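(* Let $g\in L^2(\mathbb{R})$, let $\Lambda\subset\mathbb{R}^2$ be uniformly discrete with separation constant $\delta>0$, and put $G:=V_\phi g$. \begin{enumerate} \item If $G(g,\Lambda)$ is a Riesz sequence, then there is a constant $C>0$, depending only on $\delta$ and the Riesz sequence bounds, such that for every $R>0$ \[ \sup_{(a,b)\in\mathbb{R}^2}|\Lambda\cap Q_{(a,b)}(R)|\le (2R+1)^2+C\,I_G\!\left(R+\tfrac14\right). \] \item If $G(g,\Lambda)$ is a frame, then there is a constant $C>0$, depending only on $\delta$ and the frame bounds, such that for every $R>\tfrac12$ \[ \inf_{(a,b)\in\mathbb{R}^2}|\Lambda\cap Q_{(a,b)}(R)|\ge (2R-1)^2-C\,I_G\!\left(R-\tfrac12\right). \] \end{enumerate}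
   Context: For $g\in L^2(\mathbb{R})$ and $(a,b)\in\mathbb{R}^2$ put $g_{ab}(t)=e^{2\pi i b t}g(t-a)$. For $\Lambda\subset\mathbb{R}^2$, the Gabor system is $G(g,\Lambda)=\{g_{\lambda\mu}\}_{(\lambda,\mu)\in\Lambda}$. Fix the Gaussian window $\phi(t)=c\,e^{-t^2}$, with $c>0$ chosen so that $\|\phi\|_{L^2(\mathbb{R})}=1$. The short-time Fourier transform is $V_\phi g(x,y)=\langle g,\phi_{xy}\rangle=\int_{\mathbb{R}} g(t)\overline{\phi(t-x)}e^{-2\pi i y t}\,dt$. $Q_{(a,b)}(R)=\{(x,y)\in\mathbb{R}^2:|x-a|\le R,\ |y-b|\le R\}$ and $Q^c_{(a,b)}(R)=\mathbb{R}^2\setminus Q_{(a,b)}(R)$. $\Lambda$ is uniformly discrete with separation constant $\delta$ if distinct points of $\Lambda$ are at distance greater than $\delta$. $|\Lambda\cap S|$ denotes the number of points of $\Lambda$ in $S$. For $G\in L^2(\mathbb{R}^2)$ and $R>0$, \[ I_G(R):=\int_{Q_0(R)}\int_{Q^c_0(R+\frac14)}|G(t-x,s-y)|^2\,dt\,ds\,dx\,dy, \] where $(x,y)$ ranges over $Q_0(R)$ and $(t,s)$ over $Q_0^c(R+\tfrac14)$. A system $\{f_n\}$ in a Hilbert space $H$ is a Riesz sequence if there are $A,B>0$ with $A\sum|a_n|^2\le\|\sum a_nf_n\|^2\le B\sum|a_n|^2$ for all $(a_n)\in\ell^2$. It is a frame if there are $A,B>0$ with $A\|f\|^2\le\sum|\langle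 f,f_n\rangle|^2\le B\|f\|^2$ for all $f\in H$. *)

theory Defs
  imports "HOL-Analysis.Analysis"
begin

definition L2 :: "(real \<Rightarrow> complex) set" where
  "L2 = {f. f \<in> borel_measurable lborel \<and> integrable lborel (\<lambda>t. (cmod (f t))^2)}"

definition l2_inner :: "(real \<Rightarrow> complex) \<Rightarrow> (real \<Rightarrow> complex) \<Rightarrow> complex" where
  "l2_inner f h = (LINT t|lborel. f t * cnj (h t))"

definition l2_norm :: "(real \<Rightarrow> complex) \<Rightarrow> real" where
  "l2_norm f = sqrt (LINT t|lborel. (cmod (f t))^2)"

definition tf_shift :: "(real \<Rightarrow> complex) \<Rightarrow> real \<times> real \<Rightarrow> real \<Rightarrow> complex" where
  "tf_shift g p t = cis (2 * pi * snd p * t) * g (t - fst p)"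

text \<open>Gaussian window phi(t) = c e^{-t^2}, c > 0 chosen with L2 norm 1.\<close>
definition gauss_c :: real where
  "gauss_c = 1 / sqrt (LINT t|lborel. (exp (- (t^2)))^2)"

definition gauss_phi :: "real \<Rightarrow> real" where
  "gauss_phi t = gauss_c * exp (- (t^2))"

definition stft :: "(real \<Rightarrow> complex) \<Rightarrow> real \<times> real \<Rightarrow> complex" where
  "stft g p = (LINT t|lborel. g t * cnj (complex_of_real (gauss_phi (t - fst p)))
                 * cis (- 2 * pi * snd p * t))"

definition sqr :: "real \<times> real \<Rightarrow> real \<Rightarrow> (real \<times> real) set" where
  "sqr c R = {(x, y). \<bar>x - fst c\<bar> \<le> R \<and> \<bar>y - snd c\<bar> \<le> R}"

definition I_G :: "(real \<times> real \<Rightarrow> complex) \<Rightarrow> real \<Rightarrow> real" where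
  "I_G G R = (LINT p : sqr (0, 0) R | lborel.
               (LINT q : - sqr (0, 0) (R + 1/4) | lborel. (cmod (G (q - p)))^2))"

definition uniformly_discrete :: "real \<Rightarrow> (real \<times> real) set \<Rightarrow> bool" where
  "uniformly_discrete \<delta> \<Lambda> \<longleftrightarrow> (\<forall>p\<in>\<Lambda>. \<forall>q\<in>\<Lambda>. p \<noteq> q \<longrightarrow> dist p q > \<delta>)"

text \<open>Riesz sequence with bounds A, B (inequality for all finitely supported coefficient
  sequences, which by density is the same as for all of l2).\<close>
definition gabor_riesz_seq :: "(real \<Rightarrow> complex) \<Rightarrow> (real \<times> real) set \<Rightarrow> real \<Rightarrow> real \<Rightarrow> bool" where
  "gabor_riesz_seq g \<Lambda> A B \<longleftrightarrow> 0 < A \<and> 0 < B \<and>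
     (\<forall>F c. finite F \<longrightarrow> F \<subseteq> \<Lambda> \<longrightarrow>
        A * (\<Sum>p\<in>F. (cmod (c p))^2) \<le> (l2_norm (\<lambda>t. \<Sum>p\<in>F. c p * tf_shift g p t))^2 \<and>
        (l2_norm (\<lambda>t. \<Sum>p\<in>F. c p * tf_shift g p t))^2 \<le> B * (\<Sum>p\<in>F. (cmod (c p))^2))"

definition gabor_frame :: "(real \<Rightarrow> complex) \<Rightarrow> (real \<times> real) set \<Rightarrow> real \<Rightarrow> real \<Rightarrow> bool" where
  "gabor_frame g \<Lambda> A B \<longleftrightarrow> 0 < A \<and> 0 < B \<and>
     (\<forall>f\<in>L2. (\<lambda>p. (cmod (l2_inner f (tf_shift g p)))^2) summable_on \<Lambda> \<and>
        A * (l2_norm f)^2 \<le> (\<Sum>\<^sub>\<infinity>p\<in>\<Lambda>. (cmod (l2_inner f (tf_shift g p)))^2) \<and>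
        (\<Sum>\<^sub>\<infinity>p\<in>\<Lambda>. (cmod (l2_inner f (tf_shift g p)))^2) \<le> B * (l2_norm f)^2)"

end

theory Submission
  imports Defs "HOL-Probability.Characteristic_Functions"
begin

text \<open>
  Write \<open>\<phi>\<^sub>z\<close> for the time-frequency shifts of the window, so that \<open>stft f z = \<langle>f, \<phi>\<^sub>z\<rangle>\<close>. By Moyal's
  identity the functions \<open>\<phi>\<^sub>z\<close> resolve the identity, so the trace of a finite-rank projection \<open>P\<close>
  is the integral of \<open>\<parallel>P \<phi>\<^sub>z\<parallel>\<^sup>2\<close>, an integrand bounded by \<open>1\<close>.

  For a Riesz sequence let \<open>P\<close> project onto the span of the \<open>n\<close> shifts of \<open>g\<close> by points of
  \<open>\<Lambda>\<close> in a square \<open>Q\<close>. Then \<open>n\<close> is at most the area of the enlarged square plus the integral of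
  \<open>\<parallel>P \<phi>\<^sub>z\<parallel>\<^sup>2\<close> over its complement, and there \<open>A \<parallel>P \<phi>\<^sub>z\<parallel>\<^sup>2 \<le> \<Sum> |G (z - \<lambda>)|\<^sup>2\<close>. For a frame,
  the form \<open>\<Sum> |\<langle>f, g\<^sub>\<lambda>\<rangle>|\<^sup>2\<close> over the points outside \<open>Q\<close> is bounded below by
  \<open>A \<parallel>f - P f\<parallel>\<^sup>2\<close> for some \<open>P\<close> of rank \<open>n\<close>, up to an arbitrarily small error; integrating
  over the shrunken square with \<open>f = \<phi>\<^sub>z\<close> gives the lower bound for \<open>n\<close>.

  The sums over \<open>\<lambda>\<close> are compared with integrals as follows: the short-time Fourier transform with
  Gaussian window is an entire function of \<open>x - \<i> \<pi> y\<close> times a weight, so \<open>|G|\<^sup>2\<close> at a point is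
  at most a constant times its integral over a small square around the point, and the squares
  around the points of \<open>\<Lambda>\<close> are disjoint.
\<close>

subsection \<open>Square-integrable functions\<close>

text \<open>Elements of \<open>L2\<close> are representatives rather than classes, and subspaces
  enter only through finite families of functions. A projection P is therefore encoded by a family
  \<open>e\<close>, and \<parallel>f - P f\<parallel>^2 by the positive semidefinite form
  \<open>bessel_defect e n\<close>; enlarging the family acts on this form as a Schur complement.
  The Riesz side uses that the phase-space density of P is at most 1 and has total mass exactly n;
  the frame side uses that the total mass is at most n.

  The obstacle on the frame side is the finite-dimensional space itself: it should be spanned by
  minimisers of a form that may have no minimisers. Near-minimisers replace them, and the error
  \<eta> is removed only after integration over a square of finite area.

  The area (2 R + 1)^2 or (2 R - 1)^2 belongs to a half-width shifted by 1/2. Half of this shift is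
  room for the small squares around the points, the other half is the gap of 1/4 built into
  \<open>I_G\<close>.\<close>

lemma L2_measurable: "f \<in> L2 \<Longrightarrow> f \<in> borel_measurable borel"
  by (simp add: L2_def)

lemma L2_integrable_sq: "f \<in> L2 \<Longrightarrow> integrable lborel (\<lambda>t. (cmod (f t))\<^sup>2)"
  by (simp add: L2_def)

lemma L2_I: "f \<in> borel_measurable borel \<Longrightarrow> integrable lborel (\<lambda>t. (cmod (f t))\<^sup>2) \<Longrightarrow> f \<in> L2"
  by (simp add: L2_def)

lemma L2_add:
  assumes f: "f \<in> L2" and h: "h \<in> L2"
  shows "(\<lambda>t. f t + h t) \<in> L2"
proof (rule L2_I)
  note [measurable] = L2_measurable[OF f] L2_measurable[OF h]
  show "(\<lambda>t. f t + h t) \<in> borel_measurable borel" by measurable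
  have "integrable lborel (\<lambda>t. 2 * (cmod (f t))\<^sup>2 + 2 * (cmod (h t))\<^sup>2)"
    using L2_integrable_sq[OF f] L2_integrable_sq[OF h] by simp
  then show "integrable lborel (\<lambda>t. (cmod (f t + h t))\<^sup>2)"
  proof (rule Bochner_Integration.integrable_bound)
    show "AE t in lborel. norm ((cmod (f t + h t))\<^sup>2) \<le> norm (2 * (cmod (f t))\<^sup>2 + 2 * (cmod (h t))\<^sup>2)"
    proof (rule AE_I2)
      fix t
      have "(cmod (f t + h t))\<^sup>2 \<le> (cmod (f t) + cmod (h t))\<^sup>2"
        by (intro power_mono norm_triangle_ineq) auto
      also have "\<dots> \<le> 2 * (cmod (f t))\<^sup>2 + 2 * (cmod (h t))\<^sup>2"
        using zero_le_power2[of "cmod (f t) - cmod (h t)"] by (simp add: power2_sum power2_diff)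
      finally show "norm ((cmod (f t + h t))\<^sup>2) \<le> norm (2 * (cmod (f t))\<^sup>2 + 2 * (cmod (h t))\<^sup>2)"
        by simp
    qed
  qed measurable
qed

lemma L2_scale: "f \<in> L2 \<Longrightarrow> (\<lambda>t. c * f t) \<in> L2"
  unfolding L2_def by (auto simp: norm_mult power_mult_distrib)

lemma L2_zero [simp]: "(\<lambda>t. 0) \<in> L2"
  by (simp add: L2_def)

lemma L2_sum: "finite F \<Longrightarrow> (\<And>i. i \<in> F \<Longrightarrow> e i \<in> L2) \<Longrightarrow> (\<lambda>t. \<Sum>i\<in>F. c i * e i t) \<in> L2"
  by (induction F rule: finite_induct) (auto intro!: L2_add L2_scale)

lemma L2_mult_integrable:
  assumes f: "f \<in> L2" and h: "h \<in> L2"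
  shows "integrable lborel (\<lambda>t. f t * h t)"
proof (rule Bochner_Integration.integrable_bound)
  note [measurable] = L2_measurable[OF f] L2_measurable[OF h]
  show "integrable lborel (\<lambda>t. (cmod (f t))\<^sup>2 + (cmod (h t))\<^sup>2)"
    using L2_integrable_sq[OF f] L2_integrable_sq[OF h] by simp
  show "(\<lambda>t. f t * h t) \<in> borel_measurable lborel" by measurable
  show "AE t in lborel. norm (f t * h t) \<le> norm ((cmod (f t))\<^sup>2 + (cmod (h t))\<^sup>2)"
  proof (rule AE_I2)
    fix t
    have "cmod (f t) * cmod (h t) \<le> (cmod (f t))\<^sup>2 + (cmod (h t))\<^sup>2"
      using zero_le_power2[of "cmod (f t) - cmod (h t)"] zero_le_power2[of "cmod (f t)"]
        zero_le_power2[of "cmod (h t)"]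
      unfolding power2_diff by linarith
    then show "norm (f t * h t) \<le> norm ((cmod (f t))\<^sup>2 + (cmod (h t))\<^sup>2)"
      by (simp add: norm_mult)
  qed
qed

lemma L2_cnj:
  assumes "f \<in> L2"
  shows "(\<lambda>t. cnj (f t)) \<in> L2"
proof (rule L2_I)
  note [measurable] = L2_measurable[OF assms]
  have "cnj \<in> borel_measurable borel"
    by (intro borel_measurable_continuous_onI continuous_intros)
  then show "(\<lambda>t. cnj (f t)) \<in> borel_measurable borel" by measurable
qed (simp add: L2_integrable_sq assms)

lemma L2_inner_integrable: "f \<in> L2 \<Longrightarrow> h \<in> L2 \<Longrightarrow> integrable lborel (\<lambda>t. f t * cnj (h t))"
  using L2_mult_integrable[OF _ L2_cnj] by blast

lemma l2_inner_self: "l2_inner f f = of_real (LINT t|lborel. (cmod (f t))\<^sup>2)"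
  unfolding l2_inner_def complex_norm_square[symmetric]
  by (simp only: integral_complex_of_real)

lemma l2_norm_sq: "(l2_norm f)\<^sup>2 = (LINT t|lborel. (cmod (f t))\<^sup>2)"
  unfolding l2_norm_def by (simp add: integral_nonneg_AE)

lemma Re_l2_inner_self: "Re (l2_inner f f) = (l2_norm f)\<^sup>2"
  by (simp add: l2_inner_self l2_norm_sq)

subsection \<open>Positive hermitian forms\<close>

text \<open>One set of axioms for the inner product, the defect of a Bessel family and the tail of a
  frame form. Semidefiniteness is the right strength because the last two may have nonzero kernels.
  Linearity is recorded in the first argument; hermitian symmetry transfers it to the
  second.\<close>

definition psd_form :: "((real \<Rightarrow> complex) \<Rightarrow> (real \<Rightarrow> complex) \<Rightarrow> complex) \<Rightarrow> bool" where
  "psd_form p \<longleftrightarrow>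
     (\<forall>f\<in>L2. \<forall>h\<in>L2. \<forall>k\<in>L2. p (\<lambda>t. f t + h t) k = p f k + p h k) \<and>
     (\<forall>c. \<forall>f\<in>L2. \<forall>h\<in>L2. p (\<lambda>t. c * f t) h = c * p f h) \<and>
     (\<forall>f\<in>L2. \<forall>h\<in>L2. p h f = cnj (p f h)) \<and>
     (\<forall>f\<in>L2. 0 \<le> Re (p f f))"

context
  fixes p assumes psd: "psd_form p"
begin

lemma psd_add: "f \<in> L2 \<Longrightarrow> h \<in> L2 \<Longrightarrow> k \<in> L2 \<Longrightarrow> p (\<lambda>t. f t + h t) k = p f k + p h k"
  using psd unfolding psd_form_def by blast

lemma psd_scale: "f \<in> L2 \<Longrightarrow> h \<in> L2 \<Longrightarrow> p (\<lambda>t. c * f t) h = c * p f h"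
  using psd unfolding psd_form_def by blast

lemma psd_herm: "f \<in> L2 \<Longrightarrow> h \<in> L2 \<Longrightarrow> p h f = cnj (p f h)"
  using psd unfolding psd_form_def by blast

lemma psd_nonneg: "f \<in> L2 \<Longrightarrow> 0 \<le> Re (p f f)"
  using psd unfolding psd_form_def by blast

lemma psd_add_right: "f \<in> L2 \<Longrightarrow> h \<in> L2 \<Longrightarrow> k \<in> L2 \<Longrightarrow> p k (\<lambda>t. f t + h t) = p k f + p k h"
  by (simp add: psd_herm[of _ k] L2_add psd_add)

lemma psd_scale_right: "f \<in> L2 \<Longrightarrow> h \<in> L2 \<Longrightarrow> p h (\<lambda>t. c * f t) = cnj c * p h f"
  by (simp add: psd_herm[of _ h] L2_scale psd_scale)

lemma psd_zero: "f \<in> L2 \<Longrightarrow> p (\<lambda>t. 0) f = 0"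
  using psd_scale[of "\<lambda>t. 0" f 0] by simp

lemma psd_sum:
  "finite F \<Longrightarrow> (\<And>i. i \<in> F \<Longrightarrow> e i \<in> L2) \<Longrightarrow> h \<in> L2 \<Longrightarrow>
    p (\<lambda>t. \<Sum>i\<in>F. c i * e i t) h = (\<Sum>i\<in>F. c i * p (e i) h)"
proof (induction F rule: finite_induct)
  case empty
  then show ?case by (simp add: psd_zero)
next
  case (insert x F)
  then show ?case by (simp add: psd_add psd_scale L2_scale L2_sum)
qed

lemma psd_sum_right:
  assumes "finite F" "\<And>i. i \<in> F \<Longrightarrow> e i \<in> L2" "h \<in> L2"
  shows "p h (\<lambda>t. \<Sum>i\<in>F. c i * e i t) = (\<Sum>i\<in>F. cnj (c i) * p h (e i))"
proof -
  have "p h (\<lambda>t. \<Sum>i\<in>F. c i * e i t) = cnj (p (\<lambda>t. \<Sum>i\<in>F. c i * e i t) h)"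
    using assms by (intro psd_herm L2_sum) auto
  also have "\<dots> = (\<Sum>i\<in>F. cnj (c i) * p h (e i))"
    using assms by (simp add: psd_sum psd_herm[of _ h])
  finally show ?thesis .
qed

lemma psd_expand:
  assumes f: "f \<in> L2" and h: "h \<in> L2"
  shows "Re (p (\<lambda>t. f t + s * h t) (\<lambda>t. f t + s * h t))
    = Re (p f f) + 2 * Re (cnj s * p f h) + (cmod s)\<^sup>2 * Re (p h h)"
proof -
  have "p (\<lambda>t. f t + s * h t) (\<lambda>t. f t + s * h t)
     = p f f + cnj s * p f h + (s * p h f + s * (cnj s * p h h))"
    using f h by (simp add: psd_add psd_add_right psd_scale psd_scale_right L2_add L2_scale algebra_simps)
  moreover have "s * p h f = cnj (cnj s * p f h)"
    using f h by (simp add: psd_herm[of f h])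
  moreover have "Re (s * (cnj s * p h h)) = (cmod s)\<^sup>2 * Re (p h h)"
    unfolding cmod_power2 by (simp add: power2_eq_square algebra_simps)
  ultimately show ?thesis by simp
qed

end

text \<open>The quadratic is tested at s = - x b with x real: x = 1/d settles d > 0, and for d = 0 a
  large x would make the value negative unless b = 0. It is stated for numbers because it serves
  Cauchy-Schwarz and also a case where \<open>a\<close> is a tolerance rather than a value of the
  form.\<close>

lemma discriminant_bound:
  fixes b :: complex and a d :: real
  assumes pos: "\<And>s. 0 \<le> a + 2 * Re (cnj s * b) + (cmod s)\<^sup>2 * d" and d: "0 \<le> d"
  shows "(cmod b)\<^sup>2 \<le> a * d"
proof -
  have eq: "0 \<le> a - 2 * x * (cmod b)\<^sup>2 + x\<^sup>2 * (cmod b)\<^sup>2 * d" for x :: real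
  proof -
    have "Re (cnj (- of_real x * b) * b) = - (x * (cmod b)\<^sup>2)"
      unfolding cmod_power2 by (simp add: power2_eq_square algebra_simps)
    moreover have "(cmod (- of_real x * b))\<^sup>2 = x\<^sup>2 * (cmod b)\<^sup>2"
      by (simp add: norm_mult power_mult_distrib)
    ultimately show ?thesis using pos[of "- of_real x * b"] by simp
  qed
  show ?thesis
  proof (cases "d = 0")
    case False
    then have "d > 0" using d by simp
    then have "0 \<le> (a - (cmod b)\<^sup>2 / d)"
      using eq[of "1/d"] by (simp add: power2_eq_square field_simps)
    then show ?thesis using \<open>d > 0\<close> by (simp add: field_simps)
  next
    case True
    have "(cmod b)\<^sup>2 = 0"
    proof (rule ccontr)
      assume nz: "(cmod b)\<^sup>2 \<noteq> 0"
      have "0 \<le> a - 2 * ((a + 1) / (2 * (cmod b)\<^sup>2)) * (cmod b)\<^sup>2"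
        using eq[of "(a + 1) / (2 * (cmod b)\<^sup>2)"] True by simp
      also have "\<dots> = -1" using nz by (simp add: field_simps)
      finally show False by simp
    qed
    then show ?thesis using True by simp
  qed
qed

lemma psd_cauchy_schwarz:
  assumes "psd_form p" "f \<in> L2" "h \<in> L2"
  shows "(cmod (p f h))\<^sup>2 \<le> Re (p f f) * Re (p h h)"
proof (rule discriminant_bound)
  show "0 \<le> Re (p f f) + 2 * Re (cnj s * p f h) + (cmod s)\<^sup>2 * Re (p h h)" for s
    using assms unfolding psd_expand[OF assms, symmetric]
    by (intro psd_nonneg L2_add L2_scale)
qed (use assms in \<open>auto intro: psd_nonneg\<close>)

text \<open>The left side is the minimum of the quadratic in s on the right; the proof completes the
  square in |p f k + s p k k|^2 and divides by p k k.\<close>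

lemma psd_min_line:
  assumes p: "psd_form p" and f: "f \<in> L2" and k: "k \<in> L2" and pos: "Re (p k k) > 0"
  shows "Re (p f f) - (cmod (p f k))\<^sup>2 / Re (p k k) \<le> Re (p (\<lambda>t. f t + s * k t) (\<lambda>t. f t + s * k t))"
proof -
  let ?d = "Re (p k k)" and ?b = "p f k"
  have "0 \<le> (cmod (?b + of_real ?d * s))\<^sup>2" by simp
  also have "\<dots> = (cmod ?b)\<^sup>2 + 2 * ?d * Re (cnj s * ?b) + ?d\<^sup>2 * (cmod s)\<^sup>2"
    unfolding cmod_power2 by (simp add: power2_eq_square algebra_simps)
  finally have "0 \<le> ((cmod ?b)\<^sup>2 + 2 * ?d * Re (cnj s * ?b) + ?d\<^sup>2 * (cmod s)\<^sup>2) / ?d"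
    using pos by simp
  also have "\<dots> = (cmod ?b)\<^sup>2 / ?d + 2 * Re (cnj s * ?b) + (cmod s)\<^sup>2 * ?d"
    using pos by (simp add: field_simps power2_eq_square)
  finally show ?thesis unfolding psd_expand[OF p f k] by simp
qed

lemma psd_form_l2_inner: "psd_form l2_inner"
  unfolding psd_form_def
proof (intro conjI ballI allI)
  fix f h k assume "f \<in> L2" "h \<in> L2" "k \<in> L2"
  then show "l2_inner (\<lambda>t. f t + h t) k = l2_inner f k + l2_inner h k"
    unfolding l2_inner_def by (simp add: distrib_right L2_inner_integrable)
next
  fix c f h
  show "l2_inner (\<lambda>t. c * f t) h = c * l2_inner f h"
    unfolding l2_inner_def by (simp add: mult.assoc)
next
  fix f h
  show "l2_inner h f = cnj (l2_inner f h)"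
    unfolding l2_inner_def by (subst Bochner_Integration.integral_cnj[symmetric]) (simp add: mult.commute)
next
  fix f show "0 \<le> Re (l2_inner f f)" by (simp add: Re_l2_inner_self)
qed

lemma l2_cauchy_schwarz:
  "f \<in> L2 \<Longrightarrow> h \<in> L2 \<Longrightarrow> (cmod (l2_inner f h))\<^sup>2 \<le> (l2_norm f)\<^sup>2 * (l2_norm h)\<^sup>2"
  using psd_cauchy_schwarz[OF psd_form_l2_inner] by (simp add: Re_l2_inner_self)

lemma l2_norm_nonneg [simp]: "0 \<le> l2_norm f"
  by (simp add: l2_norm_def integral_nonneg_AE)

lemma l2_cauchy_schwarz_norm:
  assumes "f \<in> L2" "h \<in> L2"
  shows "cmod (l2_inner f h) \<le> l2_norm f * l2_norm h"
  by (rule power2_le_imp_le) (use l2_cauchy_schwarz[OF assms] in \<open>simp_all add: power_mult_distrib\<close>)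

lemma l2_norm_add_scale_le:
  assumes f: "f \<in> L2" and k: "k \<in> L2"
  shows "l2_norm (\<lambda>t. f t + s * k t) \<le> l2_norm f + cmod s * l2_norm k"
proof (rule power2_le_imp_le)
  have "Re (cnj s * l2_inner f k) \<le> cmod (cnj s * l2_inner f k)" by (rule complex_Re_le_cmod)
  also have "\<dots> \<le> cmod s * (l2_norm f * l2_norm k)"
    using l2_cauchy_schwarz_norm[OF f k] by (simp add: norm_mult mult_left_mono)
  finally have "(l2_norm (\<lambda>t. f t + s * k t))\<^sup>2
      \<le> (l2_norm f)\<^sup>2 + 2 * (cmod s * (l2_norm f * l2_norm k)) + (cmod s)\<^sup>2 * (l2_norm k)\<^sup>2"
    using psd_expand[OF psd_form_l2_inner f k, of s] by (simp add: Re_l2_inner_self)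
  also have "\<dots> = (l2_norm f + cmod s * l2_norm k)\<^sup>2"
    by (simp add: power2_eq_square algebra_simps)
  finally show "(l2_norm (\<lambda>t. f t + s * k t))\<^sup>2 \<le> (l2_norm f + cmod s * l2_norm k)\<^sup>2" .
qed simp

lemma l2_inner_zero_right [simp]: "l2_inner f (\<lambda>t. 0) = 0"
  by (simp add: l2_inner_def)

lemma psd_form_add_rank1:
  assumes p: "psd_form p" and g: "g \<in> L2"
  shows "psd_form (\<lambda>f h. p f h + l2_inner f g * cnj (l2_inner h g))"
  unfolding psd_form_def
proof (intro conjI ballI allI)
  fix f assume "f \<in> L2"
  then show "0 \<le> Re (p f f + l2_inner f g * cnj (l2_inner f g))"
    using psd_nonneg[OF p] by (simp add: complex_mult_cnj)
next
  fix f h assume "f \<in> L2" "h \<in> L2"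
  then show "p h f + l2_inner h g * cnj (l2_inner f g) = cnj (p f h + l2_inner f g * cnj (l2_inner h g))"
    using psd_herm[OF p, of f h] by (simp add: mult.commute)
qed (use g in \<open>auto simp: psd_add[OF p] psd_scale[OF p] psd_add[OF psd_form_l2_inner]
      psd_scale[OF psd_form_l2_inner] algebra_simps\<close>)

subsection \<open>Bessel families\<close>

text \<open>The squared distance form to the span, when the family is orthonormal. Only positivity of this
  form (Bessel's inequality) is needed below, and it survives for families that are merely
  Bessel with bound 1.\<close>
definition bessel_defect ::
  "(nat \<Rightarrow> real \<Rightarrow> complex) \<Rightarrow> nat \<Rightarrow> (real \<Rightarrow> complex) \<Rightarrow> (real \<Rightarrow> complex) \<Rightarrow> complex" where
  "bessel_defect e n f h = l2_inner f h - (\<Sum>i<n. l2_inner f (e i) * cnj (l2_inner h (e i)))"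

lemma Re_bessel_defect:
  "Re (bessel_defect e n f f) = (l2_norm f)\<^sup>2 - (\<Sum>i<n. (cmod (l2_inner f (e i)))\<^sup>2)"
  by (simp add: bessel_defect_def Re_l2_inner_self complex_mult_cnj cmod_power2)

lemma Re_bessel_defect_le: "Re (bessel_defect e n f f) \<le> (l2_norm f)\<^sup>2"
  unfolding Re_bessel_defect by (simp add: sum_nonneg)

text \<open>The residual k - P k, written as a sum with negated coefficients so that the linearity
  rules for finite sums apply verbatim.\<close>

definition proj_compl ::
  "(nat \<Rightarrow> real \<Rightarrow> complex) \<Rightarrow> nat \<Rightarrow> (real \<Rightarrow> complex) \<Rightarrow> real \<Rightarrow> complex" where
  "proj_compl e n k = (\<lambda>t. k t + (\<Sum>i<n. (- l2_inner k (e i)) * e i t))"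

lemma proj_compl_L2: "(\<And>i. i < n \<Longrightarrow> e i \<in> L2) \<Longrightarrow> k \<in> L2 \<Longrightarrow> proj_compl e n k \<in> L2"
  unfolding proj_compl_def by (intro L2_add L2_sum) auto

lemma l2_inner_proj_compl:
  assumes e: "\<And>i. i < n \<Longrightarrow> e i \<in> L2" and k: "k \<in> L2" and f: "f \<in> L2"
  shows "l2_inner f (proj_compl e n k) = bessel_defect e n f k"
proof -
  note P = psd_form_l2_inner
  have "l2_inner f (proj_compl e n k)
      = l2_inner f k + (\<Sum>i<n. cnj (- l2_inner k (e i)) * l2_inner f (e i))"
    unfolding proj_compl_def
    using psd_add_right[OF P k L2_sum[of "{..<n}" e "\<lambda>i. - l2_inner k (e i)"] f]
      psd_sum_right[OF P, of "{..<n}" e f "\<lambda>i. - l2_inner k (e i)"] e f by simp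
  also have "\<dots> = bessel_defect e n f k"
    unfolding bessel_defect_def by (simp add: sum_negf mult.commute)
  finally show ?thesis .
qed

lemma psd_bessel_defect_proj_compl:
  assumes N: "psd_form (bessel_defect e n)" and e: "\<And>i. i < n \<Longrightarrow> e i \<in> L2"
    and k: "k \<in> L2" and f: "f \<in> L2"
  shows "bessel_defect e n (proj_compl e n k) f
    = bessel_defect e n k f - (\<Sum>i<n. l2_inner k (e i) * bessel_defect e n (e i) f)"
proof -
  have "bessel_defect e n (proj_compl e n k) f
    = bessel_defect e n k f + (\<Sum>i<n. (- l2_inner k (e i)) * bessel_defect e n (e i) f)"
    unfolding proj_compl_def
    using psd_add[OF N k L2_sum[of "{..<n}" e "\<lambda>i. - l2_inner k (e i)"] f]
      psd_sum[OF N, of "{..<n}" e f "\<lambda>i. - l2_inner k (e i)"] e f by simp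
  then show ?thesis by (simp add: sum_negf)
qed

text \<open>Unit norms and Bessel's inequality force orthonormality: the term i = j alone exhausts
  the norm of \<open>e j\<close>, so \<open>e j\<close> has zero defect and lies in the kernel of
  the form by Cauchy-Schwarz. Replacing k by its residual in the first argument then changes
  nothing.\<close>

lemma l2_norm_proj_compl:
  assumes N: "psd_form (bessel_defect e n)" and e: "\<And>i. i < n \<Longrightarrow> e i \<in> L2" and k: "k \<in> L2"
    and one: "\<And>i. i < n \<Longrightarrow> (l2_norm (e i))\<^sup>2 = 1"
  shows "(l2_norm (proj_compl e n k))\<^sup>2 = Re (bessel_defect e n k k)"
proof -
  let ?P = "proj_compl e n k"
  have zero: "bessel_defect e n (e j) k = 0" if j: "j < n" for j
  proof -
    have "(cmod (l2_inner (e j) (e j)))\<^sup>2 \<le> (\<Sum>i<n. (cmod (l2_inner (e j) (e i)))\<^sup>2)"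
      using j by (intro member_le_sum) auto
    moreover have "cmod (l2_inner (e j) (e j)) = 1"
      using one[OF j] by (simp add: l2_inner_self l2_norm_sq)
    ultimately have "Re (bessel_defect e n (e j) (e j)) \<le> 0"
      unfolding Re_bessel_defect using one[OF j] by simp
    then have "Re (bessel_defect e n (e j) (e j)) = 0"
      using psd_nonneg[OF N e[OF j]] by simp
    then show ?thesis using psd_cauchy_schwarz[OF N e[OF j] k] by simp
  qed
  have P: "?P \<in> L2" by (rule proj_compl_L2[OF e k])
  have "bessel_defect e n ?P k = bessel_defect e n k k"
    using psd_bessel_defect_proj_compl[OF N e k k] zero by simp
  then show ?thesis
    using l2_inner_proj_compl[OF e k P] by (simp flip: Re_l2_inner_self)
qed

text \<open>A Gram-Schmidt step. The residual is divided by the square root of the defect of k,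
  which is its norm when the old vectors have norm 1; for a general Bessel family it is this
  normaliser that yields the rank-one formula in \<open>bessel_defect_extend\<close>.\<close>

definition bessel_extend where
  "bessel_extend e n k =
     e(n := (\<lambda>t. of_real (1 / sqrt (Re (bessel_defect e n k k))) * proj_compl e n k t))"

context
  fixes e :: "nat \<Rightarrow> real \<Rightarrow> complex" and n k
  assumes N: "psd_form (bessel_defect e n)" and e: "\<And>i. i < n \<Longrightarrow> e i \<in> L2"
    and k: "k \<in> L2" and pos: "Re (bessel_defect e n k k) > 0"
begin

lemma bessel_extend_L2: "i < Suc n \<Longrightarrow> bessel_extend e n k i \<in> L2"
  unfolding bessel_extend_def using e L2_scale[OF proj_compl_L2[of n e k, OF e k]]
  by (cases "i = n") (simp_all del: of_real_divide)

lemma l2_inner_bessel_extend: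
  "f \<in> L2 \<Longrightarrow> l2_inner f (bessel_extend e n k n)
     = bessel_defect e n f k / of_real (sqrt (Re (bessel_defect e n k k)))"
  using psd_scale_right[OF psd_form_l2_inner proj_compl_L2[of n e k, OF e k], of f
      "complex_of_real (1 / sqrt (Re (bessel_defect e n k k)))"]
    l2_inner_proj_compl[of n e k f, OF e k]
  by (simp add: bessel_extend_def)

text \<open>The new form is the Schur complement of k in the old one, so its positivity will be
  Cauchy-Schwarz for the old form.\<close>

lemma bessel_defect_extend:
  assumes "f \<in> L2" "h \<in> L2"
  shows "bessel_defect (bessel_extend e n k) (Suc n) f h
    = bessel_defect e n f h - bessel_defect e n f k * cnj (bessel_defect e n h k) / of_real (Re (bessel_defect e n k k))"
proof -
  let ?d = "Re (bessel_defect e n k k)"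
  have "complex_of_real (sqrt ?d) * complex_of_real (sqrt ?d) = of_real ?d"
    using pos by (simp flip: of_real_mult)
  moreover have "bessel_defect (bessel_extend e n k) (Suc n) f h
    = bessel_defect e n f h - l2_inner f (bessel_extend e n k n) * cnj (l2_inner h (bessel_extend e n k n))"
    unfolding bessel_defect_def by (simp add: bessel_extend_def)
  ultimately show ?thesis
    unfolding l2_inner_bessel_extend[OF assms(1)] l2_inner_bessel_extend[OF assms(2)] by simp
qed

lemma Re_bessel_defect_extend:
  "f \<in> L2 \<Longrightarrow> Re (bessel_defect (bessel_extend e n k) (Suc n) f f)
    = Re (bessel_defect e n f f) - (cmod (bessel_defect e n f k))\<^sup>2 / Re (bessel_defect e n k k)"
  by (simp add: bessel_defect_extend complex_mult_cnj cmod_power2)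

lemma psd_bessel_defect_extend: "psd_form (bessel_defect (bessel_extend e n k) (Suc n))"
  unfolding psd_form_def
proof (intro conjI ballI allI)
  fix f assume f: "f \<in> L2"
  have "(cmod (bessel_defect e n f k))\<^sup>2 / Re (bessel_defect e n k k) \<le> Re (bessel_defect e n f f)"
    using psd_cauchy_schwarz[OF N f k] pos by (simp add: field_simps)
  then show "0 \<le> Re (bessel_defect (bessel_extend e n k) (Suc n) f f)"
    by (simp add: Re_bessel_defect_extend f)
next
  fix f h assume "f \<in> L2" "h \<in> L2"
  then show "bessel_defect (bessel_extend e n k) (Suc n) h f = cnj (bessel_defect (bessel_extend e n k) (Suc n) f h)"
    using psd_herm[OF N, of f h] by (simp add: bessel_defect_extend mult.commute)
qed (use k in \<open>auto simp: bessel_defect_extend L2_add L2_scale psd_add[OF N] psd_scale[OF N]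
      algebra_simps add_divide_distrib\<close>)

text \<open>Bessel's inequality for the extended family, applied to its new member u, bounds the
  fourth power of the norm of u by the square.\<close>

lemma bessel_extend_norm_le:
  assumes "\<And>i. i < n \<Longrightarrow> (l2_norm (e i))\<^sup>2 \<le> 1" "i < Suc n"
  shows "(l2_norm (bessel_extend e n k i))\<^sup>2 \<le> 1"
proof (cases "i = n")
  case True
  define u where "u = bessel_extend e n k n"
  have u: "u \<in> L2" unfolding u_def by (rule bessel_extend_L2) simp
  have "0 \<le> Re (bessel_defect (bessel_extend e n k) (Suc n) u u)"
    using psd_nonneg[OF psd_bessel_defect_extend u] .
  moreover have "0 \<le> (\<Sum>i<n. (cmod (l2_inner u (bessel_extend e n k i)))\<^sup>2)"
    by (intro sum_nonneg) simp
  ultimately have le: "(cmod (l2_inner u u))\<^sup>2 \<le> (l2_norm u)\<^sup>2"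
    unfolding Re_bessel_defect sum.lessThan_Suc u_def[symmetric] by linarith
  define x where "x = (l2_norm u)\<^sup>2"
  have "cmod (l2_inner u u) = x"
    by (simp add: l2_inner_self l2_norm_sq x_def)
  with le have "x\<^sup>2 \<le> x" by (simp add: x_def)
  have "x \<le> 1"
  proof (rule ccontr)
    assume "\<not> x \<le> 1"
    then have "1 * x < x * x" by (intro mult_strict_right_mono) auto
    then show False using \<open>x\<^sup>2 \<le> x\<close> by (simp add: power2_eq_square)
  qed
  then have "(l2_norm u)\<^sup>2 \<le> 1" unfolding x_def .
  then show ?thesis using True by (simp add: u_def)
next
  case False
  then show ?thesis using assms by (simp add: bessel_extend_def)
qed

lemma bessel_extend_norm_eq:
  assumes one: "\<And>i. i < n \<Longrightarrow> (l2_norm (e i))\<^sup>2 = 1" and i: "i < Suc n"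
  shows "(l2_norm (bessel_extend e n k i))\<^sup>2 = 1"
proof (cases "i = n")
  case True
  let ?d = "Re (bessel_defect e n k k)" and ?P = "proj_compl e n k"
  have "(l2_norm ?P)\<^sup>2 = ?d" by (rule l2_norm_proj_compl[OF N e k one])
  moreover have "(l2_norm (bessel_extend e n k n))\<^sup>2 = (1 / ?d) * (l2_norm ?P)\<^sup>2"
    using pos unfolding l2_norm_sq bessel_extend_def
    by (simp add: norm_mult power_mult_distrib norm_divide power_divide)
  ultimately show ?thesis using True pos by simp
next
  case False
  then show ?thesis using assms by (simp add: bessel_extend_def)
qed

end

subsection \<open>Translation in \<open>L\<^sup>1\<close>\<close>

text \<open>An \<epsilon>/3 argument: translation preserves the L1 distance of u and h, so two of
  the three pieces are the same integral. This closure under L1 approximation serves both the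
  passage from measurable to open sets and the final limit step.\<close>

lemma L1_shift_approx:
  fixes u :: "real \<Rightarrow> complex" and r :: "nat \<Rightarrow> real"
  assumes u: "integrable lborel u"
    and approx: "\<And>\<epsilon>. \<epsilon> > 0 \<Longrightarrow> \<exists>h. integrable lborel h \<and> (LINT t|lborel. cmod (u t - h t)) < \<epsilon> \<and>
         (\<lambda>n. LINT t|lborel. cmod (h (t - r n) - h t)) \<longlonglongrightarrow> 0"
  shows "(\<lambda>n. LINT t|lborel. cmod (u (t - r n) - u t)) \<longlonglongrightarrow> 0"
proof (rule LIMSEQ_I)
  fix \<epsilon> :: real assume "\<epsilon> > 0"
  then obtain h where h: "integrable lborel h" and uh: "(LINT t|lborel. cmod (u t - h t)) < \<epsilon> / 3"
    and lim: "(\<lambda>n. LINT t|lborel. cmod (h (t - r n) - h t)) \<longlonglongrightarrow> 0"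
    using approx[of "\<epsilon>/3"] by auto
  have shift: "integrable lborel (\<lambda>t. v (t - s))" if "integrable lborel v" for v :: "real \<Rightarrow> complex" and s
    using lborel_integrable_real_affine[OF that, of 1 "-s"] by (simp add: algebra_simps)
  obtain N where N: "\<And>n. n \<ge> N \<Longrightarrow> norm ((LINT t|lborel. cmod (h (t - r n) - h t)) - 0) < \<epsilon> / 3"
    using LIMSEQ_D[OF lim, of "\<epsilon>/3"] \<open>\<epsilon> > 0\<close> by auto
  show "\<exists>N. \<forall>n\<ge>N. norm ((LINT t|lborel. cmod (u (t - r n) - u t)) - 0) < \<epsilon>"
  proof (intro exI allI impI)
    fix n assume "n \<ge> N"
    note int = u h shift[OF u] shift[OF h]
    have "(LINT t|lborel. cmod (u (t - r n) - u t))
       \<le> (LINT t|lborel. cmod (u (t - r n) - h (t - r n)) + cmod (h (t - r n) - h t) + cmod (u t - h t))"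
    proof (rule integral_mono)
      fix t
      have "u (t - r n) - u t = (u (t - r n) - h (t - r n)) + (h (t - r n) - h t) - (u t - h t)"
        by simp
      then show "cmod (u (t - r n) - u t) \<le> cmod (u (t - r n) - h (t - r n)) + cmod (h (t - r n) - h t) + cmod (u t - h t)"
        by (metis norm_triangle_ineq norm_triangle_ineq4 order_trans add_right_mono)
    qed (use int in auto)
    also have "\<dots> = (LINT t|lborel. cmod (u (t - r n) - h (t - r n)))
        + (LINT t|lborel. cmod (h (t - r n) - h t)) + (LINT t|lborel. cmod (u t - h t))"
      using int by simp
    also have "(LINT t|lborel. cmod (u (t - r n) - h (t - r n))) = (LINT t|lborel. cmod (u t - h t))"
      using lborel_integral_real_affine[of 1 "\<lambda>t. cmod (u t - h t)" "- r n"] by (simp add: algebra_simps)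
    finally have "(LINT t|lborel. cmod (u (t - r n) - u t)) < \<epsilon>"
      using uh N[OF \<open>n \<ge> N\<close>] by simp
    then show "norm ((LINT t|lborel. cmod (u (t - r n) - u t)) - 0) < \<epsilon>"
      by (simp add: integral_nonneg_AE)
  qed
qed

text \<open>A point of the open set U stays in U after a small shift. Hence for a(t) = 1_U(t) -
  1_U(t - r n) the positive part tends to 0 pointwise and is dominated by 1_U. Points that enter U
  are not treated pointwise: the integral of a is 0, so |a| = 2 max(0, a) - a leaves only the
  positive part.\<close>

lemma L1_shift_open:
  fixes r :: "nat \<Rightarrow> real"
  assumes U: "open U" "emeasure lborel U < \<infinity>" and r: "r \<longlonglongrightarrow> 0"
  shows "(\<lambda>n. LINT t|lborel. cmod (indicator U (t - r n) *\<^sub>R c - indicator U t *\<^sub>R c)) \<longlonglongrightarrow> 0"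
proof -
  let ?i = "indicator U :: real \<Rightarrow> real"
  let ?m = "\<lambda>n t. max 0 (?i t - ?i (t - r n))"
  have [measurable]: "U \<in> sets borel" using U by auto
  have i: "integrable lborel ?i" using U by (auto simp: integrable_indicator_iff)
  have ish: "integrable lborel (\<lambda>t. ?i (t - s))" for s
    using lborel_integrable_real_affine[OF i, of 1 "-s"] by (simp add: algebra_simps)
  have "(\<lambda>n. integral\<^sup>L lborel (?m n)) \<longlonglongrightarrow> integral\<^sup>L lborel (\<lambda>t::real. 0::real)"
  proof (rule integral_dominated_convergence[where w = ?i])
    show "AE t in lborel. (\<lambda>n. ?m n t) \<longlonglongrightarrow> 0"
    proof (rule AE_I2)
      fix t
      show "(\<lambda>n. ?m n t) \<longlonglongrightarrow> 0"
      proof (cases "t \<in> U")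
        case True
        have "(\<lambda>n. t - r n) \<longlonglongrightarrow> t - 0" by (intro tendsto_intros r)
        then have "eventually (\<lambda>n. t - r n \<in> U) sequentially"
          using True U(1) by (simp add: topological_tendstoD)
        then have "eventually (\<lambda>n. ?m n t = 0) sequentially"
          by eventually_elim (simp add: True)
        then show ?thesis by (rule tendsto_eventually)
      qed (simp add: indicator_def)
    qed
    show "AE t in lborel. norm (?m n t) \<le> ?i t" for n
      by (rule AE_I2) (auto simp: indicator_def)
  qed (use i in measurable)
  then have lim: "(\<lambda>n. (2 * cmod c) * integral\<^sup>L lborel (?m n)) \<longlonglongrightarrow> 2 * cmod c * 0"
    by (intro tendsto_intros) simp
  have eq: "(LINT t|lborel. cmod (indicator U (t - r n) *\<^sub>R c - indicator U t *\<^sub>R c))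
    = (2 * cmod c) * integral\<^sup>L lborel (?m n)" for n
  proof -
    have "(LINT t|lborel. cmod (indicator U (t - r n) *\<^sub>R c - indicator U t *\<^sub>R c))
      = (LINT t|lborel. cmod c * (2 * ?m n t - (?i t - ?i (t - r n))))"
    proof (rule Bochner_Integration.integral_cong)
      fix t
      have "cmod (indicator U (t - r n) *\<^sub>R c - indicator U t *\<^sub>R c) = \<bar>?i (t - r n) - ?i t\<bar> * cmod c"
        by (simp flip: scaleR_diff_left)
      then show "cmod (indicator U (t - r n) *\<^sub>R c - indicator U t *\<^sub>R c)
        = cmod c * (2 * ?m n t - (?i t - ?i (t - r n)))"
        by (simp add: max_def abs_if)
    qed simp
    also have "\<dots> = cmod c * (2 * integral\<^sup>L lborel (?m n)
        - (integral\<^sup>L lborel ?i - (LINT t|lborel. ?i (t - r n))))"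
      using i ish by simp
    also have "(LINT t|lborel. ?i (t - r n)) = integral\<^sup>L lborel ?i"
      using lborel_integral_real_affine[of 1 ?i "- r n"] by (simp add: algebra_simps)
    finally show ?thesis by simp
  qed
  show ?thesis unfolding eq using lim by simp
qed

text \<open>Induction over integrable functions; outer regularity replaces a set of finite measure
  by an open superset.\<close>

lemma L1_shift_continuous:
  fixes u :: "real \<Rightarrow> complex" and r :: "nat \<Rightarrow> real"
  assumes u: "integrable lborel u" and r: "r \<longlonglongrightarrow> 0"
  shows "(\<lambda>n. LINT t|lborel. cmod (u (t - r n) - u t)) \<longlonglongrightarrow> 0"
  using u
proof (induction rule: integrable_induct)
  case (base A c)
  then have int: "integrable lborel (\<lambda>x. indicator A x *\<^sub>R c)"
    by (intro integrable_scaleR_left) (auto simp: integrable_indicator_iff)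
  show ?case
  proof (rule L1_shift_approx[OF int])
    fix \<epsilon> :: real assume "\<epsilon> > 0"
    define d where "d = \<epsilon> / (cmod c + 1)"
    have d: "d > 0" using \<open>\<epsilon> > 0\<close> by (simp add: d_def add_nonneg_pos)
    obtain U where U: "open U" "A \<subseteq> U" "emeasure lborel (U - A) < d"
      using outer_regular_lborel[of A d] base d by auto
    have [measurable]: "A \<in> sets borel" "U \<in> sets borel" using base U by auto
    have "emeasure lborel U \<le> emeasure lborel (U - A) + emeasure lborel A"
      using emeasure_subadditive[of "U - A" lborel A] U(2) by (simp add: Un_absorb2)
    also have "\<dots> < \<infinity>" using U(3) base by (auto simp: less_top intro: order.strict_trans)
    finally have fin: "emeasure lborel U < \<infinity>" .
    have "(LINT t|lborel. cmod (indicator A t *\<^sub>R c - indicator U t *\<^sub>R c))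
      = (LINT t|lborel. cmod c * indicator (U - A) t)"
      using U(2) by (intro Bochner_Integration.integral_cong) (auto simp: indicator_def)
    also have "\<dots> = cmod c * measure lborel (U - A)" by simp
    also have "\<dots> \<le> cmod c * d"
      using U(3) d by (intro mult_left_mono) (auto simp: measure_def intro!: enn2real_leI)
    also have "\<dots> < (cmod c + 1) * d" using d by simp
    also have "\<dots> = \<epsilon>" unfolding d_def by (simp add: add_nonneg_eq_0_iff)
    finally have "(LINT t|lborel. cmod (indicator A t *\<^sub>R c - indicator U t *\<^sub>R c)) < \<epsilon>" .
    moreover have "integrable lborel (\<lambda>t. indicator U t *\<^sub>R c)"
      using fin by (intro integrable_scaleR_left) (auto simp: integrable_indicator_iff)
    ultimately show "\<exists>h. integrable lborel h \<and> (LINT t|lborel. cmod (indicator A t *\<^sub>R c - h t)) < \<epsilon> \<and>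
         (\<lambda>n. LINT t|lborel. cmod (h (t - r n) - h t)) \<longlonglongrightarrow> 0"
      using L1_shift_open[OF U(1) fin r, of c] by blast
  qed
next
  case (add f g)
  show ?case
  proof (rule tendsto_sandwich[OF _ _ tendsto_const])
    have shift: "integrable lborel (\<lambda>t. v (t - s))" if "integrable lborel v" for v :: "real \<Rightarrow> complex" and s
      using lborel_integrable_real_affine[OF that, of 1 "-s"] by (simp add: algebra_simps)
    note int = add(1,2) shift[OF add(1)] shift[OF add(2)]
    have "(LINT t|lborel. cmod (f (t - r n) + g (t - r n) - (f t + g t)))
       \<le> (LINT t|lborel. cmod (f (t - r n) - f t) + cmod (g (t - r n) - g t))" for n
      using int by (intro integral_mono) (auto simp: add_diff_add intro: norm_triangle_ineq)
    also have "\<dots> n = (LINT t|lborel. cmod (f (t - r n) - f t)) + (LINT t|lborel. cmod (g (t - r n) - g t))" for n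
      using int by simp
    finally show "eventually (\<lambda>n. (LINT t|lborel. cmod (f (t - r n) + g (t - r n) - (f t + g t)))
       \<le> (LINT t|lborel. cmod (f (t - r n) - f t)) + (LINT t|lborel. cmod (g (t - r n) - g t))) sequentially"
      by simp
    show "(\<lambda>n. (LINT t|lborel. cmod (f (t - r n) - f t)) + (LINT t|lborel. cmod (g (t - r n) - g t))) \<longlonglongrightarrow> 0"
      using tendsto_add[OF add(3,4)] by simp
  qed (simp add: integral_nonneg_AE)
next
  case (lim f s)
  show ?case
  proof (rule L1_shift_approx[OF lim(4)])
    fix \<epsilon> :: real assume "\<epsilon> > 0"
    \<comment> \<open>\<open>lim(3)\<close> bounds \<open>s i\<close> by twice f, so three times f
      dominates the difference.\<close>
    have "(\<lambda>i. LINT t|lborel. cmod (f t - s i t)) \<longlonglongrightarrow> (LINT t::real|lborel. (0::real))"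
    proof (rule integral_dominated_convergence[where w = "\<lambda>t. 3 * cmod (f t)"])
      note [measurable] = borel_measurable_integrable[OF lim(4)] borel_measurable_integrable[OF lim(1)]
      show "(\<lambda>t. cmod (f t - s i t)) \<in> borel_measurable lborel" for i by measurable
      show "AE t in lborel. (\<lambda>i. cmod (f t - s i t)) \<longlonglongrightarrow> 0"
        using lim(2) by (auto intro!: tendsto_eq_intros AE_I2)
      show "AE t in lborel. norm (cmod (f t - s i t)) \<le> 3 * cmod (f t)" for i
      proof (rule AE_I2)
        fix t show "norm (cmod (f t - s i t)) \<le> 3 * cmod (f t)"
          using norm_triangle_ineq4[of "f t" "s i t"] lim(3)[of t i] by simp
      qed
    qed (use lim(4) in auto)
    then obtain i where "norm ((LINT t|lborel. cmod (f t - s i t)) - 0) < \<epsilon>"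
      using LIMSEQ_D[of _ 0 \<epsilon>] \<open>\<epsilon> > 0\<close> by fastforce
    then show "\<exists>h. integrable lborel h \<and> (LINT t|lborel. cmod (f t - h t)) < \<epsilon> \<and>
         (\<lambda>n. LINT t|lborel. cmod (h (t - r n) - h t)) \<longlonglongrightarrow> 0"
      using lim(1,5) by (intro exI[of _ "s i"]) auto
  qed
qed

subsection \<open>Time-frequency shifts\<close>

lemma tf_shift_L2:
  assumes g: "g \<in> L2"
  shows "tf_shift g p \<in> L2"
proof (rule L2_I)
  note [measurable] = L2_measurable[OF g]
  have "(\<lambda>t. cis (2 * pi * snd p * t)) \<in> borel_measurable borel"
    by (intro borel_measurable_continuous_onI continuous_intros)
  then show "tf_shift g p \<in> borel_measurable borel" unfolding tf_shift_def by measurable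
  show "integrable lborel (\<lambda>t. (cmod (tf_shift g p t))\<^sup>2)"
    using lborel_integrable_real_affine[OF L2_integrable_sq[OF g], of 1 "- fst p"]
    by (simp add: tf_shift_def norm_mult algebra_simps)
qed

lemma l2_norm_tf_shift: "l2_norm (tf_shift g p) = l2_norm g"
  using lborel_integral_real_affine[of 1 "\<lambda>t. (cmod (g t))\<^sup>2" "- fst p"]
  by (simp add: l2_norm_def tf_shift_def norm_mult algebra_simps)

lemma tf_shift_time: "tf_shift u (r, 0) = (\<lambda>t. u (t - r))"
  by (simp add: tf_shift_def fun_eq_iff)

text \<open>Cutting \<open>u\<close> off where it is large reduces continuity of the autocorrelation of an
  \<open>L\<^sup>2\<close> function to continuity of translation in \<open>L\<^sup>1\<close>.\<close>
lemma autocorrelation_continuous: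
  assumes L2: "u \<in> L2" and L1: "integrable lborel u" and r: "r \<longlonglongrightarrow> 0"
  shows "(\<lambda>n. l2_inner u (\<lambda>t. u (t - r n))) \<longlonglongrightarrow> l2_inner u u"
proof (rule LIMSEQ_I)
  fix \<epsilon> :: real assume \<epsilon>: "\<epsilon> > 0"
  note [measurable] = L2_measurable[OF L2]
  define cut where "cut M t = (if cmod (u t) \<le> real M then u t else 0)" for M t
  define tl where "tl M t = u t - cut M t" for M t
  have [measurable]: "cut M \<in> borel_measurable borel" for M
    unfolding cut_def by measurable
  have cut: "cut M \<in> L2" for M
    by (rule L2_I) (auto simp: cut_def intro: Bochner_Integration.integrable_bound[OF L2_integrable_sq[OF L2]])
  have tl: "tl M \<in> L2" for M
    using L2_add[OF L2 L2_scale[OF cut, of "-1"]] by (simp add: tl_def[abs_def])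
  define K where "K = 2 * l2_norm u + 1"
  have K: "K > 0" by (simp add: K_def add_nonneg_pos)
  have "(\<lambda>M. LINT t|lborel. (cmod (tl M t))\<^sup>2) \<longlonglongrightarrow> (LINT t::real|lborel. (0::real))"
  proof (rule integral_dominated_convergence[where w = "\<lambda>t. (cmod (u t))\<^sup>2"])
    show "AE t in lborel. (\<lambda>M. (cmod (tl M t))\<^sup>2) \<longlonglongrightarrow> 0"
    proof (rule AE_I2)
      fix t
      have "eventually (\<lambda>M. cmod (u t) \<le> real M) sequentially"
        by (rule eventually_sequentiallyI[of "nat \<lceil>cmod (u t)\<rceil>"]) linarith
      then have "eventually (\<lambda>M. (cmod (tl M t))\<^sup>2 = 0) sequentially"
        by eventually_elim (simp add: tl_def cut_def)
      then show "(\<lambda>M. (cmod (tl M t))\<^sup>2) \<longlonglongrightarrow> 0" by (rule tendsto_eventually)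
    qed
    show "AE t in lborel. norm ((cmod (tl M t))\<^sup>2) \<le> (cmod (u t))\<^sup>2" for M
      by (rule AE_I2) (simp add: tl_def cut_def)
  qed (use L2_integrable_sq[OF L2] in \<open>simp_all add: tl_def\<close>)
  then have "(\<lambda>M. l2_norm (tl M)) \<longlonglongrightarrow> sqrt 0"
    unfolding l2_norm_def by (intro tendsto_real_sqrt) simp
  then obtain M where "norm (l2_norm (tl M) - 0) < \<epsilon> / (2 * K)"
    using LIMSEQ_D[of _ "sqrt 0" "\<epsilon> / (2 * K)"] \<epsilon> K by fastforce
  then have M: "l2_norm (tl M) < \<epsilon> / (2 * K)" by simp
  define d where "d n = (LINT t|lborel. cmod (u (t - r n) - u t))" for n
  have "(\<lambda>n. real M * d n) \<longlonglongrightarrow> real M * 0"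
    unfolding d_def by (intro tendsto_intros L1_shift_continuous L1 r)
  then obtain N where "\<forall>n\<ge>N. norm (real M * d n - real M * 0) < \<epsilon> / 2"
    using LIMSEQ_D[of "\<lambda>n. real M * d n" "real M * 0" "\<epsilon> / 2"] \<epsilon> by auto
  then have N: "real M * d n < \<epsilon> / 2" if "n \<ge> N" for n using that by fastforce
  show "\<exists>N. \<forall>n\<ge>N. norm (l2_inner u (\<lambda>t. u (t - r n)) - l2_inner u u) < \<epsilon>"
  proof (intro exI allI impI)
    fix n assume "n \<ge> N"
    define v where "v t = u (t - r n) - u t" for t
    have shift: "(\<lambda>t. u (t - r n)) \<in> L2" using tf_shift_L2[OF L2, of "(r n, 0)"] by (simp add: tf_shift_time)
    have v: "v \<in> L2" using L2_add[OF shift L2_scale[OF L2, of "-1"]] by (simp add: v_def[abs_def])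
    have intv: "integrable lborel v"
      using lborel_integrable_real_affine[OF L1, of 1 "- r n"] L1 by (simp add: v_def[abs_def] algebra_simps)
    have normv: "l2_norm v \<le> 2 * l2_norm u"
      using l2_norm_add_scale_le[OF shift L2, of "-1"] l2_norm_tf_shift[of u "(r n, 0)"]
      by (simp add: v_def[abs_def] tf_shift_time)
    have "l2_inner u (\<lambda>t. u (t - r n)) - l2_inner u u = l2_inner u v"
      using L2_inner_integrable[OF L2 shift] L2_inner_integrable[OF L2 L2]
      by (simp add: l2_inner_def v_def right_diff_distrib)
    also have "\<dots> = l2_inner (tl M) v + l2_inner (cut M) v"
      using psd_add[OF psd_form_l2_inner tl[of M] cut[of M] v] by (simp add: tl_def)
    finally have "cmod (l2_inner u (\<lambda>t. u (t - r n)) - l2_inner u u)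
      \<le> cmod (l2_inner (tl M) v) + cmod (l2_inner (cut M) v)"
      by (simp add: norm_triangle_ineq)
    also have "cmod (l2_inner (tl M) v) \<le> l2_norm (tl M) * l2_norm v"
      by (rule l2_cauchy_schwarz_norm[OF tl v])
    also have "\<dots> \<le> (\<epsilon> / (2 * K)) * K"
      using M normv \<epsilon> K by (intro mult_mono) (auto simp: K_def)
    also have "\<dots> = \<epsilon> / 2" using K by simp
    also have "cmod (l2_inner (cut M) v) \<le> (LINT t|lborel. real M * cmod (v t))"
      unfolding l2_inner_def
    proof (rule order_trans[OF integral_norm_bound], rule integral_mono)
      show "integrable lborel (\<lambda>t. cmod (cut M t * cnj (v t)))"
        by (intro integrable_norm L2_inner_integrable cut v)
      show "cmod (cut M t * cnj (v t)) \<le> real M * cmod (v t)" for t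
        by (auto simp: cut_def norm_mult intro!: mult_right_mono)
    qed (use intv in auto)
    also have "\<dots> = real M * d n" using intv by (simp add: d_def v_def)
    finally show "norm (l2_inner u (\<lambda>t. u (t - r n)) - l2_inner u u) < \<epsilon>"
      using N[OF \<open>n \<ge> N\<close>] by simp
  qed
qed

subsection \<open>Plancherel's theorem\<close>

definition fourier :: "(real \<Rightarrow> complex) \<Rightarrow> real \<Rightarrow> complex" where
  "fourier u y = (LINT t|lborel. u t * cis (- 2 * pi * y * t))"

lemma cis_measurable [measurable]: "cis \<in> borel_measurable borel"
  by (intro borel_measurable_continuous_onI continuous_intros)

lemma cnj_measurable [measurable]: "cnj \<in> borel_measurable borel"
  by (intro borel_measurable_continuous_onI continuous_intros)

text \<open>Integrating the modulus over r gives |u(t)| times the L1 norm of u, whatever the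
  frequency. Frequency 0 yields integrability of the autocorrelation itself.\<close>

lemma autocorrelation_integrable:
  assumes u: "integrable lborel u"
  shows "integrable (lborel \<Otimes>\<^sub>M lborel) (\<lambda>(t, r). u t * cnj (u (t - r)) * cis (y * r))"
proof -
  have [measurable]: "u \<in> borel_measurable borel" using borel_measurable_integrable[OF u] by simp
  have int: "integrable lborel (\<lambda>r. cmod (u (t - r)))" for t
    using lborel_integrable_real_affine[of "\<lambda>s. cmod (u s)" "-1" t] u by simp
  have eq: "(LINT r|lborel. cmod (u (t - r))) = (LINT r|lborel. cmod (u r))" for t
    using lborel_integral_real_affine[of "-1" "\<lambda>s. cmod (u s)" t] by simp
  show ?thesis
  proof (rule lborel_pair.Fubini_integrable)
    show "integrable lborel (\<lambda>t. LINT r|lborel. norm (case (t, r) of (t, r) \<Rightarrow> u t * cnj (u (t - r)) * cis (y * r)))"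
      using u by (simp add: norm_mult eq)
    show "AE t in lborel. integrable lborel (\<lambda>r. case (t, r) of (t, r) \<Rightarrow> u t * cnj (u (t - r)) * cis (y * r))"
    proof (rule AE_I2)
      fix t
      show "integrable lborel (\<lambda>r. case (t, r) of (t, r) \<Rightarrow> u t * cnj (u (t - r)) * cis (y * r))"
        by (rule Bochner_Integration.integrable_bound[where f = "\<lambda>r. cmod (u t) * cmod (u (t - r))"])
           (use int in \<open>auto simp: norm_mult\<close>)
    qed
  qed measurable
qed

text \<open>The Wiener-Khinchin relation: after Fubini, the substitution r = t - s makes the double
  integral a product of the transform and its conjugate.\<close>

lemma fourier_norm_sq:
  assumes u: "integrable lborel u"
  shows "of_real ((cmod (fourier u y))\<^sup>2)
    = (LINT r|lborel. l2_inner u (\<lambda>t. u (t - r)) * cis (- 2 * pi * y * r))"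
proof -
  let ?e = "\<lambda>t. cis (- 2 * pi * y * t)"
  have [measurable]: "u \<in> borel_measurable borel" using borel_measurable_integrable[OF u] by simp
  have inner: "(LINT r|lborel. u t * cnj (u (t - r)) * ?e r) = u t * ?e t * cnj (fourier u y)" for t
  proof -
    have "(LINT r|lborel. u t * cnj (u (t - r)) * ?e r) = (LINT s|lborel. u t * cnj (u s) * ?e (t - s))"
      using lborel_integral_real_affine[of "-1" "\<lambda>r. u t * cnj (u (t - r)) * ?e r" t] by simp
    also have "\<dots> = (LINT s|lborel. (u t * ?e t) * cnj (u s * ?e s))"
    proof (rule Bochner_Integration.integral_cong)
      fix s
      have "?e (t - s) = ?e t * cnj (?e s)"
        unfolding cis_cnj cis_mult by (simp add: algebra_simps)
      then show "u t * cnj (u s) * ?e (t - s) = (u t * ?e t) * cnj (u s * ?e s)" by simp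
    qed simp
    also have "\<dots> = u t * ?e t * cnj (fourier u y)"
      unfolding fourier_def by (subst integral_mult_right_zero) (simp only: Bochner_Integration.integral_cnj)
    finally show ?thesis .
  qed
  have "(LINT r|lborel. l2_inner u (\<lambda>t. u (t - r)) * ?e r)
      = (LINT r|lborel. (LINT t|lborel. u t * cnj (u (t - r)) * ?e r))"
    by (simp add: l2_inner_def)
  also have "\<dots> = (LINT t|lborel. (LINT r|lborel. u t * cnj (u (t - r)) * ?e r))"
    using autocorrelation_integrable[OF u, of "- 2 * pi * y"] by (rule lborel_pair.Fubini_integral)
  also have "\<dots> = (LINT t|lborel. u t * ?e t * cnj (fourier u y))"
    by (simp only: inner)
  also have "\<dots> = fourier u y * cnj (fourier u y)"
    by (simp add: fourier_def)
  finally show ?thesis by (simp only: complex_norm_square)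
qed

text \<open>The Gaussian is left unnormalised, so that \<open>gauss_weight \<eta>\<close> increases to \<open>1\<close> as
  \<open>\<eta>\<close> decreases to \<open>0\<close>.\<close>
definition gauss_weight :: "real \<Rightarrow> real \<Rightarrow> real" where
  "gauss_weight \<eta> y = exp (- (\<eta> * y)\<^sup>2 / 2)"

lemma gauss_weight_measurable [measurable]: "gauss_weight \<eta> \<in> borel_measurable borel"
  unfolding gauss_weight_def[abs_def] by measurable

lemma gauss_weight_eq: "gauss_weight \<eta> y = sqrt (2 * pi) * std_normal_density (\<eta> * y)"
  by (simp add: gauss_weight_def std_normal_density_def)

lemma gauss_weight_integrable: "\<eta> > 0 \<Longrightarrow> integrable lborel (gauss_weight \<eta>)"
  using lborel_integrable_real_affine[of std_normal_density \<eta> 0]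
  unfolding gauss_weight_eq[abs_def] by simp

lemma gauss_weight_integral: "\<eta> > 0 \<Longrightarrow> integral\<^sup>L lborel (gauss_weight \<eta>) = sqrt (2 * pi) / \<eta>"
  using lborel_integral_real_affine[of \<eta> std_normal_density 0]
  unfolding gauss_weight_eq[abs_def] by (simp add: field_simps)

text \<open>The characteristic function of the standard normal law, rescaled by \<eta>.\<close>

lemma gauss_weight_fourier:
  assumes \<eta>: "\<eta> > 0"
  shows "(LINT y|lborel. gauss_weight \<eta> y * cis (s * y)) = of_real (sqrt (2 * pi) / \<eta> * exp (- (s / \<eta>)\<^sup>2 / 2))"
proof -
  have "(LINT y|lborel. std_normal_density y *\<^sub>R iexp (s / \<eta> * y)) = of_real (exp (- (s / \<eta>)\<^sup>2 / 2))"
    using fun_cong[OF char_std_normal_distribution, of "s / \<eta>"] unfolding char_def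
    by (subst (asm) integral_density) (auto simp: normal_density_nonneg)
  moreover have "(LINT y|lborel. std_normal_density y *\<^sub>R iexp (s / \<eta> * y))
     = \<bar>\<eta>\<bar> *\<^sub>R (LINT y|lborel. std_normal_density (\<eta> * y) *\<^sub>R iexp (s / \<eta> * (\<eta> * y)))"
    using lborel_integral_real_affine[of \<eta> "\<lambda>y. std_normal_density y *\<^sub>R iexp (s / \<eta> * y)" 0] \<eta> by simp
  moreover have "(LINT y|lborel. gauss_weight \<eta> y * cis (s * y))
     = sqrt (2 * pi) * (LINT y|lborel. std_normal_density (\<eta> * y) *\<^sub>R iexp (s / \<eta> * (\<eta> * y)))"
  proof -
    have "gauss_weight \<eta> y * cis (s * y)
      = of_real (sqrt (2 * pi)) * (std_normal_density (\<eta> * y) *\<^sub>R iexp (s / \<eta> * (\<eta> * y)))" for y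
      using \<eta> by (simp add: gauss_weight_eq cis_conv_exp scaleR_conv_of_real mult_ac)
    then show ?thesis by (simp only: integral_mult_right_zero)
  qed
  ultimately show ?thesis using \<eta> by (simp add: scaleR_conv_of_real field_simps)
qed

text \<open>After Fubini the substitution r = \<eta> \<rho> moves \<eta> into the argument of the
  autocorrelation and leaves a fixed Gaussian weight of total mass 1, which prepares the limit
  \<eta> to 0.\<close>

lemma fourier_gauss_weight:
  assumes L1: "integrable lborel u" and L2: "u \<in> L2" and \<eta>: "\<eta> > 0"
  shows "of_real (LINT y|lborel. (cmod (fourier u y))\<^sup>2 * gauss_weight \<eta> y)
    = (LINT \<rho>|lborel. l2_inner u (\<lambda>t. u (t - \<eta> * \<rho>)) * of_real (sqrt (2 * pi) * gauss_weight (2 * pi) \<rho>))"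
proof -
  define A where "A r = l2_inner u (\<lambda>t. u (t - r))" for r
  have [measurable]: "u \<in> borel_measurable borel" using L2_measurable[OF L2] .
  have A: "integrable lborel A"
    using lborel_pair.integrable_snd[OF autocorrelation_integrable[OF L1, of 0]]
    by (simp add: A_def[abs_def] l2_inner_def)
  then have [measurable]: "A \<in> borel_measurable borel" by auto
  have pair: "integrable (lborel \<Otimes>\<^sub>M lborel) (\<lambda>(r, y). A r * cis (- 2 * pi * y * r) * gauss_weight \<eta> y)"
  proof (rule lborel_pair.Fubini_integrable)
    note w = gauss_weight_integrable[OF \<eta>]
    have [simp]: "\<bar>gauss_weight \<eta> y\<bar> = gauss_weight \<eta> y" for y by (simp add: gauss_weight_def)
    show "integrable lborel (\<lambda>r. LINT y|lborel. norm (case (r, y) of (r, y) \<Rightarrow> A r * cis (- 2 * pi * y * r) * gauss_weight \<eta> y))"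
      using A by (simp add: norm_mult)
    show "AE r in lborel. integrable lborel (\<lambda>y. case (r, y) of (r, y) \<Rightarrow> A r * cis (- 2 * pi * y * r) * gauss_weight \<eta> y)"
    proof (rule AE_I2)
      fix r
      show "integrable lborel (\<lambda>y. case (r, y) of (r, y) \<Rightarrow> A r * cis (- 2 * pi * y * r) * gauss_weight \<eta> y)"
        by (rule Bochner_Integration.integrable_bound[where f = "\<lambda>y. cmod (A r) * gauss_weight \<eta> y"])
           (use w in \<open>auto simp: norm_mult\<close>)
    qed
  qed measurable
  have "of_real (LINT y|lborel. (cmod (fourier u y))\<^sup>2 * gauss_weight \<eta> y)
     = (LINT y|lborel. (LINT r|lborel. A r * cis (- 2 * pi * y * r) * gauss_weight \<eta> y))"
    by (subst integral_complex_of_real[symmetric])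
       (simp add: fourier_norm_sq[OF L1] A_def flip: of_real_power)
  also have "\<dots> = (LINT r|lborel. (LINT y|lborel. A r * cis (- 2 * pi * y * r) * gauss_weight \<eta> y))"
    by (rule lborel_pair.Fubini_integral[OF pair])
  also have "\<dots> = (LINT r|lborel. A r * (LINT y|lborel. gauss_weight \<eta> y * cis ((- 2 * pi * r) * y)))"
    by (simp add: mult_ac flip: integral_mult_right_zero)
  also have "\<dots> = (LINT r|lborel. A r * of_real (sqrt (2 * pi) / \<eta> * gauss_weight (2 * pi) (r / \<eta>)))"
    by (simp only: gauss_weight_fourier[OF \<eta>]) (simp add: gauss_weight_def power_divide power_mult_distrib)
  also have "\<dots> = \<bar>\<eta>\<bar> *\<^sub>R (LINT \<rho>|lborel. A (\<eta> * \<rho>) * of_real (sqrt (2 * pi) / \<eta> * gauss_weight (2 * pi) \<rho>))"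
    using lborel_integral_real_affine[of \<eta> "\<lambda>r. A r * of_real (sqrt (2 * pi) / \<eta> * gauss_weight (2 * pi) (r / \<eta>))" 0] \<eta>
    by simp
  also have "\<dots> = (LINT \<rho>|lborel. A (\<eta> * \<rho>) * of_real (sqrt (2 * pi) * gauss_weight (2 * pi) \<rho>))"
    using \<eta> by (subst integral_scaleR_right[symmetric]) (simp add: scaleR_conv_of_real field_simps)
  finally show ?thesis by (simp add: A_def)
qed

text \<open>Gaussian summation. On the frequency side the weights increase to 1, so monotone
  convergence gives integrability together with the value. On the time side the autocorrelation is
  averaged over arguments shrinking to 0, where it is continuous and equals the squared
  norm.\<close>

theorem plancherel:
  assumes L1: "integrable lborel u" and L2: "u \<in> L2"
  shows "has_bochner_integral lborel (\<lambda>y. (cmod (fourier u y))\<^sup>2) ((l2_norm u)\<^sup>2)"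
proof (rule has_bochner_integral_monotone_convergence)
  let ?\<eta> = "\<lambda>n::nat. 1 / real (Suc n)"
  let ?w = "\<lambda>n. gauss_weight (?\<eta> n)"
  let ?A = "\<lambda>r. l2_inner u (\<lambda>t. u (t - r))"
  have [measurable]: "u \<in> borel_measurable borel" using L2_measurable[OF L2] .
  have [measurable]: "fourier u \<in> borel_measurable borel"
    unfolding fourier_def[abs_def] by measurable
  have [measurable]: "?A \<in> borel_measurable borel"
    unfolding l2_inner_def[abs_def] by measurable
  have bound: "cmod (fourier u y) \<le> (LINT t|lborel. cmod (u t))" for y
    unfolding fourier_def by (rule order_trans[OF integral_norm_bound]) (simp add: norm_mult)
  show int: "integrable lborel (\<lambda>y. (cmod (fourier u y))\<^sup>2 * ?w n y)" for n
  proof (rule Bochner_Integration.integrable_bound)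
    show "integrable lborel (\<lambda>y. (LINT t|lborel. cmod (u t))\<^sup>2 * ?w n y)"
      by (intro integrable_mult_right gauss_weight_integrable) simp
    show "AE y in lborel. norm ((cmod (fourier u y))\<^sup>2 * ?w n y) \<le> norm ((LINT t|lborel. cmod (u t))\<^sup>2 * ?w n y)"
      using bound by (intro AE_I2) (auto simp: abs_mult gauss_weight_def intro!: mult_right_mono power_mono)
  qed measurable
  show "AE y in lborel. mono (\<lambda>n. (cmod (fourier u y))\<^sup>2 * ?w n y)"
    by (auto simp: gauss_weight_def mono_def power_mult_distrib power_divide frac_le
        intro!: AE_I2 mult_left_mono mult_right_mono power_mono divide_right_mono)
  show "AE y in lborel. (\<lambda>n. (cmod (fourier u y))\<^sup>2 * ?w n y) \<longlonglongrightarrow> (cmod (fourier u y))\<^sup>2"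
  proof (rule AE_I2)
    fix y
    have "(\<lambda>n. (cmod (fourier u y))\<^sup>2 * exp (- (?\<eta> n * y)\<^sup>2 / 2)) \<longlonglongrightarrow> (cmod (fourier u y))\<^sup>2 * exp (- (0 * y)\<^sup>2 / 2)"
      by (intro tendsto_intros LIMSEQ_Suc[OF lim_1_over_n]) simp
    then show "(\<lambda>n. (cmod (fourier u y))\<^sup>2 * ?w n y) \<longlonglongrightarrow> (cmod (fourier u y))\<^sup>2"
      by (simp add: gauss_weight_def)
  qed
  have shift: "(\<lambda>t. u (t - r)) \<in> L2" for r
    using tf_shift_L2[OF L2, of "(r, 0)"] by (simp add: tf_shift_time)
  have A_bound: "cmod (?A r) \<le> (l2_norm u)\<^sup>2" for r
    using l2_cauchy_schwarz_norm[OF L2 shift, of r] l2_norm_tf_shift[of u "(r, 0)"]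
    by (simp add: tf_shift_time power2_eq_square)
  let ?c = "\<lambda>\<rho>. sqrt (2 * pi) * gauss_weight (2 * pi) \<rho>"
  have "(\<lambda>n. LINT \<rho>|lborel. ?A (?\<eta> n * \<rho>) * of_real (?c \<rho>)) \<longlonglongrightarrow> (LINT \<rho>|lborel. l2_inner u u * of_real (?c \<rho>))"
  proof (rule integral_dominated_convergence[where w = "\<lambda>\<rho>. (l2_norm u)\<^sup>2 * ?c \<rho>"])
    show "integrable lborel (\<lambda>\<rho>. (l2_norm u)\<^sup>2 * ?c \<rho>)"
      by (intro integrable_mult_right gauss_weight_integrable) simp
    show "AE \<rho> in lborel. (\<lambda>n. ?A (?\<eta> n * \<rho>) * of_real (?c \<rho>)) \<longlonglongrightarrow> l2_inner u u * of_real (?c \<rho>)"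
    proof (intro AE_I2 tendsto_mult tendsto_const)
      fix \<rho> :: real
      have "(\<lambda>n. ?\<eta> n * \<rho>) \<longlonglongrightarrow> 0 * \<rho>"
        by (intro tendsto_intros LIMSEQ_Suc[OF lim_1_over_n])
      then show "(\<lambda>n. ?A (?\<eta> n * \<rho>)) \<longlonglongrightarrow> l2_inner u u"
        by (intro autocorrelation_continuous[OF L2 L1]) simp
    qed
    show "AE \<rho> in lborel. norm (?A (?\<eta> n * \<rho>) * of_real (?c \<rho>)) \<le> (l2_norm u)\<^sup>2 * ?c \<rho>" for n
      using A_bound by (intro AE_I2) (auto simp: norm_mult gauss_weight_def intro!: mult_right_mono)
  qed measurable
  also have "(LINT \<rho>|lborel. l2_inner u u * of_real (?c \<rho>)) = l2_inner u u * of_real (LINT \<rho>|lborel. ?c \<rho>)"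
    by (simp flip: integral_complex_of_real)
  also have "(LINT \<rho>|lborel. ?c \<rho>) = 1"
    by (simp add: gauss_weight_integral flip: real_sqrt_mult)
  also have "l2_inner u u * of_real 1 = of_real ((l2_norm u)\<^sup>2)"
    by (simp add: l2_inner_self l2_norm_sq)
  finally have "(\<lambda>n. complex_of_real (LINT y|lborel. (cmod (fourier u y))\<^sup>2 * ?w n y)) \<longlonglongrightarrow> of_real ((l2_norm u)\<^sup>2)"
    by (subst fourier_gauss_weight[OF L1 L2]) simp_all
  then show "(\<lambda>n. LINT y|lborel. (cmod (fourier u y))\<^sup>2 * ?w n y) \<longlonglongrightarrow> (l2_norm u)\<^sup>2"
    by (simp only: tendsto_of_real_iff)
  show "(\<lambda>y. (cmod (fourier u y))\<^sup>2) \<in> borel_measurable lborel" by measurable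
qed

subsection \<open>The short-time Fourier transform\<close>

lemma gauss_sq_integral:
  "integrable lborel (\<lambda>t. (exp (- (t::real)\<^sup>2))\<^sup>2)" "(LINT t|lborel. (exp (- (t::real)\<^sup>2))\<^sup>2) > 0"
proof -
  have eq: "(exp (- t\<^sup>2))\<^sup>2 = gauss_weight 2 t" for t :: real
    by (simp add: gauss_weight_def power2_eq_square flip: exp_add)
  show "integrable lborel (\<lambda>t. (exp (- (t::real)\<^sup>2))\<^sup>2)"
    unfolding eq by (rule gauss_weight_integrable) simp
  show "(LINT t|lborel. (exp (- (t::real)\<^sup>2))\<^sup>2) > 0"
    unfolding eq by (simp add: gauss_weight_integral)
qed

lemma gauss_c_pos: "gauss_c > 0"
  using gauss_sq_integral(2) by (simp add: gauss_c_def)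

lemma gauss_phi_measurable [measurable]: "gauss_phi \<in> borel_measurable borel"
  unfolding gauss_phi_def[abs_def] by measurable

lemma gauss_phi_bounds: "0 \<le> gauss_phi t" "gauss_phi t \<le> gauss_c"
  using gauss_c_pos by (auto simp: gauss_phi_def)

lemma gauss_phi_sq_integrable: "integrable lborel (\<lambda>t. (gauss_phi t)\<^sup>2)"
  using gauss_sq_integral(1) by (simp add: gauss_phi_def power_mult_distrib)

lemma gauss_phi_sq_integral: "(LINT t|lborel. (gauss_phi t)\<^sup>2) = 1"
proof -
  have "(LINT t|lborel. (gauss_phi t)\<^sup>2) = gauss_c\<^sup>2 * (LINT t|lborel. (exp (- (t::real)\<^sup>2))\<^sup>2)"
    by (simp add: gauss_phi_def power_mult_distrib)
  then show ?thesis
    using gauss_sq_integral(2) by (simp add: gauss_c_def power_divide)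
qed

abbreviation window :: "real \<Rightarrow> complex" where
  "window \<equiv> \<lambda>t. of_real (gauss_phi t)"

lemma window_L2: "window \<in> L2"
  by (rule L2_I) (use gauss_phi_sq_integrable in \<open>auto\<close>)

lemma l2_norm_window: "l2_norm window = 1"
  by (simp add: l2_norm_def gauss_phi_sq_integral)

lemma stft_eq_inner: "stft f p = l2_inner f (tf_shift window p)"
  unfolding stft_def l2_inner_def tf_shift_def
  by (intro Bochner_Integration.integral_cong) (auto simp: cis_cnj mult_ac)

lemma cmod_stft_le: "f \<in> L2 \<Longrightarrow> cmod (stft f p) \<le> l2_norm f"
  using l2_cauchy_schwarz_norm[of f "tf_shift window p"]
  by (simp add: stft_eq_inner tf_shift_L2 window_L2 l2_norm_tf_shift l2_norm_window)

lemma stft_measurable: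
  assumes f: "f \<in> L2"
  shows "stft f \<in> borel_measurable borel"
proof -
  note [measurable] = L2_measurable[OF f]
  show ?thesis unfolding stft_def[abs_def] borel_prod[symmetric] by measurable
qed

text \<open>Substituting \<open>fst l + t\<close> for t leaves only the unimodular factor
  \<open>?c\<close>; the second summand in its argument is zero.\<close>

lemma cmod_stft_tf_shift: "cmod (stft (tf_shift f l) p) = cmod (stft f (p - l))"
proof -
  let ?I = "\<lambda>t. f t * cnj (complex_of_real (gauss_phi (t - fst (p - l)))) * cis (- 2 * pi * snd (p - l) * t)"
  let ?c = "cis (- 2 * pi * snd (p - l) * fst l + 2 * pi * snd l * 0)"
  have "stft (tf_shift f l) p
      = (LINT t|lborel. tf_shift f l (fst l + t) * cnj (complex_of_real (gauss_phi (fst l + t - fst p)))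
            * cis (- 2 * pi * snd p * (fst l + t)))"
    unfolding stft_def
    using lborel_integral_real_affine[of 1 "\<lambda>t. tf_shift f l t * cnj (complex_of_real (gauss_phi (t - fst p)))
       * cis (- 2 * pi * snd p * t)" "fst l"] by simp
  also have "\<dots> = (LINT t|lborel. ?c * ?I t)"
  proof (rule Bochner_Integration.integral_cong)
    fix t
    have "cis (2 * pi * snd l * (fst l + t)) * cis (- 2 * pi * snd p * (fst l + t))
       = ?c * cis (- 2 * pi * snd (p - l) * t)"
      unfolding cis_mult by (simp add: algebra_simps)
    then show "tf_shift f l (fst l + t) * cnj (complex_of_real (gauss_phi (fst l + t - fst p)))
            * cis (- 2 * pi * snd p * (fst l + t)) = ?c * ?I t"
      by (simp add: tf_shift_def algebra_simps)
  qed simp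
  also have "\<dots> = ?c * stft f (p - l)"
    unfolding stft_def by (rule integral_mult_right_zero)
  finally show ?thesis by (simp add: norm_mult)
qed

text \<open>For fixed x this is a Fourier transform in y of f times the shifted window, a product
  that is integrable because both factors are in \<open>L2\<close> and square-integrable because the
  window is bounded. Plancherel in y and Tonelli leave the norm of the window, which is 1.\<close>

theorem moyal:
  assumes f: "f \<in> L2"
  shows "(\<integral>\<^sup>+ z. ennreal ((cmod (stft f z))\<^sup>2) \<partial>lborel) = ennreal ((l2_norm f)\<^sup>2)"
proof -
  note [measurable] = L2_measurable[OF f] stft_measurable[OF f]
  define u where "u x t = f t * of_real (gauss_phi (t - x))" for x t
  have [measurable]: "u x \<in> borel_measurable borel" for x unfolding u_def by measurable
  have shift: "(\<lambda>t. of_real (gauss_phi (t - x)) :: complex) \<in> L2" for x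
    using tf_shift_L2[OF window_L2, of "(x, 0)"] by (simp add: tf_shift_time)
  have L1: "integrable lborel (u x)" for x
    unfolding u_def by (rule L2_mult_integrable[OF f shift])
  have L2: "u x \<in> L2" for x
  proof (rule L2_I)
    show "integrable lborel (\<lambda>t. (cmod (u x t))\<^sup>2)"
    proof (rule Bochner_Integration.integrable_bound)
      show "integrable lborel (\<lambda>t. (cmod (f t))\<^sup>2 * gauss_c\<^sup>2)"
        using L2_integrable_sq[OF f] by simp
      show "AE t in lborel. norm ((cmod (u x t))\<^sup>2) \<le> norm ((cmod (f t))\<^sup>2 * gauss_c\<^sup>2)"
        using gauss_phi_bounds by (intro AE_I2)
          (auto simp: u_def norm_mult power_mult_distrib intro!: mult_left_mono power_mono)
    qed measurable
  qed measurable
  have stft: "stft f (x, y) = fourier (u x) y" for x y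
    by (simp add: stft_def fourier_def u_def)
  have "(\<integral>\<^sup>+ z. ennreal ((cmod (stft f z))\<^sup>2) \<partial>lborel)
     = (\<integral>\<^sup>+ x. \<integral>\<^sup>+ y. ennreal ((cmod (stft f (x, y)))\<^sup>2) \<partial>lborel \<partial>lborel)"
    unfolding lborel_prod[symmetric]
    by (subst lborel.nn_integral_fst) (simp_all add: lborel_prod)
  also have "\<dots> = (\<integral>\<^sup>+ x. \<integral>\<^sup>+ t. ennreal ((cmod (u x t))\<^sup>2) \<partial>lborel \<partial>lborel)"
  proof (rule nn_integral_cong)
    fix x
    note P = plancherel[OF L1 L2, of x]
    have "(\<integral>\<^sup>+ y. ennreal ((cmod (stft f (x, y)))\<^sup>2) \<partial>lborel) = ennreal ((l2_norm (u x))\<^sup>2)"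
      unfolding stft using P by (subst nn_integral_eq_integral) (auto simp: has_bochner_integral_iff)
    also have "\<dots> = (\<integral>\<^sup>+ t. ennreal ((cmod (u x t))\<^sup>2) \<partial>lborel)"
      by (subst nn_integral_eq_integral) (auto simp: l2_norm_sq L2_integrable_sq[OF L2])
    finally show "(\<integral>\<^sup>+ y. ennreal ((cmod (stft f (x, y)))\<^sup>2) \<partial>lborel) = (\<integral>\<^sup>+ t. ennreal ((cmod (u x t))\<^sup>2) \<partial>lborel)" .
  qed
  also have "\<dots> = (\<integral>\<^sup>+ t. \<integral>\<^sup>+ x. ennreal ((cmod (u x t))\<^sup>2) \<partial>lborel \<partial>lborel)"
    by (rule lborel_pair.Fubini') (simp add: u_def)
  also have "\<dots> = (\<integral>\<^sup>+ t. ennreal ((cmod (f t))\<^sup>2) \<partial>lborel)"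
  proof (rule nn_integral_cong)
    fix t
    have "(\<integral>\<^sup>+ x. ennreal ((gauss_phi (t - x))\<^sup>2) \<partial>lborel) = (\<integral>\<^sup>+ x. ennreal ((gauss_phi x)\<^sup>2) \<partial>lborel)"
      using nn_integral_real_affine[of "\<lambda>x. ennreal ((gauss_phi x)\<^sup>2)" "-1" t] by simp
    also have "\<dots> = 1"
      by (subst nn_integral_eq_integral) (auto simp: gauss_phi_sq_integrable gauss_phi_sq_integral)
    finally show "(\<integral>\<^sup>+ x. ennreal ((cmod (u x t))\<^sup>2) \<partial>lborel) = ennreal ((cmod (f t))\<^sup>2)"
      by (simp add: u_def norm_mult power_mult_distrib ennreal_mult nn_integral_cmult)
  qed
  also have "\<dots> = ennreal ((l2_norm f)\<^sup>2)"
    by (subst nn_integral_eq_integral) (auto simp: l2_norm_sq L2_integrable_sq[OF f])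
  finally show ?thesis .
qed

subsection \<open>A mean value inequality for the Gaussian window\<close>

lemma nn_integral_lborel_shift:
  fixes a :: "'a::euclidean_space"
  assumes [measurable]: "f \<in> borel_measurable borel"
  shows "(\<integral>\<^sup>+ x. f (a + x) \<partial>lborel) = (\<integral>\<^sup>+ x. f x \<partial>lborel)"
  by (subst (2) lborel_affine[of 1 a]) (simp_all add: nn_integral_density nn_integral_distr)

lemma nn_integral_lborel_reflect:
  fixes a :: "'a::euclidean_space"
  assumes [measurable]: "f \<in> borel_measurable borel"
  shows "(\<integral>\<^sup>+ x. f (a - x) \<partial>lborel) = (\<integral>\<^sup>+ x. f x \<partial>lborel)"
  by (subst (2) lborel_affine[of "-1" a]) (simp_all add: nn_integral_density nn_integral_distr)

text \<open>Squaring removes the corner of the positive part at 0, so the squared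
  \<open>bump\<close> is differentiable across the boundary of its support.\<close>

lemma max_zero_sq_has_derivative:
  "((\<lambda>z::real. (max 0 z)\<^sup>2) has_real_derivative 2 * max 0 z) (at z)"
proof (cases "z = 0")
  case True
  have "(\<lambda>h. (max 0 (0 + h))\<^sup>2 / h) \<midarrow>0\<rightarrow> (0::real)"
  proof (rule Lim_null_comparison)
    show "eventually (\<lambda>h. norm ((max 0 (0 + h))\<^sup>2 / h) \<le> \<bar>h\<bar>) (at (0::real))"
      by (rule always_eventually) (auto simp: max_def power2_eq_square)
    show "(\<lambda>h. \<bar>h\<bar>) \<midarrow>0\<rightarrow> (0::real)" by (intro tendsto_eq_intros) auto
  qed
  then show ?thesis using True by (simp add: DERIV_def)
next
  case False
  then consider "z > 0" | "z < 0" by linarith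
  then show ?thesis
  proof cases
    case 1
    have "((\<lambda>z::real. z\<^sup>2) has_real_derivative 2 * z) (at z)"
      by (auto intro!: derivative_eq_intros)
    then have "((\<lambda>z::real. (max 0 z)\<^sup>2) has_real_derivative 2 * z) (at z)"
      by (rule has_field_derivative_transform_within_open[where S = "{0<..}"]) (use 1 in auto)
    then show ?thesis using 1 by simp
  next
    case 2
    have "((\<lambda>z::real. 0) has_real_derivative 0) (at z)" by simp
    then have "((\<lambda>z::real. (max 0 z)\<^sup>2) has_real_derivative 0) (at z)"
      by (rule has_field_derivative_transform_within_open[where S = "{..<0}"]) (use 2 in auto)
    then show ?thesis using 2 by simp
  qed
qed

text \<open>The positive part of s^2 - |w|^2 with w = \<open>wcoord p\<close>. A weight that is
  radial in w averages functions holomorphic in w to a multiple of their value at 0.\<close>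

definition bump :: "real \<Rightarrow> real \<times> real \<Rightarrow> real" where
  "bump s p = max 0 (s\<^sup>2 - (fst p)\<^sup>2 - (pi * snd p)\<^sup>2)"

text \<open>The coordinate w = x - \<i> \<pi> y makes the Gaussian kernel holomorphic up to a
  weight: x^2 - (t - x)^2 - 2 \<pi> \<i> y t = - t^2 + 2 t w.\<close>

definition wcoord :: "real \<times> real \<Rightarrow> complex" where
  "wcoord p = of_real (fst p) - \<i> * of_real (pi * snd p)"

lemma continuous_on_bump [continuous_intros]: "continuous_on A (bump s)"
  unfolding bump_def[abs_def] by (intro continuous_intros)

lemma continuous_on_wcoord [continuous_intros]: "continuous_on A wcoord"
  unfolding wcoord_def[abs_def] by (intro continuous_intros)

lemma bump_nonneg: "0 \<le> bump s p" and bump_le: "bump s p \<le> s\<^sup>2"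
  by (auto simp: bump_def)

text \<open>The weight lives on the ellipse x^2 + (\<pi> y)^2 < s^2, which lies in the square of
  half-width s because \<pi> \<ge> 1.\<close>

lemma bump_eq_0:
  assumes "s \<ge> 0" "s \<le> \<bar>fst p\<bar> \<or> s \<le> \<bar>snd p\<bar>"
  shows "bump s p = 0"
proof -
  have "s\<^sup>2 \<le> (fst p)\<^sup>2 + (pi * snd p)\<^sup>2"
    using assms(2)
  proof
    assume "s \<le> \<bar>fst p\<bar>"
    then have "s\<^sup>2 \<le> (fst p)\<^sup>2" using assms(1) by (metis power2_abs power_mono)
    then show ?thesis by (simp add: add_increasing2)
  next
    assume "s \<le> \<bar>snd p\<bar>"
    moreover have "\<bar>snd p\<bar> * 1 \<le> \<bar>snd p\<bar> * pi"
      using pi_gt3 by (intro mult_left_mono) auto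
    ultimately have "s \<le> \<bar>pi * snd p\<bar>" by (simp add: abs_mult mult.commute)
    then have "s\<^sup>2 \<le> (pi * snd p)\<^sup>2" using assms(1) by (metis power2_abs power_mono)
    then show ?thesis by (simp add: add_increasing)
  qed
  then show ?thesis by (simp add: bump_def)
qed

lemma bump_sq_has_vector_derivative:
  fixes t :: complex
  shows "((\<lambda>x. of_real ((bump s (x, y))\<^sup>2) * exp (2 * t * wcoord (x, y))) has_vector_derivative
      (of_real (- 4 * x * bump s (x, y)) + of_real ((bump s (x, y))\<^sup>2) * (2 * t)) * exp (2 * t * wcoord (x, y)))
      (at x within A)" (is ?X)
    and "((\<lambda>y. of_real ((bump s (x, y))\<^sup>2) * exp (2 * t * wcoord (x, y))) has_vector_derivative
      (of_real (- 4 * pi\<^sup>2 * y * bump s (x, y)) + of_real ((bump s (x, y))\<^sup>2) * (- 2 * \<i> * pi * t)) * exp (2 * t * wcoord (x, y)))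
      (at y within A)" (is ?Y)
proof -
  have 1: "((\<lambda>x. (bump s (x, y))\<^sup>2) has_real_derivative 2 * bump s (x, y) * (- 2 * x)) (at x within A)"
    unfolding bump_def
    by (rule DERIV_chain2[OF max_zero_sq_has_derivative])
       (auto intro!: derivative_eq_intros)
  have "((\<lambda>x. 2 * t * wcoord (x, y)) has_vector_derivative 2 * t) (at x within A)"
    unfolding wcoord_def by (auto intro!: derivative_eq_intros)
  then have "(exp \<circ> (\<lambda>x. 2 * t * wcoord (x, y)) has_vector_derivative 2 * t * exp (2 * t * wcoord (x, y))) (at x within A)"
    by (rule field_vector_diff_chain_within) (auto intro!: derivative_eq_intros)
  from has_vector_derivative_mult[OF has_vector_derivative_of_real[OF 1] this]
  show ?X by (simp add: o_def algebra_simps)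
  have 2: "((\<lambda>y. (bump s (x, y))\<^sup>2) has_real_derivative 2 * bump s (x, y) * (- 2 * pi\<^sup>2 * y)) (at y within A)"
    unfolding bump_def
    by (rule DERIV_chain2[OF max_zero_sq_has_derivative])
       (auto intro!: derivative_eq_intros simp: power2_eq_square)
  have "((\<lambda>y. 2 * t * wcoord (x, y)) has_vector_derivative - 2 * \<i> * pi * t) (at y within A)"
    unfolding wcoord_def by (auto intro!: derivative_eq_intros simp: algebra_simps)
  then have "(exp \<circ> (\<lambda>y. 2 * t * wcoord (x, y)) has_vector_derivative - 2 * \<i> * pi * t * exp (2 * t * wcoord (x, y))) (at y within A)"
    by (rule field_vector_diff_chain_within) (auto intro!: derivative_eq_intros)
  from has_vector_derivative_mult[OF has_vector_derivative_of_real[OF 2] this]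
  show ?Y by (simp add: o_def algebra_simps)
qed

text \<open>Up to a constant factor the integrand is \<open>\<partial>\<^sub>x - (\<i>/\<pi>) \<partial>\<^sub>y\<close> applied to the compactly supported
  function \<open>(bump s p)\<^sup>2 * exp (2 * t * wcoord p)\<close>, because this operator annihilates \<open>exp (2 * t * wcoord p)\<close> and maps \<open>(bump s p)\<^sup>2\<close> to \<open>- 4 * bump s p * wcoord p\<close>.\<close>
lemma bump_exp_derivative_integral:
  fixes t :: complex
  assumes s: "s > 0"
  shows "integral (cbox (-s, -s) (s, s)) (\<lambda>p. of_real (bump s p) * (2 * wcoord p) * exp (2 * t * wcoord p)) = 0"
proof -
  let ?E = "\<lambda>p. exp (2 * t * wcoord p)"
  let ?B = "cbox (-s, -s) (s, s)"
  let ?X = "\<lambda>x y. (of_real (- 4 * x * bump s (x, y)) + of_real ((bump s (x, y))\<^sup>2) * (2 * t)) * ?E (x, y)"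
  let ?Y = "\<lambda>x y. (of_real (- 4 * pi\<^sup>2 * y * bump s (x, y)) + of_real ((bump s (x, y))\<^sup>2) * (- 2 * \<i> * pi * t)) * ?E (x, y)"
  have cX: "continuous_on ?B (\<lambda>(x, y). ?X x y)"
    unfolding split_def prod.collapse by (intro continuous_intros)
  have cY: "continuous_on ?B (\<lambda>(x, y). ?Y x y)"
    unfolding split_def prod.collapse by (intro continuous_intros)
  \<comment> \<open>The primitive vanishes at both ends because \<open>bump\<close> is zero on the
    sides of the box.\<close>
  have X0: "integral (cbox (-s) s) (\<lambda>x. ?X x y) = 0" for y
    using fundamental_theorem_of_calculus[of "-s" s, OF _ bump_sq_has_vector_derivative(1)[of s y t]] s
    by (simp add: bump_eq_0 integral_unique)
  have Y0: "integral (cbox (-s) s) (\<lambda>y. ?Y x y) = 0" for x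
    using fundamental_theorem_of_calculus[of "-s" s, OF _ bump_sq_has_vector_derivative(2)[of s x t]] s
    by (simp add: bump_eq_0 integral_unique)
  have IX: "integral ?B (\<lambda>(x, y). ?X x y) = 0"
    using integral_prod_continuous[OF cX] integral_swap_continuous[OF cX] X0 by simp
  have IY: "integral ?B (\<lambda>(x, y). ?Y x y) = 0"
    using integral_prod_continuous[OF cY] Y0 by simp
  have "integral ?B (\<lambda>p. of_real (bump s p) * (2 * wcoord p) * ?E p)
     = integral ?B (\<lambda>p. (- 1/2) * (case p of (x, y) \<Rightarrow> ?X x y) + (\<i> / (2 * pi)) * (case p of (x, y) \<Rightarrow> ?Y x y))"
  proof (rule integral_cong)
    fix p :: "real \<times> real"
    obtain x y where p: "p = (x, y)" by (cases p)
    \<comment> \<open>With the weights -1/2 and \<i>/(2 \<pi>) the terms containing the squared bump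
      cancel, and the remaining ones add up to 2 w times the bump.\<close>
    have "of_real (bump s p) * (2 * wcoord p) = (- 1/2) * (of_real (- 4 * x * bump s (x, y)) + of_real ((bump s (x, y))\<^sup>2) * (2 * t))
       + (\<i> / (2 * pi)) * (of_real (- 4 * pi\<^sup>2 * y * bump s (x, y)) + of_real ((bump s (x, y))\<^sup>2) * (- 2 * \<i> * pi * t))"
      by (simp add: p wcoord_def field_simps power2_eq_square)
    then show "of_real (bump s p) * (2 * wcoord p) * ?E p
      = (- 1/2) * (case p of (x, y) \<Rightarrow> ?X x y) + (\<i> / (2 * pi)) * (case p of (x, y) \<Rightarrow> ?Y x y)"
      unfolding p by (simp add: ring_distribs mult.assoc)
  qed
  also have "\<dots> = (- 1/2) * integral ?B (\<lambda>(x, y). ?X x y) + (\<i> / (2 * pi)) * integral ?B (\<lambda>(x, y). ?Y x y)"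
    by (intro integral_unique has_integral_add has_integral_mult_right integrable_integral
        integrable_continuous cX cY)
  finally show ?thesis unfolding IX IY by simp
qed

text \<open>Differentiating in t under the integral sign gives the integral just shown to vanish.
  The average is therefore constant in t, and t = 0 identifies the constant.\<close>

lemma bump_exp_integral:
  fixes t :: complex
  assumes s: "s > 0"
  shows "integral (cbox (-s, -s) (s, s)) (\<lambda>p. of_real (bump s p) * exp (2 * t * wcoord p))
    = integral (cbox (-s, -s) (s, s)) (\<lambda>p. of_real (bump s p))"
proof -
  let ?J = "\<lambda>t. integral (cbox (-s, -s) (s, s)) (\<lambda>p. of_real (bump s p) * exp (2 * t * wcoord p))"
  have "(?J has_field_derivative 0) (at t within UNIV)" for t
    unfolding bump_exp_derivative_integral[OF s, of t, symmetric]
  proof (rule leibniz_rule_field_derivative)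
    fix t and p :: "real \<times> real"
    show "((\<lambda>t. of_real (bump s p) * exp (2 * t * wcoord p)) has_field_derivative
        of_real (bump s p) * (2 * wcoord p) * exp (2 * t * wcoord p)) (at t within UNIV)"
      by (auto intro!: derivative_eq_intros)
    show "(\<lambda>p. of_real (bump s p) * exp (2 * t * wcoord p)) integrable_on cbox (- s, - s) (s, s)"
      by (intro integrable_continuous continuous_intros)
    show "continuous_on (UNIV \<times> cbox (- s, - s) (s, s))
       (\<lambda>(t, p). of_real (bump s p) * (2 * wcoord p) * exp (2 * t * wcoord p))"
      unfolding split_def
      by (intro continuous_intros continuous_on_compose2[OF continuous_on_bump[of UNIV]]
          continuous_on_compose2[OF continuous_on_wcoord[of UNIV]]) auto
  qed auto
  then obtain c where c: "\<And>t. ?J t = c"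
    using has_field_derivative_zero_constant[of UNIV ?J] by auto
  have "?J t = ?J 0" by (rule trans[OF c c[symmetric]])
  then show ?thesis by simp
qed

lemma bump_support: "s > 0 \<Longrightarrow> p \<notin> cbox (-s, -s) (s, s) \<Longrightarrow> bump s p = 0"
  by (rule bump_eq_0) (cases p; auto simp: cbox_Pair_eq)+

text \<open>The bridge from the gauge integral over a box, used for the calculus above, to the
  Lebesgue integral over the plane.\<close>

lemma bump_lborel_integral:
  fixes h :: "real \<times> real \<Rightarrow> complex"
  assumes s: "s > 0" and h: "continuous_on UNIV h"
  shows "integrable lborel (\<lambda>p. of_real (bump s p) * h p)"
    and "(LINT p|lborel. of_real (bump s p) * h p) = integral (cbox (-s, -s) (s, s)) (\<lambda>p. of_real (bump s p) * h p)"
proof -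
  let ?f = "\<lambda>p. of_real (bump s p) * h p"
  have eq: "indicator (cbox (-s, -s) (s, s)) p *\<^sub>R ?f p = ?f p" for p
    using bump_support[OF s, of p] by (auto simp: indicator_def)
  have int: "set_integrable lborel (cbox (-s, -s) (s, s)) ?f"
    unfolding set_integrable_def
    by (intro borel_integrable_compact continuous_intros continuous_on_subset[OF h]) auto
  then show "integrable lborel ?f" unfolding set_integrable_def eq .
  have "(LINT p : cbox (-s, -s) (s, s)|lborel. ?f p) = integral (cbox (-s, -s) (s, s)) ?f"
    by (rule set_borel_integral_eq_integral(2)[OF int])
  then show "(LINT p|lborel. ?f p) = integral (cbox (-s, -s) (s, s)) ?f"
    unfolding set_lebesgue_integral_def eq .
qed

lemma bump_integral_pos:
  assumes s: "s > 0"
  shows "(LINT p|lborel. bump s p) > 0"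
proof -
  \<comment> \<open>On this box x^2 \<le> s^2/64 and, since \<pi> < 4, (\<pi> y)^2 \<le> s^2/4; so
    the bump is at least s^2/2 there.\<close>
  let ?B = "cbox (-(s/8), -(s/8)) (s/8, s/8)"
  have int: "integrable lborel (bump s)"
    using bump_lborel_integral(1)[OF s, of "\<lambda>_. 1"] by (simp add: complex_of_real_integrable_eq)
  have "0 < measure lborel ?B * (s\<^sup>2 / 2)"
    using s by (simp add: content_Pair)
  also have "\<dots> = (LINT p|lborel. indicator ?B p * (s\<^sup>2 / 2))"
    by simp
  also have "\<dots> \<le> (LINT p|lborel. bump s p)"
  proof (rule integral_mono)
    fix p
    show "indicator ?B p * (s\<^sup>2 / 2) \<le> bump s p"
    proof (cases "p \<in> ?B")
      case True
      then have "\<bar>fst p\<bar> \<le> s/8" "\<bar>snd p\<bar> \<le> s/8" by (cases p; auto simp: cbox_Pair_eq)+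
      moreover from this(2) have "\<bar>pi * snd p\<bar> \<le> 4 * (s/8)"
        unfolding abs_mult using pi_less_4 s by (intro mult_mono) auto
      ultimately have "(fst p)\<^sup>2 \<le> (s/8)\<^sup>2" "(pi * snd p)\<^sup>2 \<le> (s/2)\<^sup>2"
        using s by (auto simp: abs_le_square_iff[symmetric])
      moreover have "(s/8)\<^sup>2 = s\<^sup>2 / 64" "(s/2)\<^sup>2 = s\<^sup>2 / 4"
        by (simp_all add: power_divide)
      ultimately have "s\<^sup>2 / 2 \<le> s\<^sup>2 - (fst p)\<^sup>2 - (pi * snd p)\<^sup>2"
        using zero_le_power2[of s] by linarith
      then have "s\<^sup>2 / 2 \<le> bump s p" unfolding bump_def by linarith
      then show ?thesis using True by (simp only: indicator_simps)
    qed (simp add: bump_nonneg)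
    show "integrable lborel (\<lambda>p. indicator ?B p * (s\<^sup>2 / 2))"
      by (intro integrable_mult_left integrable_real_indicator emeasure_lborel_cbox_finite) simp
  qed (rule int)
  finally show ?thesis .
qed

section \<open>Averages of the short-time Fourier transform over squares\<close>

lemma mem_sqr: "p \<in> sqr c R \<longleftrightarrow> \<bar>fst p - fst c\<bar> \<le> R \<and> \<bar>snd p - snd c\<bar> \<le> R"
  by (cases p) (auto simp: sqr_def)

lemma sqr_0_eq_cbox: "sqr (0, 0) s = cbox (-s, -s) (s, s)"
  by (auto simp: sqr_def cbox_Pair_eq)

text \<open>The factor exp(x^2) cancels the nonholomorphic part of the Gaussian. After exchanging
  the integrals, each fixed t contributes a constant times an exponential in w, and
  \<open>bump_exp_integral\<close> replaces its average by its value at 0.\<close>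

lemma stft_0_eq_bump_average:
  assumes f: "f \<in> L2" and s: "s > 0"
  defines "h \<equiv> \<lambda>p. of_real (bump s p * exp ((fst p)\<^sup>2)) * stft f p"
  shows "integrable lborel h" "(LINT p|lborel. h p) = of_real (LINT p|lborel. bump s p) * stft f (0, 0)"
proof -
  define F where "F p t = of_real (bump s p * exp ((fst p)\<^sup>2)) *
     (f t * of_real (gauss_phi (t - fst p)) * cis (- 2 * pi * snd p * t))" for p :: "real \<times> real" and t
  note [measurable] = L2_measurable[OF f]
  have [measurable]: "bump s \<in> borel_measurable borel"
    by (intro borel_measurable_continuous_onI continuous_intros)
  have shift: "(\<lambda>t. of_real (gauss_phi (t - x)) :: complex) \<in> L2" for x
    using tf_shift_L2[OF window_L2, of "(x, 0)"] by (simp add: tf_shift_time)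
  have absf: "(\<lambda>t. of_real (cmod (f t))) \<in> L2"
    by (rule L2_I) (use L2_integrable_sq[OF f] in auto)
  have prod: "integrable lborel (\<lambda>t. cmod (f t) * gauss_phi (t - x))" for x
    using L2_mult_integrable[OF absf shift, of x]
    by (simp flip: of_real_mult add: complex_of_real_integrable_eq)
  \<comment> \<open>This integral is the transform of |f| at frequency 0, hence bounded by the norm
    uniformly in x; it supplies the majorant for Fubini.\<close>
  have prod_le: "(LINT t|lborel. cmod (f t) * gauss_phi (t - x)) \<le> l2_norm f" for x
  proof -
    have "cmod (stft (\<lambda>t. of_real (cmod (f t))) (x, 0)) \<le> l2_norm (\<lambda>t. of_real (cmod (f t)))"
      by (rule cmod_stft_le[OF absf])
    moreover have "stft (\<lambda>t. of_real (cmod (f t))) (x, 0) = of_real (LINT t|lborel. cmod (f t) * gauss_phi (t - x))"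
      by (simp add: stft_def flip: integral_complex_of_real)
    ultimately show ?thesis by (simp add: l2_norm_def)
  qed
  have normF: "norm (F p t) = bump s p * exp ((fst p)\<^sup>2) * (cmod (f t) * gauss_phi (t - fst p))" for p t
    by (simp add: F_def norm_mult gauss_phi_bounds bump_nonneg)
  have F_measurable: "(\<lambda>(p, t). F p t) \<in> borel_measurable (lborel \<Otimes>\<^sub>M lborel)"
  proof -
    have [measurable]: "bump s \<in> borel_measurable (borel \<Otimes>\<^sub>M borel)"
      by (simp add: borel_prod)
    have "(\<lambda>(p, t). F p t) \<in> borel_measurable ((borel \<Otimes>\<^sub>M borel) \<Otimes>\<^sub>M borel)"
      unfolding F_def by measurable
    moreover have "sets (lborel \<Otimes>\<^sub>M lborel) = sets ((borel :: (real \<times> real) measure) \<Otimes>\<^sub>M (borel :: real measure))"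
      by (intro sets_pair_measure_cong) auto
    ultimately show ?thesis
      unfolding borel_prod by (simp cong: measurable_cong_sets)
  qed
  have pair: "integrable (lborel \<Otimes>\<^sub>M lborel) (\<lambda>(p, t). F p t)"
  proof (rule lborel_pair.Fubini_integrable)
    show "(\<lambda>(p, t). F p t) \<in> borel_measurable (lborel \<Otimes>\<^sub>M lborel)"
      by (rule F_measurable)
    show "AE p in lborel. integrable lborel (\<lambda>t. case (p, t) of (p, t) \<Rightarrow> F p t)"
    proof (rule AE_I2)
      fix p
      show "integrable lborel (\<lambda>t. case (p, t) of (p, t) \<Rightarrow> F p t)"
      proof (rule Bochner_Integration.integrable_bound)
        show "integrable lborel (\<lambda>t. bump s p * exp ((fst p)\<^sup>2) * (cmod (f t) * gauss_phi (t - fst p)))"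
          by (intro integrable_mult_right prod)
        show "(\<lambda>t. case (p, t) of (p, t) \<Rightarrow> F p t) \<in> borel_measurable lborel"
          unfolding F_def prod.case by measurable
      qed (simp add: normF)
    qed
    show "integrable lborel (\<lambda>p. LINT t|lborel. norm (case (p, t) of (p, t) \<Rightarrow> F p t))"
    proof (rule Bochner_Integration.integrable_bound)
      show "integrable lborel (\<lambda>p. indicator (sqr (0, 0) s) p * (s\<^sup>2 * exp (s\<^sup>2) * l2_norm f))"
        unfolding sqr_0_eq_cbox
        by (intro integrable_mult_left integrable_real_indicator emeasure_lborel_cbox_finite) simp
      show "(\<lambda>p. LINT t|lborel. norm (case (p, t) of (p, t) \<Rightarrow> F p t)) \<in> borel_measurable lborel"
        using F_measurable by (intro lborel.borel_measurable_lebesgue_integral) (simp add: split_def)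
      show "AE p in lborel. norm (LINT t|lborel. norm (case (p, t) of (p, t) \<Rightarrow> F p t))
          \<le> norm (indicator (sqr (0, 0) s) p * (s\<^sup>2 * exp (s\<^sup>2) * l2_norm f))"
      proof (rule AE_I2)
        fix p
        have "bump s p * exp ((fst p)\<^sup>2) * (LINT t|lborel. cmod (f t) * gauss_phi (t - fst p))
            \<le> s\<^sup>2 * exp (s\<^sup>2) * l2_norm f" if "p \<in> sqr (0, 0) s"
        proof -
          have "\<bar>fst p\<bar> \<le> s" using that by (auto simp: sqr_def)
          then have "(fst p)\<^sup>2 \<le> s\<^sup>2" using s by (simp add: abs_le_square_iff[symmetric])
          then show ?thesis
            using prod_le by (intro mult_mono bump_le) (auto simp: bump_nonneg integral_nonneg_AE gauss_phi_bounds)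
        qed
        then show "norm (LINT t|lborel. norm (case (p, t) of (p, t) \<Rightarrow> F p t))
          \<le> norm (indicator (sqr (0, 0) s) p * (s\<^sup>2 * exp (s\<^sup>2) * l2_norm f))"
          using bump_support[OF s, of p] unfolding sqr_0_eq_cbox
          by (cases "p \<in> cbox (- s, - s) (s, s)") (auto simp: normF bump_nonneg integral_nonneg_AE gauss_phi_bounds abs_mult)
      qed
    qed
  qed
  have h: "h p = (LINT t|lborel. F p t)" for p
    unfolding h_def F_def stft_def by simp
  show "integrable lborel h"
    using lborel_pair.integrable_fst[OF pair] by (simp add: h[abs_def])
  have "(LINT p|lborel. h p) = (LINT t|lborel. LINT p|lborel. F p t)"
    unfolding h using lborel_pair.Fubini_integral[OF pair] by simp
  also have "\<dots> = (LINT t|lborel. f t * of_real (gauss_phi t) * of_real (LINT p|lborel. bump s p))"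
  proof (rule Bochner_Integration.integral_cong)
    fix t
    have "F p t = (f t * of_real (gauss_phi t)) * (of_real (bump s p) * exp (2 * of_real t * wcoord p))" for p
    proof -
      have "of_real (exp ((fst p)\<^sup>2) * exp (- ((t - fst p)\<^sup>2))) * cis (- 2 * pi * snd p * t)
         = of_real (exp (- (t\<^sup>2))) * exp (2 * of_real t * wcoord p)"
        unfolding cis_conv_exp exp_of_real[symmetric] of_real_mult exp_add[symmetric] wcoord_def
        by (simp add: power2_eq_square algebra_simps)
      then show ?thesis unfolding F_def gauss_phi_def by (simp add: mult_ac)
    qed
    then have "(LINT p|lborel. F p t) = f t * of_real (gauss_phi t) *
        (LINT p|lborel. of_real (bump s p) * exp (2 * of_real t * wcoord p))"
      by simp
    also have "(LINT p|lborel. of_real (bump s p) * exp (2 * of_real t * wcoord p))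
      = (LINT p|lborel. of_real (bump s p) * 1)"
      using bump_exp_integral[OF s, of "of_real t"]
        bump_lborel_integral(2)[OF s, of "\<lambda>p. exp (2 * of_real t * wcoord p)"]
        bump_lborel_integral(2)[OF s, of "\<lambda>p. 1"]
      by (simp add: continuous_intros)
    also have "\<dots> = of_real (LINT p|lborel. bump s p)"
      by (simp only: mult_1_right integral_complex_of_real)
    finally show "(LINT p|lborel. F p t) = f t * of_real (gauss_phi t) * of_real (LINT p|lborel. bump s p)" .
  qed simp
  also have "\<dots> = of_real (LINT p|lborel. bump s p) * stft f (0, 0)"
    by (simp add: stft_def mult.commute)
  finally show "(LINT p|lborel. h p) = of_real (LINT p|lborel. bump s p) * stft f (0, 0)" .
qed

lemma sqr_measurable [measurable]: "sqr c R \<in> sets borel"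
proof -
  have "sqr c R = cbox (fst c - R, snd c - R) (fst c + R, snd c + R)"
    by (auto simp: sqr_def cbox_Pair_eq)
  then show ?thesis by simp
qed

lemma emeasure_sqr: "R \<ge> 0 \<Longrightarrow> emeasure lborel (sqr c R) = ennreal ((2 * R)\<^sup>2)"
proof -
  assume R: "R \<ge> 0"
  have "sqr c R = cbox (fst c - R, snd c - R) (fst c + R, snd c + R)"
    by (auto simp: sqr_def cbox_Pair_eq)
  moreover have "measure lborel (cbox (fst c - R, snd c - R) (fst c + R, snd c + R)) = (2 * R)\<^sup>2"
    using R by (simp add: content_Pair power2_eq_square)
  moreover have "emeasure lborel (cbox (fst c - R, snd c - R) (fst c + R, snd c + R)) \<noteq> \<infinity>"
    using emeasure_lborel_cbox_finite[of "(fst c - R, snd c - R)" "(fst c + R, snd c + R)"] by simp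
  ultimately show ?thesis
    using emeasure_eq_ennreal_measure[of lborel "cbox (fst c - R, snd c - R) (fst c + R, snd c + R)"]
    by simp
qed

text \<open>Dividing the averaging formula by the mass \<kappa> of the bump and bounding its weight
  by K gives an L1 estimate. Cauchy-Schwarz on the square turns it into an L2 estimate at the cost
  of the area (2 s)^2.\<close>

lemma stft_0_submean:
  assumes s: "s > 0"
  shows "\<exists>C>0. \<forall>f\<in>L2. ennreal ((cmod (stft f (0, 0)))\<^sup>2)
    \<le> ennreal C * (\<integral>\<^sup>+ v. indicator (sqr (0, 0) s) v * ennreal ((cmod (stft f v))\<^sup>2) \<partial>lborel)"
proof -
  define \<kappa> where "\<kappa> = (LINT p|lborel. bump s p)"
  define K where "K = s\<^sup>2 * exp (s\<^sup>2)"
  have \<kappa>: "\<kappa> > 0" unfolding \<kappa>_def by (rule bump_integral_pos[OF s])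
  have K: "K > 0" using s by (simp add: K_def)
  show ?thesis
  proof (intro exI[of _ "(K / \<kappa>)\<^sup>2 * (2 * s)\<^sup>2"] conjI ballI)
    show "0 < (K / \<kappa>)\<^sup>2 * (2 * s)\<^sup>2" using s K \<kappa> by simp
    fix f assume f: "f \<in> L2"
    note [measurable] = stft_measurable[OF f]
    let ?Q = "sqr (0, 0) s"
    let ?I = "\<integral>\<^sup>+ v. indicator ?Q v * ennreal (cmod (stft f v)) \<partial>lborel"
    have "ennreal (\<kappa> * cmod (stft f (0, 0)))
        = ennreal (norm (LINT p|lborel. of_real (bump s p * exp ((fst p)\<^sup>2)) * stft f p))"
      unfolding stft_0_eq_bump_average(2)[OF f s] using \<kappa> by (simp add: \<kappa>_def norm_mult)
    also have "\<dots> \<le> (\<integral>\<^sup>+ p. ennreal (norm (of_real (bump s p * exp ((fst p)\<^sup>2)) * stft f p)) \<partial>lborel)"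
      by (rule integral_norm_bound_ennreal[OF stft_0_eq_bump_average(1)[OF f s]])
    also have "\<dots> \<le> (\<integral>\<^sup>+ p. ennreal K * (indicator ?Q p * ennreal (cmod (stft f p))) \<partial>lborel)"
    proof (rule nn_integral_mono)
      fix p
      show "ennreal (norm (of_real (bump s p * exp ((fst p)\<^sup>2)) * stft f p))
        \<le> ennreal K * (indicator ?Q p * ennreal (cmod (stft f p)))"
      proof (cases "p \<in> ?Q")
        case True
        then have "\<bar>fst p\<bar> \<le> s" by (auto simp: sqr_def)
        then have "(fst p)\<^sup>2 \<le> s\<^sup>2" using s by (simp add: abs_le_square_iff[symmetric])
        then have "bump s p * exp ((fst p)\<^sup>2) \<le> K"
          unfolding K_def by (intro mult_mono bump_le) auto
        then have "norm (of_real (bump s p * exp ((fst p)\<^sup>2)) * stft f p) \<le> K * cmod (stft f p)"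
          by (simp add: norm_mult bump_nonneg mult_right_mono)
        then show ?thesis using True K by (simp flip: ennreal_mult)
      next
        case False
        then show ?thesis using bump_support[OF s, of p] by (simp add: sqr_0_eq_cbox)
      qed
    qed
    also have "\<dots> = ennreal K * ?I" by (rule nn_integral_cmult) measurable
    finally have "ennreal (1 / \<kappa>) * ennreal (\<kappa> * cmod (stft f (0, 0))) \<le> ennreal (1 / \<kappa>) * (ennreal K * ?I)"
      by (rule mult_left_mono) simp
    then have "ennreal (cmod (stft f (0, 0))) \<le> ennreal (K / \<kappa>) * ?I"
      using \<kappa> K by (simp flip: mult.assoc ennreal_mult)
    then have "(ennreal (cmod (stft f (0, 0))))\<^sup>2 \<le> (ennreal (K / \<kappa>) * ?I)\<^sup>2"
      by (rule power_mono) simp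
    also have "\<dots> = ennreal ((K / \<kappa>)\<^sup>2) * ?I\<^sup>2"
      using \<kappa> K by (simp add: power_mult_distrib ennreal_power)
    also have "?I\<^sup>2 = (\<integral>\<^sup>+ v. indicator ?Q v * (indicator ?Q v * ennreal (cmod (stft f v))) \<partial>lborel)\<^sup>2"
      by (intro arg_cong[where f = "\<lambda>x. x\<^sup>2"] nn_integral_cong) (simp split: split_indicator)
    also have "\<dots> \<le> (\<integral>\<^sup>+ v. (indicator ?Q v)\<^sup>2 \<partial>lborel) * (\<integral>\<^sup>+ v. (indicator ?Q v * ennreal (cmod (stft f v)))\<^sup>2 \<partial>lborel)"
      by (rule Cauchy_Schwarz_nn_integral) measurable
    also have "(\<integral>\<^sup>+ v. (indicator ?Q v)\<^sup>2 \<partial>lborel) = (\<integral>\<^sup>+ v. indicator ?Q v \<partial>lborel)"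
      by (intro nn_integral_cong) (simp split: split_indicator)
    also have "\<dots> = ennreal ((2 * s)\<^sup>2)" using s by (simp add: emeasure_sqr)
    also have "(\<integral>\<^sup>+ v. (indicator ?Q v * ennreal (cmod (stft f v)))\<^sup>2 \<partial>lborel)
       = (\<integral>\<^sup>+ v. indicator ?Q v * ennreal ((cmod (stft f v))\<^sup>2) \<partial>lborel)"
      by (intro nn_integral_cong) (simp split: split_indicator add: ennreal_power)
    finally show "ennreal ((cmod (stft f (0, 0)))\<^sup>2) \<le> ennreal ((K / \<kappa>)\<^sup>2 * (2 * s)\<^sup>2)
        * (\<integral>\<^sup>+ v. indicator ?Q v * ennreal ((cmod (stft f v))\<^sup>2) \<partial>lborel)"
      by (simp add: ennreal_power ennreal_mult mult.assoc mult_left_mono)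
  qed
qed

text \<open>Covariance moves the origin to z - l: the estimate at 0 is applied to the shift of f by
  l - z, then v is reflected into w = l - v. The square is centred at l whatever z is, so the same
  disjoint squares serve for every z.\<close>

lemma stft_submean:
  assumes s: "s > 0"
  shows "\<exists>C>0. \<forall>f\<in>L2. \<forall>z l. ennreal ((cmod (stft f (z - l)))\<^sup>2)
    \<le> ennreal C * (\<integral>\<^sup>+ w. indicator (sqr l s) w * ennreal ((cmod (stft f (z - w)))\<^sup>2) \<partial>lborel)"
proof -
  obtain C where C: "C > 0" and sub: "\<And>f. f \<in> L2 \<Longrightarrow> ennreal ((cmod (stft f (0, 0)))\<^sup>2)
    \<le> ennreal C * (\<integral>\<^sup>+ v. indicator (sqr (0, 0) s) v * ennreal ((cmod (stft f v))\<^sup>2) \<partial>lborel)"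
    using stft_0_submean[OF s] by blast
  show ?thesis
  proof (intro exI[of _ C] conjI C ballI allI)
    fix f z l assume f: "f \<in> L2"
    note [measurable] = stft_measurable[OF f]
    have V: "cmod (stft (tf_shift f (l - z)) v) = cmod (stft f (z - (l - v)))" for v
      by (simp add: cmod_stft_tf_shift algebra_simps)
    have "ennreal ((cmod (stft f (z - l)))\<^sup>2) = ennreal ((cmod (stft (tf_shift f (l - z)) (0, 0)))\<^sup>2)"
      unfolding V by (simp add: zero_prod_def[symmetric])
    also have "\<dots> \<le> ennreal C * (\<integral>\<^sup>+ v. indicator (sqr (0, 0) s) v * ennreal ((cmod (stft f (z - (l - v))))\<^sup>2) \<partial>lborel)"
      using sub[OF tf_shift_L2[OF f, of "l - z"]] unfolding V .
    also have "(\<integral>\<^sup>+ v. indicator (sqr (0, 0) s) v * ennreal ((cmod (stft f (z - (l - v))))\<^sup>2) \<partial>lborel)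
      = (\<integral>\<^sup>+ v. indicator (sqr l s) (l - v) * ennreal ((cmod (stft f (z - (l - v))))\<^sup>2) \<partial>lborel)"
      by (intro nn_integral_cong arg_cong2[where f = times] refl) (simp add: indicator_def mem_sqr)
    also have "\<dots> = (\<integral>\<^sup>+ w. indicator (sqr l s) w * ennreal ((cmod (stft f (z - w)))\<^sup>2) \<partial>lborel)"
      by (rule nn_integral_lborel_reflect) measurable
    finally show "ennreal ((cmod (stft f (z - l)))\<^sup>2)
      \<le> ennreal C * (\<integral>\<^sup>+ w. indicator (sqr l s) w * ennreal ((cmod (stft f (z - w)))\<^sup>2) \<partial>lborel)" .
  qed
qed

subsection \<open>Families with lower bounds\<close>

lemma bessel_defect_0: "bessel_defect e 0 = l2_inner"
  by (simp add: bessel_defect_def fun_eq_iff)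

lemma bessel_defect_extend_zero: "bessel_defect (e(n := (\<lambda>t. 0))) (Suc n) = bessel_defect e n"
  by (simp add: bessel_defect_def fun_eq_iff)

text \<open>Extending along k lowers the form at f to the minimum of the old form on the line f + s
  k. If k has zero defect, the old form is constant along that line by Cauchy-Schwarz and the zero
  function pads the family; this is why norms are only required to be at most 1.\<close>

lemma bessel_defect_shrink:
  assumes N: "psd_form (bessel_defect e n)" and e: "\<And>i. i < n \<Longrightarrow> e i \<in> L2 \<and> (l2_norm (e i))\<^sup>2 \<le> 1"
    and k: "k \<in> L2"
  obtains e' where "psd_form (bessel_defect e' (Suc n))"
    and "\<And>i. i < Suc n \<Longrightarrow> e' i \<in> L2 \<and> (l2_norm (e' i))\<^sup>2 \<le> 1"
    and "\<And>f s. f \<in> L2 \<Longrightarrow> Re (bessel_defect e' (Suc n) f f)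
      \<le> Re (bessel_defect e n (\<lambda>t. f t + s * k t) (\<lambda>t. f t + s * k t))"
proof (cases "Re (bessel_defect e n k k) > 0")
  case True
  note X = N _ k True
  show thesis
  proof (rule that[of "bessel_extend e n k"])
    show "psd_form (bessel_defect (bessel_extend e n k) (Suc n))"
      by (rule psd_bessel_defect_extend[OF X]) (use e in auto)
    show "bessel_extend e n k i \<in> L2 \<and> (l2_norm (bessel_extend e n k i))\<^sup>2 \<le> 1" if "i < Suc n" for i
      using bessel_extend_L2[OF X, of i] bessel_extend_norm_le[OF X, of i] e that by blast
    show "Re (bessel_defect (bessel_extend e n k) (Suc n) f f)
      \<le> Re (bessel_defect e n (\<lambda>t. f t + s * k t) (\<lambda>t. f t + s * k t))" if f: "f \<in> L2" for f s
      using psd_min_line[OF N f k True, of s] Re_bessel_defect_extend[OF X f] e by simp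
  qed
next
  case False
  then have 0: "Re (bessel_defect e n k k) = 0" using psd_nonneg[OF N k] by simp
  show thesis
  proof (rule that[of "e(n := (\<lambda>t. 0))"])
    show "psd_form (bessel_defect (e(n := (\<lambda>t. 0))) (Suc n))"
      using N by (simp add: bessel_defect_extend_zero)
    show "(e(n := (\<lambda>t. 0))) i \<in> L2 \<and> (l2_norm ((e(n := (\<lambda>t. 0))) i))\<^sup>2 \<le> 1" if "i < Suc n" for i
      using e[of i] that by (auto simp: l2_norm_def)
    show "Re (bessel_defect (e(n := (\<lambda>t. 0))) (Suc n) f f)
      \<le> Re (bessel_defect e n (\<lambda>t. f t + s * k t) (\<lambda>t. f t + s * k t))" if f: "f \<in> L2" for f s
      using psd_cauchy_schwarz[OF N f k] psd_expand[OF N f k, of s] 0 by (simp add: bessel_defect_extend_zero)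
  qed
qed

text \<open>A lower bound that needs the help of \<open>card F\<close> rank-one forms persists, up to \<open>\<eta>\<close>, without
  them off a space of dimension \<open>card F\<close>. Each step removes one rank-one form: near-minimisers
  \<open>k\<close> of \<open>p\<close> on the affine hyperplane \<open>l2_inner k (g x) = 1\<close> are almost \<open>p\<close>-orthogonal to the
  kernel of \<open>l2_inner _ (g x)\<close>, where \<open>p\<close> and \<open>q\<close> agree. Working with near-minimisers avoids
  completeness of \<open>L\<^sup>2\<close>.\<close>
lemma lower_bound_off_finite_rank:
  fixes A :: real
  assumes "finite F" "psd_form q" "A > 0" "\<eta> > 0"
    and "\<And>l. l \<in> F \<Longrightarrow> g l \<in> L2"
    and "\<And>f. f \<in> L2 \<Longrightarrow> A * (l2_norm f)\<^sup>2 \<le> Re (q f f) + (\<Sum>l\<in>F. (cmod (l2_inner f (g l)))\<^sup>2)"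
  shows "\<exists>e. (\<forall>i<card F. e i \<in> L2 \<and> (l2_norm (e i))\<^sup>2 \<le> 1) \<and> psd_form (bessel_defect e (card F)) \<and>
    (\<forall>f\<in>L2. A * Re (bessel_defect e (card F) f f) - \<eta> * (l2_norm f)\<^sup>2 \<le> Re (q f f))"
  using assms
proof (induction F arbitrary: q \<eta> rule: finite_induct)
  case empty
  then have "A * (l2_norm f)\<^sup>2 - \<eta> * (l2_norm f)\<^sup>2 \<le> Re (q f f)" if "f \<in> L2" for f
  proof -
    have "0 \<le> \<eta> * (l2_norm f)\<^sup>2" using empty(3) by simp
    then show ?thesis using empty(5)[OF that] by simp
  qed
  then show ?case
    by (simp add: bessel_defect_0 psd_form_l2_inner Re_l2_inner_self)
next
  case (insert x F)
  note q = \<open>psd_form q\<close> and A = \<open>A > 0\<close> and \<eta> = \<open>\<eta> > 0\<close>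
  let ?n = "card F"
  have g: "g x \<in> L2" and gF: "\<And>l. l \<in> F \<Longrightarrow> g l \<in> L2" using insert.prems by auto
  define p where "p f h = q f h + l2_inner f (g x) * cnj (l2_inner h (g x))" for f h
  have p: "psd_form p" unfolding p_def[abs_def] by (rule psd_form_add_rank1[OF q g])
  have Re_p: "Re (p f f) = Re (q f f) + (cmod (l2_inner f (g x)))\<^sup>2" for f
    by (simp add: p_def complex_mult_cnj cmod_power2)
  have lower: "A * (l2_norm f)\<^sup>2 \<le> Re (p f f) + (\<Sum>l\<in>F. (cmod (l2_inner f (g l)))\<^sup>2)" if "f \<in> L2" for f
    using insert.prems(5)[OF that] insert.hyps by (simp add: Re_p)
  have card: "card (insert x F) = Suc ?n" using insert.hyps by simp
  note LA = psd_add[OF psd_form_l2_inner] psd_scale[OF psd_form_l2_inner]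
  show ?case
  proof (cases "\<exists>f0\<in>L2. l2_inner f0 (g x) \<noteq> 0")
    case False
    \<comment> \<open>Every f is orthogonal to \<open>g x\<close> here, so the rank-one form is zero
      and padding suffices.\<close>
    then have "Re (p f f) = Re (q f f)" if "f \<in> L2" for f using that by (simp add: Re_p)
    then obtain e where e: "\<forall>i<?n. e i \<in> L2 \<and> (l2_norm (e i))\<^sup>2 \<le> 1" "psd_form (bessel_defect e ?n)"
      "\<forall>f\<in>L2. A * Re (bessel_defect e ?n f f) - \<eta> * (l2_norm f)\<^sup>2 \<le> Re (q f f)"
      using insert.IH[OF p A \<eta> gF lower] by auto
    moreover from e(1) have "\<forall>i<Suc ?n. (e(?n := (\<lambda>t. 0))) i \<in> L2 \<and> (l2_norm ((e(?n := (\<lambda>t. 0))) i))\<^sup>2 \<le> 1"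
      by (auto simp: l2_norm_def)
    ultimately show ?thesis unfolding card
      by (intro exI[of _ "e(?n := (\<lambda>t. 0))"]) (simp only: bessel_defect_extend_zero simp_thms)
  next
    case True
    then obtain f0 where f0: "f0 \<in> L2" "l2_inner f0 (g x) \<noteq> 0" by blast
    define S where "S = {Re (p f f) |f. f \<in> L2 \<and> l2_inner f (g x) = 1}"
    define m where "m = Inf S"
    define G where "G = (l2_norm (g x))\<^sup>2"
    \<comment> \<open>\<theta> \<le> 1/2 keeps 1 - \<theta> positive, and the other bound makes
      \<theta> (A + G) at most \<eta>/2. The near-minimiser is allowed the slack \<theta>^2, whose
      square root enters the cross term.\<close>
    define \<theta> where "\<theta> = min (1/2) (\<eta> / (2 * (A + G)))"
    have "A + G > 0" using A by (simp add: G_def add_pos_nonneg)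
    then have \<theta>: "\<theta> > 0" "\<theta> \<le> 1/2" "\<theta> \<le> \<eta> / (2 * (A + G))"
      unfolding \<theta>_def using \<eta> by (simp, intro min.cobounded1, intro min.cobounded2)
    from this(3) have \<theta>_le: "\<theta> * (2 * (A + G)) \<le> \<eta>"
      using \<open>A + G > 0\<close> by (subst (asm) pos_le_divide_eq) auto
    define f1 where "f1 = (\<lambda>t. (1 / l2_inner f0 (g x)) * f0 t)"
    have "f1 \<in> L2"
      unfolding f1_def by (rule L2_scale[OF f0(1)])
    moreover have "l2_inner f1 (g x) = 1"
      unfolding f1_def LA(2)[OF f0(1) g] using f0(2) by simp
    ultimately have "Re (p f1 f1) \<in> S" unfolding S_def by blast
    then have "S \<noteq> {}" by blast
    have bdd: "bdd_below S"
      unfolding S_def by (rule bdd_belowI[of _ 0]) (auto intro: psd_nonneg[OF p])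
    obtain k where k: "k \<in> L2" "l2_inner k (g x) = 1" and k_min: "Re (p k k) < m + \<theta>\<^sup>2"
      using cInf_lessD[OF \<open>S \<noteq> {}\<close>, of "m + \<theta>\<^sup>2"] \<theta>(1) by (auto simp: m_def S_def)
    have pk: "Re (p k k) \<ge> 1" using Re_p[of k] psd_nonneg[OF q k(1)] k(2) by simp
    \<comment> \<open>Adding multiples of h to k stays on the hyperplane, so the form drops by less
      than \<theta>^2; the discriminant of this quadratic gives the near-orthogonality.\<close>
    have orth: "(cmod (p k h))\<^sup>2 \<le> \<theta>\<^sup>2 * Re (p h h)" if h: "h \<in> L2" "l2_inner h (g x) = 0" for h
    proof (rule discriminant_bound)
      fix s
      let ?v = "\<lambda>t. k t + s * h t"
      have "?v \<in> L2" by (intro L2_add L2_scale k h)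
      moreover have "l2_inner ?v (g x) = 1" using k h g by (simp add: LA L2_scale)
      ultimately have "Re (p ?v ?v) \<in> S" by (auto simp: S_def)
      then have "m \<le> Re (p ?v ?v)" unfolding m_def by (rule cInf_lower[OF _ bdd])
      then show "0 \<le> \<theta>\<^sup>2 + 2 * Re (cnj s * p k h) + (cmod s)\<^sup>2 * Re (p h h)"
        using k_min unfolding psd_expand[OF p k(1) h(1)] by linarith
    qed (rule psd_nonneg[OF p h(1)])
    define M where "M = 1 + l2_norm (g x) * l2_norm k"
    have M: "M \<ge> 1" by (simp add: M_def)
    \<comment> \<open>The bound from the induction hypothesis is evaluated at h below, whose norm is
      at most M times that of f. Its error then becomes \<eta>/2 times the squared norm of
      f.\<close>
    define \<eta>1 where "\<eta>1 = \<eta> / 2 / M\<^sup>2"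
    have \<eta>1: "\<eta>1 > 0" using \<eta> M by (simp add: \<eta>1_def)
    obtain e where e: "\<And>i. i < ?n \<Longrightarrow> e i \<in> L2 \<and> (l2_norm (e i))\<^sup>2 \<le> 1" and N: "psd_form (bessel_defect e ?n)"
      and e_lower: "\<And>f. f \<in> L2 \<Longrightarrow> A * Re (bessel_defect e ?n f f) - \<eta>1 * (l2_norm f)\<^sup>2 \<le> Re (p f f)"
      using insert.IH[OF p A \<eta>1 gF lower] by blast
    obtain e' where N': "psd_form (bessel_defect e' (Suc ?n))"
      and e': "\<And>i. i < Suc ?n \<Longrightarrow> e' i \<in> L2 \<and> (l2_norm (e' i))\<^sup>2 \<le> 1"
      and shrink: "\<And>f s. f \<in> L2 \<Longrightarrow> Re (bessel_defect e' (Suc ?n) f f)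
        \<le> Re (bessel_defect e ?n (\<lambda>t. f t + s * k t) (\<lambda>t. f t + s * k t))"
      using bessel_defect_shrink[OF N e k(1)] by blast
    have "A * Re (bessel_defect e' (Suc ?n) f f) - \<eta> * (l2_norm f)\<^sup>2 \<le> Re (q f f)" if f: "f \<in> L2" for f
    proof -
      define t where "t = l2_inner f (g x)"
      \<comment> \<open>The component of f in the kernel of the functional given by
        \<open>g x\<close>; k is normalised there, so f = h + t k.\<close>
      define h where "h = (\<lambda>y. f y + (- t) * k y)"
      define N'f where "N'f = Re (bessel_defect e' (Suc ?n) f f)"
      define F2 where "F2 = (l2_norm f)\<^sup>2"
      have h: "h \<in> L2" unfolding h_def by (intro L2_add L2_scale f k)
      have h0: "l2_inner h (g x) = 0"
        unfolding h_def using f k g LA(1)[OF f L2_scale[OF k(1), of "- t"] g] LA(2)[OF k(1) g, of "- t"]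
        by (simp add: t_def)
      have f_eq: "f = (\<lambda>y. h y + t * k y)" by (simp add: h_def)
      have cross: "- (\<theta> * (Re (p h h) + (cmod t)\<^sup>2)) \<le> 2 * Re (cnj t * p h k)"
      proof -
        have "cmod (p h k) = cmod (p k h)" using psd_herm[OF p k(1) h] by simp
        also have "\<dots> \<le> \<theta> * sqrt (Re (p h h))"
        proof (rule power2_le_imp_le)
          show "(cmod (p k h))\<^sup>2 \<le> (\<theta> * sqrt (Re (p h h)))\<^sup>2"
            using orth[OF h h0] psd_nonneg[OF p h] by (simp add: power_mult_distrib)
          show "0 \<le> \<theta> * sqrt (Re (p h h))" using \<theta>(1) psd_nonneg[OF p h] by simp
        qed
        finally have "cmod t * cmod (p h k) \<le> cmod t * (\<theta> * sqrt (Re (p h h)))"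
          by (rule mult_left_mono) simp
        moreover have "2 * (cmod t * sqrt (Re (p h h))) \<le> Re (p h h) + (cmod t)\<^sup>2"
          using zero_le_power2[of "cmod t - sqrt (Re (p h h))"] psd_nonneg[OF p h]
          by (simp add: power2_diff)
        then have "\<theta> * (2 * (cmod t * sqrt (Re (p h h)))) \<le> \<theta> * (Re (p h h) + (cmod t)\<^sup>2)"
          using \<theta>(1) by (intro mult_left_mono) auto
        moreover have "\<bar>Re (cnj t * p h k)\<bar> \<le> cmod t * cmod (p h k)"
          using abs_Re_le_cmod[of "cnj t * p h k"] by (simp add: norm_mult)
        ultimately show ?thesis by (simp add: algebra_simps abs_le_iff)
      qed
      \<comment> \<open>Since p k k \<ge> 1, the k-part of p covers the rank-one term |t|^2 by which
        p exceeds q; only the cross term costs \<theta>.\<close>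
      have "Re (p f f) = Re (p h h) + 2 * Re (cnj t * p h k) + (cmod t)\<^sup>2 * Re (p k k)"
        by (subst (1 2) f_eq) (rule psd_expand[OF p h k(1)])
      moreover have "(cmod t)\<^sup>2 * 1 \<le> (cmod t)\<^sup>2 * Re (p k k)" using pk by (intro mult_left_mono) auto
      moreover have "Re (p f f) = Re (q f f) + (cmod t)\<^sup>2" by (simp add: Re_p t_def)
      ultimately have q1: "(1 - \<theta>) * Re (p h h) - \<theta> * (cmod t)\<^sup>2 \<le> Re (q f f)"
        using cross by (simp add: algebra_simps)
      have t_le: "(cmod t)\<^sup>2 \<le> G * F2"
        using l2_cauchy_schwarz[OF f g] by (simp add: t_def G_def F2_def mult.commute)
      have "l2_norm h \<le> l2_norm f + cmod t * l2_norm k"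
        using l2_norm_add_scale_le[OF f k(1), of "- t"] by (simp add: h_def)
      also have "cmod t * l2_norm k \<le> (l2_norm f * l2_norm (g x)) * l2_norm k"
        unfolding t_def by (intro mult_right_mono l2_cauchy_schwarz_norm f g) simp
      finally have "l2_norm h \<le> M * l2_norm f" by (simp add: M_def algebra_simps)
      then have "(l2_norm h)\<^sup>2 \<le> M\<^sup>2 * F2"
        unfolding F2_def power_mult_distrib[symmetric] by (intro power_mono) auto
      then have "\<eta>1 * (l2_norm h)\<^sup>2 \<le> \<eta>1 * (M\<^sup>2 * F2)" using \<eta>1 by simp
      also have "\<dots> = \<eta> / 2 * F2" using M by (simp add: \<eta>1_def)
      finally have h_err: "\<eta>1 * (l2_norm h)\<^sup>2 \<le> \<eta> / 2 * F2" .
      \<comment> \<open>The shrinking bound at s = - t: the point of the line that lies in the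
        kernel.\<close>
      have "N'f \<le> Re (bessel_defect e ?n h h)"
        unfolding N'f_def h_def by (rule shrink[OF f])
      then have "A * N'f \<le> A * Re (bessel_defect e ?n h h)" using A by simp
      then have ph: "A * N'f - \<eta> / 2 * F2 \<le> Re (p h h)" using e_lower[OF h] h_err by linarith
      have N'f: "N'f \<le> F2" unfolding N'f_def F2_def by (rule Re_bessel_defect_le)
      have F2: "F2 \<ge> 0" by (simp add: F2_def)
      have "\<theta> * (A * N'f) \<le> \<theta> * (A * F2)" using N'f A \<theta>(1) by (intro mult_left_mono) auto
      moreover have "\<theta> * (cmod t)\<^sup>2 \<le> \<theta> * (G * F2)" using t_le \<theta>(1) by (intro mult_left_mono) auto
      moreover have "\<theta> * (A * F2) + \<theta> * (G * F2) \<le> \<eta> / 2 * F2"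
        using mult_right_mono[OF \<theta>_le F2] by (simp add: algebra_simps)
      moreover have "(1 - \<theta>) * (A * N'f - \<eta> / 2 * F2) \<le> (1 - \<theta>) * Re (p h h)"
        using ph \<theta>(2) by (intro mult_left_mono) auto
      moreover have "(1 - \<theta>) * (X - Y) = X - \<theta> * X - Y + \<theta> * Y" for X Y
        by (simp add: algebra_simps)
      note this[of "A * N'f" "\<eta> / 2 * F2"]
      moreover have "\<eta> * F2 = \<eta> / 2 * F2 + \<eta> / 2 * F2" by simp
      moreover have "0 \<le> \<theta> * (\<eta> / 2 * F2)" using \<theta>(1) \<eta> F2 by simp
      ultimately show ?thesis using q1 unfolding N'f_def[symmetric] F2_def[symmetric] by linarith
    qed
    then show ?thesis unfolding card using N' e' by blast
  qed
qed

section \<open>Riesz side: spans with explicit coefficients and orthonormal families\<close>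

definition lin_span :: "('l \<Rightarrow> real \<Rightarrow> complex) \<Rightarrow> 'l set \<Rightarrow> (real \<Rightarrow> complex) set" where
  "lin_span g F = {f. \<exists>c. f = (\<lambda>t. \<Sum>l\<in>F. c l * g l t)}"

lemma lin_span_add: "f \<in> lin_span g F \<Longrightarrow> h \<in> lin_span g F \<Longrightarrow> (\<lambda>t. f t + h t) \<in> lin_span g F"
  unfolding lin_span_def
proof clarify
  fix c d
  show "\<exists>c'. (\<lambda>t. (\<Sum>l\<in>F. c l * g l t) + (\<Sum>l\<in>F. d l * g l t)) = (\<lambda>t. \<Sum>l\<in>F. c' l * g l t)"
    by (rule exI[of _ "\<lambda>l. c l + d l"]) (simp add: distrib_right sum.distrib)
qed

lemma lin_span_scale: "f \<in> lin_span g F \<Longrightarrow> (\<lambda>t. a * f t) \<in> lin_span g F"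
  unfolding lin_span_def
proof clarify
  fix c
  show "\<exists>c'. (\<lambda>t. a * (\<Sum>l\<in>F. c l * g l t)) = (\<lambda>t. \<Sum>l\<in>F. c' l * g l t)"
    by (rule exI[of _ "\<lambda>l. a * c l"]) (simp add: sum_distrib_left mult.assoc)
qed

lemma lin_span_zero: "(\<lambda>t. 0) \<in> lin_span g F"
  unfolding lin_span_def by (auto intro!: exI[of _ "\<lambda>l. 0"])

lemma lin_span_sum: "(\<And>i. i < (n::nat) \<Longrightarrow> e i \<in> lin_span g F) \<Longrightarrow> (\<lambda>t. \<Sum>i<n. a i * e i t) \<in> lin_span g F"
  by (induction n) (auto simp: lin_span_zero intro!: lin_span_add lin_span_scale)

lemma lin_span_insert:
  assumes "finite F" "x \<notin> F" "f \<in> lin_span g F"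
  shows "\<exists>c. c x = a \<and> (\<lambda>t. a * g x t + f t) = (\<lambda>t. \<Sum>l\<in>insert x F. c l * g l t)"
proof -
  obtain c where c: "f = (\<lambda>t. \<Sum>l\<in>F. c l * g l t)" using assms(3) by (auto simp: lin_span_def)
  show ?thesis
    using assms(1,2) by (intro exI[of _ "c(x := a)"]) (auto simp: c fun_eq_iff intro!: sum.cong)
qed

text \<open>The lower Riesz bound acts as quantitative linear independence: the residual of
  \<open>g x\<close> is a combination with coefficient 1 at x, so its squared norm, which equals the
  defect, is at least A. No step degenerates and all norms are 1.\<close>

lemma gram_schmidt:
  fixes A :: real
  assumes "finite F" "A > 0" "\<And>l. l \<in> F \<Longrightarrow> g l \<in> L2"
    and "\<And>c. A * (\<Sum>l\<in>F. (cmod (c l))\<^sup>2) \<le> (l2_norm (\<lambda>t. \<Sum>l\<in>F. c l * g l t))\<^sup>2"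
  shows "\<exists>e. (\<forall>i<card F. e i \<in> L2 \<and> (l2_norm (e i))\<^sup>2 = 1 \<and> e i \<in> lin_span g F) \<and>
     psd_form (bessel_defect e (card F))"
  using assms
proof (induction F rule: finite_induct)
  case empty
  then show ?case by (simp add: bessel_defect_0 psd_form_l2_inner)
next
  case (insert x F)
  let ?n = "card F"
  have g: "g x \<in> L2" and gF: "\<And>l. l \<in> F \<Longrightarrow> g l \<in> L2" using insert.prems by auto
  have card: "card (insert x F) = Suc ?n" using insert.hyps by simp
  have "A * (\<Sum>l\<in>F. (cmod (c l))\<^sup>2) \<le> (l2_norm (\<lambda>t. \<Sum>l\<in>F. c l * g l t))\<^sup>2" for c
  proof -
    have "(\<Sum>l\<in>F. (cmod ((c(x := 0)) l))\<^sup>2) = (\<Sum>l\<in>F. (cmod (c l))\<^sup>2)"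
      using insert.hyps by (intro sum.cong) auto
    moreover have "(\<Sum>l\<in>F. (c(x := 0)) l * g l t) = (\<Sum>l\<in>F. c l * g l t)" for t
      using insert.hyps by (intro sum.cong) auto
    ultimately show ?thesis using insert.prems(3)[of "c(x := 0)"] insert.hyps by simp
  qed
  then obtain e where e: "\<And>i. i < ?n \<Longrightarrow> e i \<in> L2" and one: "\<And>i. i < ?n \<Longrightarrow> (l2_norm (e i))\<^sup>2 = 1"
    and span: "\<And>i. i < ?n \<Longrightarrow> e i \<in> lin_span g F" and N: "psd_form (bessel_defect e ?n)"
    using insert.IH insert.prems(1) gF by blast
  let ?P = "proj_compl e ?n (g x)"
  obtain c where c: "c x = 1" "?P = (\<lambda>t. \<Sum>l\<in>insert x F. c l * g l t)"
    using lin_span_insert[OF insert.hyps lin_span_sum[of ?n e g F "\<lambda>i. - l2_inner (g x) (e i)", OF span], of 1]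
    unfolding proj_compl_def by auto
  have "A * 1 \<le> A * (\<Sum>l\<in>insert x F. (cmod (c l))\<^sup>2)"
    using c(1) insert.hyps insert.prems(1) by (intro mult_left_mono) (auto simp: sum_nonneg)
  also have "\<dots> \<le> (l2_norm ?P)\<^sup>2" unfolding c(2) by (rule insert.prems(3))
  finally have pos: "Re (bessel_defect e ?n (g x) (g x)) > 0"
    using l2_norm_proj_compl[OF N e g one] insert.prems(1) by simp
  note X = N e g pos
  have mono: "f \<in> lin_span g (insert x F)" if "f \<in> lin_span g F" for f
    using lin_span_insert[OF insert.hyps that, of 0] by (auto simp: lin_span_def)
  have "bessel_extend e ?n (g x) i \<in> lin_span g (insert x F)" if "i < Suc ?n" for i
  proof (cases "i = ?n")
    case True
    have "?P \<in> lin_span g (insert x F)" unfolding c(2) lin_span_def by blast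
    then show ?thesis using True unfolding bessel_extend_def by (simp only: fun_upd_same lin_span_scale)
  next
    case False
    then show ?thesis using that span mono by (simp add: bessel_extend_def)
  qed
  moreover have "bessel_extend e ?n (g x) i \<in> L2" "(l2_norm (bessel_extend e ?n (g x) i))\<^sup>2 = 1" if "i < Suc ?n" for i
    using bessel_extend_L2[OF X that] bessel_extend_norm_eq[OF X one that] by auto
  moreover have "psd_form (bessel_defect (bessel_extend e ?n (g x)) (Suc ?n))"
    by (rule psd_bessel_defect_extend[OF X])
  ultimately show ?case unfolding card by blast
qed

text \<open>For f = P u with coefficients c in the family \<open>g\<close>, the sum s of the |<u,
  e_i>|^2 is <u, f>. Expanding f and using AM-GM gives 2 A s \<le> A^2 sum |c_l|^2 + sum |<u,
  g_l>|^2, while the Riesz bound gives A sum |c_l|^2 \<le> \<parallel>f\<parallel>^2 \<le>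
  s.\<close>

lemma riesz_projection_bound:
  fixes A :: real
  assumes F: "finite F" and A: "A > 0" and g: "\<And>l. l \<in> F \<Longrightarrow> g l \<in> L2"
    and riesz: "\<And>c. A * (\<Sum>l\<in>F. (cmod (c l))\<^sup>2) \<le> (l2_norm (\<lambda>t. \<Sum>l\<in>F. c l * g l t))\<^sup>2"
    and e: "\<And>i. i < n \<Longrightarrow> e i \<in> L2" and span: "\<And>i. i < n \<Longrightarrow> e i \<in> lin_span g F"
    and N: "psd_form (bessel_defect e n)" and u: "u \<in> L2"
  shows "A * (\<Sum>i<n. (cmod (l2_inner u (e i)))\<^sup>2) \<le> (\<Sum>l\<in>F. (cmod (l2_inner u (g l)))\<^sup>2)"
proof -
  note P = psd_form_l2_inner
  define s where "s = (\<Sum>i<n. (cmod (l2_inner u (e i)))\<^sup>2)"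
  define f where "f = (\<lambda>t. \<Sum>i<n. l2_inner u (e i) * e i t)"
  obtain c where c: "f = (\<lambda>t. \<Sum>l\<in>F. c l * g l t)"
    using lin_span_sum[of n e g F "\<lambda>i. l2_inner u (e i)", OF span] by (auto simp: f_def lin_span_def)
  have f: "f \<in> L2" unfolding f_def using e by (intro L2_sum) auto
  have amgm: "2 * (x * y) \<le> x\<^sup>2 + y\<^sup>2" for x y :: real
    using zero_le_power2[of "x - y"] by (simp add: power2_diff)
  have "l2_inner u f = (\<Sum>i<n. cnj (l2_inner u (e i)) * l2_inner u (e i))"
    unfolding f_def using e u by (intro psd_sum_right[OF P]) auto
  also have "\<dots> = of_real s" unfolding s_def of_real_sum
    by (intro sum.cong refl) (simp only: complex_norm_square mult.commute)
  finally have uf: "l2_inner u f = of_real s" .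
  \<comment> \<open>The bound \<parallel>f\<parallel>^2 \<le> s follows from Bessel's inequality for
    f itself: 2 \<parallel>f\<parallel>^2 \<le> s + sum |<f, e_i>|^2 \<le> s +
    \<parallel>f\<parallel>^2.\<close>
  have "l2_inner f f = (\<Sum>i<n. l2_inner u (e i) * l2_inner (e i) f)"
    by (subst f_def) (use e f in \<open>intro psd_sum[OF P]; auto\<close>)
  then have "(l2_norm f)\<^sup>2 = cmod (\<Sum>i<n. l2_inner u (e i) * l2_inner (e i) f)"
    by (metis Re_l2_inner_self l2_inner_self l2_norm_sq norm_of_real abs_of_nonneg zero_le_power2)
  also have "\<dots> \<le> (\<Sum>i<n. cmod (l2_inner u (e i)) * cmod (l2_inner f (e i)))"
    using e f psd_herm[OF P f] by (intro order_trans[OF norm_sum] sum_mono) (simp add: norm_mult)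
  finally have "2 * (l2_norm f)\<^sup>2 \<le> (\<Sum>i<n. 2 * (cmod (l2_inner u (e i)) * cmod (l2_inner f (e i))))"
    unfolding sum_distrib_left[symmetric] by simp
  also have "\<dots> \<le> (\<Sum>i<n. (cmod (l2_inner u (e i)))\<^sup>2 + (cmod (l2_inner f (e i)))\<^sup>2)"
    by (intro sum_mono amgm)
  also have "\<dots> = s + (\<Sum>i<n. (cmod (l2_inner f (e i)))\<^sup>2)" by (simp add: s_def sum.distrib)
  also have "\<dots> \<le> s + (l2_norm f)\<^sup>2"
    using psd_nonneg[OF N f] by (simp add: Re_bessel_defect)
  finally have f_le: "(l2_norm f)\<^sup>2 \<le> s" by simp
  have "l2_inner u f = (\<Sum>l\<in>F. cnj (c l) * l2_inner u (g l))"
    unfolding c using F g u by (intro psd_sum_right[OF P]) auto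
  moreover have "s = cmod (l2_inner u f)" 
    unfolding uf norm_of_real by (simp add: s_def sum_nonneg)
  ultimately have "s = cmod (\<Sum>l\<in>F. cnj (c l) * l2_inner u (g l))"
    by simp
  also have "\<dots> \<le> (\<Sum>l\<in>F. cmod (c l) * cmod (l2_inner u (g l)))"
    by (intro order_trans[OF norm_sum] sum_mono) (simp add: norm_mult)
  finally have "2 * A * s \<le> (\<Sum>l\<in>F. 2 * ((A * cmod (c l)) * cmod (l2_inner u (g l))))"
    using A by (simp add: mult.assoc flip: sum_distrib_left)
  also have "\<dots> \<le> (\<Sum>l\<in>F. (A * cmod (c l))\<^sup>2 + (cmod (l2_inner u (g l)))\<^sup>2)"
    by (intro sum_mono amgm)
  also have "\<dots> = A * (A * (\<Sum>l\<in>F. (cmod (c l))\<^sup>2)) + (\<Sum>l\<in>F. (cmod (l2_inner u (g l)))\<^sup>2)"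
    by (simp add: sum.distrib sum_distrib_left power_mult_distrib power2_eq_square mult_ac)
  also have "A * (A * (\<Sum>l\<in>F. (cmod (c l))\<^sup>2)) \<le> A * s"
    using riesz[of c] f_le A unfolding c by (intro mult_left_mono) auto
  finally show ?thesis by (simp add: s_def)
qed

subsection \<open>Sampling the short-time Fourier transform\<close>

text \<open>A limit point in the compact square would bring two points closer than \<delta>.
  Finiteness gives the count its meaning, since \<open>card\<close> of an infinite set is 0.\<close>

lemma finite_uniformly_discrete_sqr:
  assumes ud: "uniformly_discrete \<delta> \<Lambda>" and \<delta>: "\<delta> > 0"
  shows "finite (\<Lambda> \<inter> sqr c R)"
proof (rule ccontr)
  assume inf: "infinite (\<Lambda> \<inter> sqr c R)"
  have "sqr c R = cbox (fst c - R, snd c - R) (fst c + R, snd c + R)"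
    by (auto simp: mem_sqr cbox_Pair_eq)
  then have "compact (sqr c R)" by simp
  then obtain x where x: "x islimpt (\<Lambda> \<inter> sqr c R)"
    using inf unfolding compact_eq_Bolzano_Weierstrass by blast
  obtain p where p: "p \<in> \<Lambda>" "p \<noteq> x" "dist p x < \<delta> / 2"
    using x \<delta> unfolding islimpt_approachable by (metis IntD1 half_gt_zero)
  \<comment> \<open>Choosing q strictly closer to x than p makes the two points distinct.\<close>
  obtain q where q: "q \<in> \<Lambda>" "q \<noteq> x" "dist q x < min (\<delta> / 2) (dist p x)"
    using x \<delta> p(2) unfolding islimpt_approachable
    by (metis IntD1 half_gt_zero min_less_iff_conj zero_less_dist_iff)
  have "dist p q \<le> dist p x + dist q x" by (rule dist_triangle2)
  also have "\<dots> < \<delta>" using p(3) q(3) by simp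
  finally have "dist p q < \<delta>" .
  moreover have "p \<noteq> q" using q(3) by auto
  ultimately show False using ud p(1) q(1) unfolding uniformly_discrete_def by fastforce
qed

text \<open>A common point puts both coordinates within 2 r of each other, so the distance is at
  most 4 r \<le> \<delta> by comparison with the l1 norm.\<close>

lemma sqr_disjoint:
  assumes ud: "uniformly_discrete \<delta> \<Lambda>" and l: "l \<in> \<Lambda>" "l' \<in> \<Lambda>" "l \<noteq> l'"
    and r: "r \<le> \<delta> / 4"
  shows "sqr l r \<inter> sqr l' r = {}"
proof (rule ccontr)
  assume "sqr l r \<inter> sqr l' r \<noteq> {}"
  then obtain w where "w \<in> sqr l r" "w \<in> sqr l' r" by blast
  then have "\<bar>fst l - fst l'\<bar> \<le> 2 * r" "\<bar>snd l - snd l'\<bar> \<le> 2 * r"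
    unfolding mem_sqr by linarith+
  then have "dist l l' \<le> 4 * r"
    using sqrt_sum_squares_le_sum_abs[of "fst l - fst l'" "snd l - snd l'"]
    by (simp add: dist_prod_def dist_real_def)
  moreover have "dist l l' > \<delta>" using ud l unfolding uniformly_discrete_def by blast
  ultimately show False using r by linarith
qed

text \<open>The constant is fixed before f, \<Lambda> and z, which makes the final constant uniform.
  In the half-width, \<delta>/4 makes the squares around the points disjoint and 1/4 keeps them
  inside the margin around the counted square.\<close>

definition stft_sampling_const :: "real \<Rightarrow> real \<Rightarrow> bool" where
  "stft_sampling_const \<delta> C \<longleftrightarrow> C > 0 \<and>
    (\<forall>f\<in>L2. \<forall>\<Lambda> F D z. uniformly_discrete \<delta> \<Lambda> \<longrightarrow> finite F \<longrightarrow> F \<subseteq> \<Lambda> \<longrightarrow>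
      D \<in> sets borel \<longrightarrow> (\<forall>l\<in>F. sqr l (min \<delta> 1 / 4) \<subseteq> D) \<longrightarrow>
      ennreal (\<Sum>l\<in>F. (cmod (stft f (z - l)))\<^sup>2)
        \<le> ennreal C * (\<integral>\<^sup>+ w. indicator D w * ennreal ((cmod (stft f (z - w)))\<^sup>2) \<partial>lborel))"

lemma stft_sampling_bound:
  assumes "stft_sampling_const \<delta> C" "f \<in> L2" "uniformly_discrete \<delta> \<Lambda>" "finite F" "F \<subseteq> \<Lambda>"
    "D \<in> sets borel" "\<forall>l\<in>F. sqr l (min \<delta> 1 / 4) \<subseteq> D"
  shows "ennreal (\<Sum>l\<in>F. (cmod (stft f (z - l)))\<^sup>2)
      \<le> ennreal C * (\<integral>\<^sup>+ w. indicator D w * ennreal ((cmod (stft f (z - w)))\<^sup>2) \<partial>lborel)"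
  using assms unfolding stft_sampling_const_def by blast

text \<open>Disjoint squares inside D have indicators summing to at most that of D, so the submean
  estimates add up to one integral over D.\<close>

lemma stft_sampling_const_exists:
  assumes \<delta>: "\<delta> > 0"
  shows "\<exists>C. stft_sampling_const \<delta> C"
proof -
  define r where "r = min \<delta> 1 / 4"
  have r: "r > 0" "r \<le> \<delta> / 4" using \<delta> by (auto simp: r_def)
  obtain C where C: "C > 0" and sub: "\<And>f z l. f \<in> L2 \<Longrightarrow> ennreal ((cmod (stft f (z - l)))\<^sup>2)
    \<le> ennreal C * (\<integral>\<^sup>+ w. indicator (sqr l r) w * ennreal ((cmod (stft f (z - w)))\<^sup>2) \<partial>lborel)"
    using stft_submean[OF r(1)] by blast
  show ?thesis unfolding stft_sampling_const_def r_def[symmetric]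
  proof (intro exI[of _ C] conjI C ballI allI impI)
    fix f \<Lambda> F D z
    assume f: "f \<in> L2" and ud: "uniformly_discrete \<delta> \<Lambda>" and F: "finite F" "F \<subseteq> \<Lambda>"
      and D [measurable]: "D \<in> sets borel" and sub_D: "\<forall>l\<in>F. sqr l r \<subseteq> D"
    note [measurable] = stft_measurable[OF f]
    let ?g = "\<lambda>w. ennreal ((cmod (stft f (z - w)))\<^sup>2)"
    have ind: "(\<Sum>l\<in>F. indicator (sqr l r) w) \<le> (indicator D w :: ennreal)" for w
    proof (cases "\<exists>l\<in>F. w \<in> sqr l r")
      case True
      then obtain l where l: "l \<in> F" "w \<in> sqr l r" by blast
      have "indicator (sqr l' r) w = (0::ennreal)" if "l' \<in> F - {l}" for l'
        using sqr_disjoint[OF ud, of l l' r] that l F r(2) by (auto simp: indicator_def)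
      then have "(\<Sum>l\<in>F. indicator (sqr l r) w) = (1::ennreal)"
        using l F(1) by (simp add: sum.remove[of F l])
      moreover have "w \<in> D" using sub_D l by blast
      ultimately show ?thesis by simp
    next
      case False
      then have "(\<Sum>l\<in>F. indicator (sqr l r) w) = (0::ennreal)"
        by (intro sum.neutral) (auto simp: indicator_def)
      then show ?thesis by simp
    qed
    have "ennreal (\<Sum>l\<in>F. (cmod (stft f (z - l)))\<^sup>2) = (\<Sum>l\<in>F. ennreal ((cmod (stft f (z - l)))\<^sup>2))"
      by simp
    also have "\<dots> \<le> (\<Sum>l\<in>F. ennreal C * (\<integral>\<^sup>+ w. indicator (sqr l r) w * ?g w \<partial>lborel))"
      by (intro sum_mono sub f)
    also have "\<dots> = ennreal C * (\<integral>\<^sup>+ w. (\<Sum>l\<in>F. indicator (sqr l r) w) * ?g w \<partial>lborel)"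
      by (simp add: sum_distrib_right nn_integral_sum flip: sum_distrib_left)
    also have "\<dots> \<le> ennreal C * (\<integral>\<^sup>+ w. indicator D w * ?g w \<partial>lborel)"
      by (intro mult_left_mono nn_integral_mono mult_right_mono ind) auto
    finally show "ennreal (\<Sum>l\<in>F. (cmod (stft f (z - l)))\<^sup>2)
      \<le> ennreal C * (\<integral>\<^sup>+ w. indicator D w * ?g w \<partial>lborel)" .
  qed
qed

subsection \<open>The integral \<open>I_G\<close>\<close>

lemma moyal_shift:
  assumes f: "f \<in> L2"
  shows "(\<integral>\<^sup>+ q. ennreal ((cmod (stft f (q - p)))\<^sup>2) \<partial>lborel) = ennreal ((l2_norm f)\<^sup>2)"
proof -
  note [measurable] = stft_measurable[OF f]
  have "(\<integral>\<^sup>+ q. ennreal ((cmod (stft f (q - p)))\<^sup>2) \<partial>lborel) = (\<integral>\<^sup>+ q. ennreal ((cmod (stft f q))\<^sup>2) \<partial>lborel)"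
    using nn_integral_lborel_shift[of "\<lambda>q. ennreal ((cmod (stft f q))\<^sup>2)" "- p"] by simp
  then show ?thesis by (simp add: moyal[OF f])
qed

text \<open>A Bochner integral defaults to 0 without integrability, so \<open>I_G\<close> carries
  information only once both integrals exist: Moyal bounds the inner one, and this bound on a square
  of finite area controls the outer one.\<close>

lemma I_G_eq_nn_integral:
  assumes f: "f \<in> L2"
  shows "ennreal (I_G (stft f) R) = (\<integral>\<^sup>+ p. indicator (sqr (0, 0) R) p *
     (\<integral>\<^sup>+ q. indicator (- sqr (0, 0) (R + 1/4)) q * ennreal ((cmod (stft f (q - p)))\<^sup>2) \<partial>lborel) \<partial>lborel)"
proof -
  note [measurable] = stft_measurable[OF f]
  let ?S = "- sqr (0, 0) (R + 1/4)"
  define h where "h p q = indicator ?S q * (cmod (stft f (q - p)))\<^sup>2" for p q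
  define H where "H p = (LINT q|lborel. h p q)" for p
  have [measurable]: "(\<lambda>(p, q). h p q) \<in> borel_measurable (borel \<Otimes>\<^sub>M borel)"
    unfolding h_def by measurable
  have h_nn: "ennreal (h p q) = indicator ?S q * ennreal ((cmod (stft f (q - p)))\<^sup>2)" for p q
    by (simp add: h_def split: split_indicator)
  have h_le: "(\<integral>\<^sup>+ q. ennreal (h p q) \<partial>lborel) \<le> ennreal ((l2_norm f)\<^sup>2)" for p
    unfolding moyal_shift[OF f, of p, symmetric] h_nn
    by (intro nn_integral_mono) (simp split: split_indicator)
  have h_int: "integrable lborel (h p)" for p
  proof (rule integrableI_bounded)
    show "h p \<in> borel_measurable lborel" unfolding h_def by measurable
    have "(\<integral>\<^sup>+ q. ennreal (norm (h p q)) \<partial>lborel) = (\<integral>\<^sup>+ q. ennreal (h p q) \<partial>lborel)"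
      by (simp add: h_def abs_mult)
    also have "\<dots> < \<infinity>" using h_le[of p] by (auto intro: order.strict_trans1)
    finally show "(\<integral>\<^sup>+ q. ennreal (norm (h p q)) \<partial>lborel) < \<infinity>" .
  qed
  have H_nn: "ennreal (H p) = (\<integral>\<^sup>+ q. ennreal (h p q) \<partial>lborel)" for p
    unfolding H_def using h_int by (intro nn_integral_eq_integral[symmetric]) (auto simp: h_def)
  have H_nonneg: "0 \<le> H p" for p unfolding H_def h_def by (simp add: integral_nonneg_AE)
  have H_le: "H p \<le> (l2_norm f)\<^sup>2" for p
    using h_le[of p] unfolding H_nn[symmetric] by simp
  have [measurable]: "H \<in> borel_measurable borel"
  proof -
    have "(\<lambda>(p, q). h p q) \<in> borel_measurable (borel \<Otimes>\<^sub>M lborel)"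
      unfolding h_def by measurable
    then show ?thesis unfolding H_def[abs_def] by (rule lborel.borel_measurable_lebesgue_integral)
  qed
  have int: "integrable lborel (\<lambda>p. indicator (sqr (0, 0) R) p * H p)"
  proof (rule Bochner_Integration.integrable_bound)
    show "integrable lborel (\<lambda>p. indicator (sqr (0, 0) R) p * (l2_norm f)\<^sup>2)"
      unfolding sqr_0_eq_cbox by (intro integrable_mult_left integrable_real_indicator emeasure_lborel_cbox_finite) simp
    show "AE p in lborel. norm (indicator (sqr (0, 0) R) p * H p) \<le> norm (indicator (sqr (0, 0) R) p * (l2_norm f)\<^sup>2)"
      using H_nonneg H_le by (intro AE_I2) (auto simp: indicator_def)
  qed measurable
  have "I_G (stft f) R = (LINT p|lborel. indicator (sqr (0, 0) R) p * H p)"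
    unfolding I_G_def set_lebesgue_integral_def H_def h_def by simp
  then have "ennreal (I_G (stft f) R) = (\<integral>\<^sup>+ p. ennreal (indicator (sqr (0, 0) R) p * H p) \<partial>lborel)"
    using int H_nonneg by (simp add: nn_integral_eq_integral)
  also have "\<dots> = (\<integral>\<^sup>+ p. indicator (sqr (0, 0) R) p * (\<integral>\<^sup>+ q. ennreal (h p q) \<partial>lborel) \<partial>lborel)"
    unfolding H_nn[symmetric] by (intro nn_integral_cong) (simp split: split_indicator)
  finally show ?thesis unfolding h_nn .
qed

lemma I_G_nonneg: "0 \<le> I_G G R"
proof -
  have "0 \<le> (LINT q : - sqr (0, 0) (R + 1/4) | lborel. (cmod (G (q - p)))^2)" for p
    unfolding set_lebesgue_integral_def by (intro integral_nonneg_AE) auto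
  then show ?thesis
    unfolding I_G_def by (subst set_lebesgue_integral_def) (intro integral_nonneg_AE AE_I2, simp)
qed

text \<open>The frame configuration, z inside and w outside: z = c - p and w = c - q turn z - w into
  q - p.\<close>

lemma I_G_reflected:
  assumes f: "f \<in> L2"
  shows "(\<integral>\<^sup>+ z. indicator (sqr c R) z *
     (\<integral>\<^sup>+ w. indicator (- sqr c (R + 1/4)) w * ennreal ((cmod (stft f (z - w)))\<^sup>2) \<partial>lborel) \<partial>lborel)
   = ennreal (I_G (stft f) R)" (is "nn_integral lborel ?H = _")
proof -
  note [measurable] = stft_measurable[OF f]
  have ind: "indicator (sqr c S) (c - p) = (indicator (sqr (0, 0) S) p :: ennreal)"
    "indicator (- sqr c S) (c - p) = (indicator (- sqr (0, 0) S) p :: ennreal)" for S p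
    by (simp_all add: indicator_def mem_sqr)
  have "nn_integral lborel ?H = (\<integral>\<^sup>+ p. ?H (c - p) \<partial>lborel)"
    by (rule nn_integral_lborel_reflect[symmetric]) measurable
  also have "\<dots> = (\<integral>\<^sup>+ p. indicator (sqr (0, 0) R) p *
     (\<integral>\<^sup>+ q. indicator (- sqr (0, 0) (R + 1/4)) q * ennreal ((cmod (stft f (q - p)))\<^sup>2) \<partial>lborel) \<partial>lborel)"
  proof (rule nn_integral_cong)
    fix p
    have "(\<integral>\<^sup>+ w. indicator (- sqr c (R + 1/4)) w * ennreal ((cmod (stft f (c - p - w)))\<^sup>2) \<partial>lborel)
      = (\<integral>\<^sup>+ q. indicator (- sqr c (R + 1/4)) (c - q) * ennreal ((cmod (stft f (c - p - (c - q))))\<^sup>2) \<partial>lborel)"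
      by (rule nn_integral_lborel_reflect[symmetric]) measurable
    then show "?H (c - p) = indicator (sqr (0, 0) R) p *
     (\<integral>\<^sup>+ q. indicator (- sqr (0, 0) (R + 1/4)) q * ennreal ((cmod (stft f (q - p)))\<^sup>2) \<partial>lborel)"
      by (simp add: ind)
  qed
  finally show ?thesis by (simp add: I_G_eq_nn_integral[OF f])
qed

text \<open>The Riesz configuration, z outside and w inside: after exchanging the integrals, w = c +
  p and z = c + q give q - p. The modulus of the transform need not be even, so a translation is
  used here in place of a reflection.\<close>

lemma I_G_translated:
  assumes f: "f \<in> L2"
  shows "(\<integral>\<^sup>+ z. indicator (- sqr c (R + 1/4)) z *
     (\<integral>\<^sup>+ w. indicator (sqr c R) w * ennreal ((cmod (stft f (z - w)))\<^sup>2) \<partial>lborel) \<partial>lborel)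
   = ennreal (I_G (stft f) R)"
proof -
  note [measurable] = stft_measurable[OF f]
  let ?h = "\<lambda>z w. indicator (- sqr c (R + 1/4)) z * (indicator (sqr c R) w * ennreal ((cmod (stft f (z - w)))\<^sup>2))"
  let ?H = "\<lambda>w. indicator (sqr c R) w *
     (\<integral>\<^sup>+ z. indicator (- sqr c (R + 1/4)) z * ennreal ((cmod (stft f (z - w)))\<^sup>2) \<partial>lborel)"
  have ind: "indicator (sqr c S) (c + p) = (indicator (sqr (0, 0) S) p :: ennreal)"
    "indicator (- sqr c S) (c + p) = (indicator (- sqr (0, 0) S) p :: ennreal)" for S p
    by (simp_all add: indicator_def mem_sqr)
  have "(\<integral>\<^sup>+ z. indicator (- sqr c (R + 1/4)) z *
     (\<integral>\<^sup>+ w. indicator (sqr c R) w * ennreal ((cmod (stft f (z - w)))\<^sup>2) \<partial>lborel) \<partial>lborel)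
    = (\<integral>\<^sup>+ z. \<integral>\<^sup>+ w. ?h z w \<partial>lborel \<partial>lborel)"
    by (intro nn_integral_cong nn_integral_cmult[symmetric]) measurable
  also have "\<dots> = (\<integral>\<^sup>+ w. \<integral>\<^sup>+ z. ?h z w \<partial>lborel \<partial>lborel)"
    by (rule lborel_pair.Fubini') measurable
  also have "\<dots> = nn_integral lborel ?H"
  proof (rule nn_integral_cong)
    fix w
    have "(\<integral>\<^sup>+ z. ?h z w \<partial>lborel)
      = (\<integral>\<^sup>+ z. indicator (sqr c R) w * (indicator (- sqr c (R + 1/4)) z * ennreal ((cmod (stft f (z - w)))\<^sup>2)) \<partial>lborel)"
      by (intro nn_integral_cong) (simp add: mult_ac)
    also have "\<dots> = ?H w" by (rule nn_integral_cmult) measurable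
    finally show "(\<integral>\<^sup>+ z. ?h z w \<partial>lborel) = ?H w" .
  qed
  also have "\<dots> = (\<integral>\<^sup>+ p. ?H (c + p) \<partial>lborel)"
    by (rule nn_integral_lborel_shift[symmetric]) measurable
  also have "\<dots> = (\<integral>\<^sup>+ p. indicator (sqr (0, 0) R) p *
     (\<integral>\<^sup>+ q. indicator (- sqr (0, 0) (R + 1/4)) q * ennreal ((cmod (stft f (q - p)))\<^sup>2) \<partial>lborel) \<partial>lborel)"
  proof (rule nn_integral_cong)
    fix p
    have "(\<integral>\<^sup>+ z. indicator (- sqr c (R + 1/4)) z * ennreal ((cmod (stft f (z - (c + p))))\<^sup>2) \<partial>lborel)
      = (\<integral>\<^sup>+ q. indicator (- sqr c (R + 1/4)) (c + q) * ennreal ((cmod (stft f (c + q - (c + p))))\<^sup>2) \<partial>lborel)"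
      by (rule nn_integral_lborel_shift[symmetric]) measurable
    then show "?H (c + p) = indicator (sqr (0, 0) R) p *
     (\<integral>\<^sup>+ q. indicator (- sqr (0, 0) (R + 1/4)) q * ennreal ((cmod (stft f (q - p)))\<^sup>2) \<partial>lborel)"
      by (simp add: ind)
  qed
  finally show ?thesis by (simp add: I_G_eq_nn_integral[OF f])
qed

subsection \<open>The density bounds\<close>

lemma cmod_window_inner_tf_shift:
  assumes g: "g \<in> L2"
  shows "cmod (l2_inner (tf_shift window z) (tf_shift g l)) = cmod (stft g (z - l))"
  using psd_herm[OF psd_form_l2_inner tf_shift_L2[OF g, of l] tf_shift_L2[OF window_L2, of z]]
  by (simp add: stft_eq_inner[symmetric] cmod_stft_tf_shift)

lemma cmod_window_inner: "e \<in> L2 \<Longrightarrow> cmod (l2_inner (tf_shift window z) e) = cmod (stft e z)"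
  using psd_herm[OF psd_form_l2_inner, of e "tf_shift window z"]
  by (simp add: stft_eq_inner tf_shift_L2 window_L2)

lemma moyal_sum:
  assumes "\<And>i. i < n \<Longrightarrow> e i \<in> L2"
  shows "(\<integral>\<^sup>+ z. ennreal (\<Sum>i<n. (cmod (stft (e i) z))\<^sup>2) \<partial>lborel) = ennreal (\<Sum>i<n. (l2_norm (e i))\<^sup>2)"
proof -
  have "(\<integral>\<^sup>+ z. ennreal (\<Sum>i<n. (cmod (stft (e i) z))\<^sup>2) \<partial>lborel)
      = (\<integral>\<^sup>+ z. (\<Sum>i<n. ennreal ((cmod (stft (e i) z))\<^sup>2)) \<partial>lborel)"
    by simp
  also have "\<dots> = (\<Sum>i<n. (\<integral>\<^sup>+ z. ennreal ((cmod (stft (e i) z))\<^sup>2) \<partial>lborel))"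
  proof (rule nn_integral_sum)
    fix i assume "i \<in> {..<n}"
    then have [measurable]: "stft (e i) \<in> borel_measurable borel"
      using assms by (intro stft_measurable) auto
    show "(\<lambda>z. ennreal ((cmod (stft (e i) z))\<^sup>2)) \<in> borel_measurable lborel" by measurable
  qed
  also have "\<dots> = (\<Sum>i<n. ennreal ((l2_norm (e i))\<^sup>2))"
    using assms by (intro sum.cong refl moyal) auto
  finally show ?thesis by simp
qed

text \<open>Half-widths: the points lie within R, their small squares within R + 1/4, and
  \<open>I_G\<close> keeps a further gap of 1/4, which gives \<open>?Q\<close> half-width R + 1/2.
  The density is bounded by 1 on \<open>?Q\<close> and by the sampled transform divided by A
  outside.\<close>

lemma riesz_card_bound:
  assumes const: "stft_sampling_const \<delta> C" and \<delta>: "\<delta> > 0" and g: "g \<in> L2" and ud: "uniformly_discrete \<delta> \<Lambda>"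
    and riesz: "gabor_riesz_seq g \<Lambda> A B" and R: "R > 0"
  shows "real (card (\<Lambda> \<inter> sqr c R)) \<le> (2 * R + 1)\<^sup>2 + C / A * I_G (stft g) (R + 1/4)"
proof -
  note [measurable] = stft_measurable[OF g]
  have C: "C > 0" using const by (simp add: stft_sampling_const_def)
  define F where "F = \<Lambda> \<inter> sqr c R"
  have F: "finite F" "F \<subseteq> \<Lambda>" unfolding F_def using finite_uniformly_discrete_sqr[OF ud \<delta>] by auto
  let ?n = "card F" and ?g = "tf_shift g"
  have A: "A > 0" using riesz by (simp add: gabor_riesz_seq_def)
  have gL: "?g l \<in> L2" for l by (rule tf_shift_L2[OF g])
  have low: "A * (\<Sum>l\<in>F. (cmod (a l))\<^sup>2) \<le> (l2_norm (\<lambda>t. \<Sum>l\<in>F. a l * ?g l t))\<^sup>2" for a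
    using riesz F unfolding gabor_riesz_seq_def by blast
  obtain e where e: "\<And>i. i < ?n \<Longrightarrow> e i \<in> L2" and one: "\<And>i. i < ?n \<Longrightarrow> (l2_norm (e i))\<^sup>2 = 1"
    and span: "\<And>i. i < ?n \<Longrightarrow> e i \<in> lin_span ?g F" and N: "psd_form (bessel_defect e ?n)"
    using gram_schmidt[OF F(1) A gL low] by blast
  let ?s = "\<lambda>z. \<Sum>i<?n. (cmod (stft (e i) z))\<^sup>2"
  let ?Q = "sqr c (R + 1/2)"
  let ?I = "\<lambda>z. \<integral>\<^sup>+ w. indicator (sqr c (R + 1/4)) w * ennreal ((cmod (stft g (z - w)))\<^sup>2) \<partial>lborel"
  have s: "?s z = (\<Sum>i<?n. (cmod (l2_inner (tf_shift window z) (e i)))\<^sup>2)" for z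
    using e by (intro sum.cong) (auto simp: cmod_window_inner)
  have wL: "tf_shift window z \<in> L2" for z by (rule tf_shift_L2[OF window_L2])
  have s_le_1: "?s z \<le> 1" for z
    using psd_nonneg[OF N wL[of z]] unfolding Re_bessel_defect s
    by (simp add: l2_norm_tf_shift l2_norm_window)
  have s_le: "ennreal (?s z) \<le> ennreal (C / A) * ?I z" for z
  proof -
    have "A * ?s z \<le> (\<Sum>l\<in>F. (cmod (l2_inner (tf_shift window z) (?g l)))\<^sup>2)"
      unfolding s by (rule riesz_projection_bound[OF F(1) A gL low e span N wL])
    then have "?s z \<le> (1 / A) * (\<Sum>l\<in>F. (cmod (stft g (z - l)))\<^sup>2)"
      using A by (simp add: cmod_window_inner_tf_shift[OF g] field_simps)
    then have "ennreal (?s z) \<le> ennreal (1 / A) * ennreal (\<Sum>l\<in>F. (cmod (stft g (z - l)))\<^sup>2)"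
      using A by (subst ennreal_mult[symmetric]) (auto intro!: ennreal_leI sum_nonneg)
    also have "ennreal (\<Sum>l\<in>F. (cmod (stft g (z - l)))\<^sup>2) \<le> ennreal C * ?I z"
    proof (rule stft_sampling_bound[OF const g ud F])
      show "\<forall>l\<in>F. sqr l (min \<delta> 1 / 4) \<subseteq> sqr c (R + 1/4)"
      proof (intro ballI subsetI)
        fix l w assume l: "l \<in> F" and w: "w \<in> sqr l (min \<delta> 1 / 4)"
        have "l \<in> sqr c R" using l by (simp add: F_def)
        moreover have "min \<delta> 1 \<le> 1" by simp
        ultimately show "w \<in> sqr c (R + 1/4)" using w unfolding mem_sqr by linarith
      qed
    qed measurable
    finally show ?thesis using A C by (simp add: mult_left_mono ennreal_mult[symmetric] flip: mult.assoc)
  qed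
  have "ennreal (real ?n) = (\<integral>\<^sup>+ z. ennreal (?s z) \<partial>lborel)"
    using moyal_sum[of ?n e] e one by simp
  also have "\<dots> \<le> (\<integral>\<^sup>+ z. indicator ?Q z + ennreal (C / A) * (indicator (- ?Q) z * ?I z) \<partial>lborel)"
  proof (rule nn_integral_mono)
    fix z
    show "ennreal (?s z) \<le> indicator ?Q z + ennreal (C / A) * (indicator (- ?Q) z * ?I z)"
      using s_le[of z] s_le_1[of z] by (cases "z \<in> ?Q") (auto simp: ennreal_le_1)
  qed
  also have "\<dots> = (\<integral>\<^sup>+ z. indicator ?Q z \<partial>lborel) + ennreal (C / A) * (\<integral>\<^sup>+ z. indicator (- ?Q) z * ?I z \<partial>lborel)"
    by (subst nn_integral_add) (auto simp: nn_integral_cmult)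
  also have "(\<integral>\<^sup>+ z. indicator ?Q z \<partial>lborel) = ennreal ((2 * R + 1)\<^sup>2)"
    using R by (simp add: emeasure_sqr algebra_simps)
  also have "(\<integral>\<^sup>+ z. indicator (- ?Q) z * ?I z \<partial>lborel) = ennreal (I_G (stft g) (R + 1/4))"
    using I_G_translated[OF g, of c "R + 1/4"] by (simp add: algebra_simps)
  also have "ennreal ((2 * R + 1)\<^sup>2) + ennreal (C / A) * ennreal (I_G (stft g) (R + 1/4))
     = ennreal ((2 * R + 1)\<^sup>2 + C / A * I_G (stft g) (R + 1/4))"
    using A C I_G_nonneg by (simp add: ennreal_mult ennreal_plus del: times_divide_eq_left)
  finally show ?thesis
    using A C I_G_nonneg[of "stft g" "R + 1/4"] unfolding F_def[symmetric]
    by (subst (asm) ennreal_le_iff) (auto intro!: add_nonneg_nonneg)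
qed

text \<open>Products are absolutely summable because |x y| \<le> |x|^2 + |y|^2; this summability for
  all pairs is what makes the infinite sum additive in f.\<close>

lemma psd_form_infsum:
  assumes g: "\<And>l. l \<in> M \<Longrightarrow> g l \<in> L2"
    and summable: "\<And>f. f \<in> L2 \<Longrightarrow> (\<lambda>l. (cmod (l2_inner f (g l)))\<^sup>2) summable_on M"
  shows "psd_form (\<lambda>f h. \<Sum>\<^sub>\<infinity>l\<in>M. l2_inner f (g l) * cnj (l2_inner h (g l)))"
    and "f \<in> L2 \<Longrightarrow> Re (\<Sum>\<^sub>\<infinity>l\<in>M. l2_inner f (g l) * cnj (l2_inner f (g l)))
      = (\<Sum>\<^sub>\<infinity>l\<in>M. (cmod (l2_inner f (g l)))\<^sup>2)"
proof -
  have sum: "(\<lambda>l. l2_inner f (g l) * cnj (l2_inner h (g l))) summable_on M" if f: "f \<in> L2" and h: "h \<in> L2" for f h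
  proof (rule summable_on_iff_abs_summable_on_complex[THEN iffD2], rule Infinite_Sum.abs_summable_on_comparison_test')
    show "(\<lambda>l. (cmod (l2_inner f (g l)))\<^sup>2 + (cmod (l2_inner h (g l)))\<^sup>2) summable_on M"
      by (intro summable_on_add summable f h)
    fix l
    have "cmod (l2_inner f (g l)) * cmod (l2_inner h (g l)) \<le> (cmod (l2_inner f (g l)))\<^sup>2 + (cmod (l2_inner h (g l)))\<^sup>2"
      using zero_le_power2[of "cmod (l2_inner f (g l)) - cmod (l2_inner h (g l))"]
        zero_le_power2[of "cmod (l2_inner f (g l))"] zero_le_power2[of "cmod (l2_inner h (g l))"]
      unfolding power2_diff by linarith
    then show "norm (l2_inner f (g l) * cnj (l2_inner h (g l))) \<le> (cmod (l2_inner f (g l)))\<^sup>2 + (cmod (l2_inner h (g l)))\<^sup>2"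
      by (simp add: norm_mult)
  qed
  show self: "Re (\<Sum>\<^sub>\<infinity>l\<in>M. l2_inner f (g l) * cnj (l2_inner f (g l))) = (\<Sum>\<^sub>\<infinity>l\<in>M. (cmod (l2_inner f (g l)))\<^sup>2)"
    if f: "f \<in> L2" for f
    unfolding infsum_Re[OF sum[OF f f], symmetric] by (simp add: complex_mult_cnj cmod_power2)
  show "psd_form (\<lambda>f h. \<Sum>\<^sub>\<infinity>l\<in>M. l2_inner f (g l) * cnj (l2_inner h (g l)))"
    unfolding psd_form_def
  proof (intro conjI ballI allI)
    fix f h k assume L: "f \<in> L2" "h \<in> L2" "k \<in> L2"
    have "(\<Sum>\<^sub>\<infinity>l\<in>M. l2_inner (\<lambda>t. f t + h t) (g l) * cnj (l2_inner k (g l)))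
      = (\<Sum>\<^sub>\<infinity>l\<in>M. l2_inner f (g l) * cnj (l2_inner k (g l)) + l2_inner h (g l) * cnj (l2_inner k (g l)))"
      using L g by (intro infsum_cong) (simp add: psd_add[OF psd_form_l2_inner] distrib_right)
    also have "\<dots> = (\<Sum>\<^sub>\<infinity>l\<in>M. l2_inner f (g l) * cnj (l2_inner k (g l))) + (\<Sum>\<^sub>\<infinity>l\<in>M. l2_inner h (g l) * cnj (l2_inner k (g l)))"
      by (intro infsum_add sum L)
    finally show "(\<Sum>\<^sub>\<infinity>l\<in>M. l2_inner (\<lambda>t. f t + h t) (g l) * cnj (l2_inner k (g l)))
      = (\<Sum>\<^sub>\<infinity>l\<in>M. l2_inner f (g l) * cnj (l2_inner k (g l))) + (\<Sum>\<^sub>\<infinity>l\<in>M. l2_inner h (g l) * cnj (l2_inner k (g l)))" .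
  next
    fix a f h assume L: "f \<in> L2" "h \<in> L2"
    have "(\<Sum>\<^sub>\<infinity>l\<in>M. l2_inner (\<lambda>t. a * f t) (g l) * cnj (l2_inner h (g l)))
      = (\<Sum>\<^sub>\<infinity>l\<in>M. a * (l2_inner f (g l) * cnj (l2_inner h (g l))))"
      using L g by (intro infsum_cong) (simp add: psd_scale[OF psd_form_l2_inner] mult.assoc)
    also have "\<dots> = a * (\<Sum>\<^sub>\<infinity>l\<in>M. l2_inner f (g l) * cnj (l2_inner h (g l)))"
      by (rule infsum_cmult_right') 
    finally show "(\<Sum>\<^sub>\<infinity>l\<in>M. l2_inner (\<lambda>t. a * f t) (g l) * cnj (l2_inner h (g l)))
      = a * (\<Sum>\<^sub>\<infinity>l\<in>M. l2_inner f (g l) * cnj (l2_inner h (g l)))" .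
  next
    fix f h
    show "(\<Sum>\<^sub>\<infinity>l\<in>M. l2_inner h (g l) * cnj (l2_inner f (g l)))
      = cnj (\<Sum>\<^sub>\<infinity>l\<in>M. l2_inner f (g l) * cnj (l2_inner h (g l)))"
      unfolding infsum_cnj[symmetric] by (simp add: mult.commute)
  next
    fix f assume "f \<in> L2"
    then show "0 \<le> Re (\<Sum>\<^sub>\<infinity>l\<in>M. l2_inner f (g l) * cnj (l2_inner f (g l)))"
      by (simp add: self infsum_nonneg)
  qed
qed

text \<open>The half-widths now run inwards: points outside R have small squares outside R - 1/4,
  and z ranges over R - 1/2, the argument of \<open>I_G\<close>.\<close>

lemma frame_card_bound:
  assumes const: "stft_sampling_const \<delta> C" and \<delta>: "\<delta> > 0" and g: "g \<in> L2" and ud: "uniformly_discrete \<delta> \<Lambda>"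
    and frame: "gabor_frame g \<Lambda> A B" and R: "R > 1/2"
  shows "(2 * R - 1)\<^sup>2 - C / A * I_G (stft g) (R - 1/2) \<le> real (card (\<Lambda> \<inter> sqr c R))"
proof -
  note [measurable] = stft_measurable[OF g]
  have C: "C > 0" using const by (simp add: stft_sampling_const_def)
  define F where "F = \<Lambda> \<inter> sqr c R"
  have F: "finite F" "F \<subseteq> \<Lambda>" unfolding F_def using finite_uniformly_discrete_sqr[OF ud \<delta>] by auto
  let ?n = "card F" and ?g = "tf_shift g"
  have A: "A > 0" using frame by (simp add: gabor_frame_def)
  have gL: "?g l \<in> L2" for l by (rule tf_shift_L2[OF g])
  have summ: "(\<lambda>l. (cmod (l2_inner f (?g l)))\<^sup>2) summable_on \<Lambda>" if "f \<in> L2" for f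
    using frame that by (auto simp: gabor_frame_def)
  have summ': "(\<lambda>l. (cmod (l2_inner f (?g l)))\<^sup>2) summable_on (\<Lambda> - F)" if "f \<in> L2" for f
    by (rule summable_on_subset_banach[OF summ[OF that]]) auto
  define q where "q f h = (\<Sum>\<^sub>\<infinity>l\<in>\<Lambda> - F. l2_inner f (?g l) * cnj (l2_inner h (?g l)))" for f h
  have q: "psd_form q" unfolding q_def[abs_def] by (rule psd_form_infsum(1)[OF gL summ'])
  have Re_q: "Re (q f f) = (\<Sum>\<^sub>\<infinity>l\<in>\<Lambda> - F. (cmod (l2_inner f (?g l)))\<^sup>2)" if "f \<in> L2" for f
    unfolding q_def by (rule psd_form_infsum(2)[OF gL summ' that])
  have low: "A * (l2_norm f)\<^sup>2 \<le> Re (q f f) + (\<Sum>l\<in>F. (cmod (l2_inner f (?g l)))\<^sup>2)" if f: "f \<in> L2" for f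
  proof -
    have "A * (l2_norm f)\<^sup>2 \<le> (\<Sum>\<^sub>\<infinity>l\<in>\<Lambda>. (cmod (l2_inner f (?g l)))\<^sup>2)"
      using frame f by (auto simp: gabor_frame_def)
    also have "\<Lambda> = (\<Lambda> - F) \<union> F" using F(2) by blast
    also have "(\<Sum>\<^sub>\<infinity>l\<in>(\<Lambda> - F) \<union> F. (cmod (l2_inner f (?g l)))\<^sup>2)
       = (\<Sum>\<^sub>\<infinity>l\<in>\<Lambda> - F. (cmod (l2_inner f (?g l)))\<^sup>2) + (\<Sum>\<^sub>\<infinity>l\<in>F. (cmod (l2_inner f (?g l)))\<^sup>2)"
      using F(1) by (intro infsum_Un_disjoint summ' f) auto
    finally show ?thesis using F(1) by (simp add: Re_q[OF f])
  qed
  let ?Q = "sqr c (R - 1/2)"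
  let ?I = "\<lambda>z. \<integral>\<^sup>+ w. indicator (- sqr c (R - 1/4)) w * ennreal ((cmod (stft g (z - w)))\<^sup>2) \<partial>lborel"
  have wL: "tf_shift window z \<in> L2" for z by (rule tf_shift_L2[OF window_L2])
  \<comment> \<open>An infinite right side is trivial; a finite one bounds all finite partial sums
    and therefore the infinite sum.\<close>
  have q_le: "ennreal (Re (q (tf_shift window z) (tf_shift window z))) \<le> ennreal C * ?I z" for z
  proof (cases "ennreal C * ?I z")
    case (real x)
    have "(\<Sum>\<^sub>\<infinity>l\<in>\<Lambda> - F. (cmod (l2_inner (tf_shift window z) (?g l)))\<^sup>2) \<le> x"
    proof (rule infsum_le_finite_sums[OF summ'[OF wL]])
      fix E assume E: "finite E" "E \<subseteq> \<Lambda> - F"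
      have "ennreal (\<Sum>l\<in>E. (cmod (stft g (z - l)))\<^sup>2) \<le> ennreal C * ?I z"
      proof (rule stft_sampling_bound[OF const g ud E(1)])
        show "\<forall>l\<in>E. sqr l (min \<delta> 1 / 4) \<subseteq> - sqr c (R - 1/4)"
        proof (intro ballI subsetI)
          fix l w assume l: "l \<in> E" and w: "w \<in> sqr l (min \<delta> 1 / 4)"
          have "l \<notin> sqr c R" using l E unfolding F_def by auto
          moreover have "min \<delta> 1 \<le> 1" by simp
          ultimately show "w \<in> - sqr c (R - 1/4)" using w unfolding Compl_iff mem_sqr by linarith
        qed
      qed (use E in auto)
      then show "(\<Sum>l\<in>E. (cmod (l2_inner (tf_shift window z) (?g l)))\<^sup>2) \<le> x"
        using real by (simp add: cmod_window_inner_tf_shift[OF g])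
    qed
    then show ?thesis using real by (simp add: Re_q[OF wL])
  qed simp
  \<comment> \<open>The family \<open>e\<close> depends on \<eta>, so \<eta> is sent to 0 only in
    this numerical inequality, from which \<open>e\<close> has disappeared.\<close>
  have approx: "A * (2 * R - 1)\<^sup>2 \<le> A * real ?n + C * I_G (stft g) (R - 1/2) + \<eta> * (2 * R - 1)\<^sup>2" if \<eta>: "\<eta> > 0" for \<eta>
  proof -
    obtain e where e: "\<And>i. i < ?n \<Longrightarrow> e i \<in> L2" and le1: "\<And>i. i < ?n \<Longrightarrow> (l2_norm (e i))\<^sup>2 \<le> 1"
      and e_low: "\<And>f. f \<in> L2 \<Longrightarrow> A * Re (bessel_defect e ?n f f) - \<eta> * (l2_norm f)\<^sup>2 \<le> Re (q f f)"
      using lower_bound_off_finite_rank[OF F(1) q A \<eta> gL low] by blast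
    let ?s = "\<lambda>z. \<Sum>i<?n. (cmod (stft (e i) z))\<^sup>2"
    have [measurable]: "?s \<in> borel_measurable borel"
    proof (rule borel_measurable_sum)
      fix i assume "i \<in> {..<?n}"
      then have [measurable]: "stft (e i) \<in> borel_measurable borel"
        using e by (intro stft_measurable) auto
      show "(\<lambda>z. (cmod (stft (e i) z))\<^sup>2) \<in> borel_measurable borel" by measurable
    qed
    have s: "?s z = (\<Sum>i<?n. (cmod (l2_inner (tf_shift window z) (e i)))\<^sup>2)" for z
      using e by (intro sum.cong) (auto simp: cmod_window_inner)
    have pointwise: "ennreal A \<le> ennreal A * ennreal (?s z) + ennreal C * ?I z + ennreal \<eta>" for z
    proof -
      have "A \<le> A * ?s z + Re (q (tf_shift window z) (tf_shift window z)) + \<eta>"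
        using e_low[OF wL[of z]] unfolding Re_bessel_defect s
        by (simp add: l2_norm_tf_shift l2_norm_window algebra_simps)
      then have "ennreal A \<le> ennreal (A * ?s z + Re (q (tf_shift window z) (tf_shift window z)) + \<eta>)"
        by (rule ennreal_leI)
      also have "\<dots> = ennreal A * ennreal (?s z) + ennreal (Re (q (tf_shift window z) (tf_shift window z))) + ennreal \<eta>"
        using A \<eta> psd_nonneg[OF q wL[of z]] by (simp add: ennreal_plus ennreal_mult sum_nonneg)
      also have "\<dots> \<le> ennreal A * ennreal (?s z) + ennreal C * ?I z + ennreal \<eta>"
        by (intro add_mono q_le order_refl)
      finally show ?thesis .
    qed
    have area: "(\<integral>\<^sup>+ z. indicator ?Q z \<partial>lborel) = ennreal ((2 * R - 1)\<^sup>2)"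
      using R by (simp add: emeasure_sqr algebra_simps)
    have "ennreal (A * (2 * R - 1)\<^sup>2) = (\<integral>\<^sup>+ z. ennreal A * indicator ?Q z \<partial>lborel)"
      using A area by (simp add: nn_integral_cmult ennreal_mult)
    also have "\<dots> \<le> (\<integral>\<^sup>+ z. ennreal A * ennreal (?s z) + ennreal C * (indicator ?Q z * ?I z) + ennreal \<eta> * indicator ?Q z \<partial>lborel)"
    proof (rule nn_integral_mono)
      fix z
      show "ennreal A * indicator ?Q z \<le> ennreal A * ennreal (?s z) + ennreal C * (indicator ?Q z * ?I z) + ennreal \<eta> * indicator ?Q z"
        using pointwise[of z] by (cases "z \<in> ?Q") simp_all
    qed
    also have "\<dots> = ennreal A * (\<integral>\<^sup>+ z. ennreal (?s z) \<partial>lborel) + ennreal C * (\<integral>\<^sup>+ z. indicator ?Q z * ?I z \<partial>lborel)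
        + ennreal \<eta> * (\<integral>\<^sup>+ z. indicator ?Q z \<partial>lborel)"
      by (simp add: nn_integral_add nn_integral_cmult)
    also have "(\<integral>\<^sup>+ z. indicator ?Q z * ?I z \<partial>lborel) = ennreal (I_G (stft g) (R - 1/2))"
      using I_G_reflected[OF g, of c "R - 1/2"] by (simp add: algebra_simps)
    also have "(\<integral>\<^sup>+ z. ennreal (?s z) \<partial>lborel) = ennreal (\<Sum>i<?n. (l2_norm (e i))\<^sup>2)"
      by (rule moyal_sum[OF e])
    also have "ennreal A * ennreal (\<Sum>i<?n. (l2_norm (e i))\<^sup>2) \<le> ennreal A * ennreal (real ?n)"
    proof (intro mult_left_mono ennreal_leI)
      have "(\<Sum>i<?n. (l2_norm (e i))\<^sup>2) \<le> (\<Sum>i<?n. 1)"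
        using le1 by (intro sum_mono) simp
      then show "(\<Sum>i<?n. (l2_norm (e i))\<^sup>2) \<le> real ?n" by simp
    qed simp
    finally have "ennreal (A * (2 * R - 1)\<^sup>2) \<le> ennreal A * ennreal (real ?n) + ennreal C * ennreal (I_G (stft g) (R - 1/2))
        + ennreal \<eta> * ennreal ((2 * R - 1)\<^sup>2)"
      unfolding area by (simp add: add_right_mono)
    also have "\<dots> = ennreal (A * real ?n + C * I_G (stft g) (R - 1/2) + \<eta> * (2 * R - 1)\<^sup>2)"
      using A C \<eta> I_G_nonneg by (simp add: ennreal_plus ennreal_mult)
    finally show ?thesis
      using A C \<eta> I_G_nonneg[of "stft g" "R - 1/2"] by (subst (asm) ennreal_le_iff) (auto intro!: add_nonneg_nonneg)
  qed
  have "A * (2 * R - 1)\<^sup>2 \<le> A * real ?n + C * I_G (stft g) (R - 1/2)"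
  proof (rule field_le_epsilon)
    fix \<epsilon> :: real assume "\<epsilon> > 0"
    moreover have "(2 * R - 1)\<^sup>2 > 0" using R by simp
    ultimately show "A * (2 * R - 1)\<^sup>2 \<le> A * real ?n + C * I_G (stft g) (R - 1/2) + \<epsilon>"
      using approx[of "\<epsilon> / (2 * R - 1)\<^sup>2"] by simp
  qed
  then show ?thesis unfolding F_def[symmetric] using A by (simp add: field_simps)
qed

theorem theorem4:
  shows "(\<forall>\<delta>>0. \<forall>A B. \<exists>C>0. \<forall>g \<Lambda>.
            g \<in> L2 \<longrightarrow> uniformly_discrete \<delta> \<Lambda> \<longrightarrow> gabor_riesz_seq g \<Lambda> A B \<longrightarrow>
            (\<forall>R>0. \<forall>a b. real (card (\<Lambda> \<inter> sqr (a, b) R))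
                 \<le> (2 * R + 1)^2 + C * I_G (stft g) (R + 1/4)))
       \<and> (\<forall>\<delta>>0. \<forall>A B. \<exists>C>0. \<forall>g \<Lambda>.
            g \<in> L2 \<longrightarrow> uniformly_discrete \<delta> \<Lambda> \<longrightarrow> gabor_frame g \<Lambda> A B \<longrightarrow>
            (\<forall>R>1/2. \<forall>a b. real (card (\<Lambda> \<inter> sqr (a, b) R))
                 \<ge> (2 * R - 1)^2 - C * I_G (stft g) (R - 1/2)))"
proof (intro conjI allI impI)
  fix \<delta> A B :: real assume \<delta>: "\<delta> > 0"
  obtain C where const: "stft_sampling_const \<delta> C"
    using stft_sampling_const_exists[OF \<delta>] by blast
  then have C: "C > 0" by (simp add: stft_sampling_const_def)
  \<comment> \<open>A and B are quantified before the Riesz or frame hypothesis, so a positive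
    constant is due even for A \<le> 0; the value 1 is a placeholder for that case.\<close>
  define K where "K = (if A > 0 then C / A else 1)"
  have K: "K > 0" using C by (simp add: K_def)
  have "real (card (\<Lambda> \<inter> sqr (a, b) R)) \<le> (2 * R + 1)^2 + K * I_G (stft g) (R + 1/4)"
    if "g \<in> L2" "uniformly_discrete \<delta> \<Lambda>" "gabor_riesz_seq g \<Lambda> A B" "R > 0" for g \<Lambda> R a b
  proof -
    have "A > 0" using that(3) by (simp add: gabor_riesz_seq_def)
    then show ?thesis using riesz_card_bound[OF const \<delta> that, of "(a, b)"] by (simp add: K_def)
  qed
  then show "\<exists>C>0. \<forall>g \<Lambda>. g \<in> L2 \<longrightarrow> uniformly_discrete \<delta> \<Lambda> \<longrightarrow> gabor_riesz_seq g \<Lambda> A B \<longrightarrow>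
            (\<forall>R>0. \<forall>a b. real (card (\<Lambda> \<inter> sqr (a, b) R)) \<le> (2 * R + 1)^2 + C * I_G (stft g) (R + 1/4))"
    using K by blast
  have "real (card (\<Lambda> \<inter> sqr (a, b) R)) \<ge> (2 * R - 1)^2 - K * I_G (stft g) (R - 1/2)"
    if "g \<in> L2" "uniformly_discrete \<delta> \<Lambda>" "gabor_frame g \<Lambda> A B" "R > 1/2" for g \<Lambda> R a b
  proof -
    have "A > 0" using that(3) by (simp add: gabor_frame_def)
    then show ?thesis using frame_card_bound[OF const \<delta> that, of "(a, b)"] by (simp add: K_def)
  qed
  then show "\<exists>C>0. \<forall>g \<Lambda>. g \<in> L2 \<longrightarrow> uniformly_discrete \<delta> \<Lambda> \<longrightarrow> gabor_frame g \<Lambda> A B \<longrightarrow>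
            (\<forall>R>1/2. \<forall>a b. real (card (\<Lambda> \<inter> sqr (a, b) R)) \<ge> (2 * R - 1)^2 - C * I_G (stft g) (R - 1/2))"
    using K by blast
qed

end
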